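(* Let $V\to M$ be a representation of a Lie algebroid $A\Rightarrow M$. (i) Given any linear connection $\nabla$ on $V$, its $A$-invariance form $(T,\theta)$ is an IM form: $(T,\theta)\in\Omega^1_{im}(A;\operatorname{End}V)$. (ii) The set $\mathcal A_{\mathrm{inv}}(A;V)$ of $A$-invariant linear connections on $V$ is an affine space over the invariant endomorphism-valued 1-forms $\Omega^1_{\mathrm{inv}}(M;\operatorname{End}V)$. (iii) The cohomology class of the $A$-invariance form $(T,\theta)$ of a connection $\nabla$ on $V$ is independent of the choice of $\nabla$; denote it by $\mathrm{obs}_{\mathcal A_{\mathrm{inv}}(A;V)}=[(T,\theta)]\in H^{1,1}(A;\operatorname{End}V)$. (iv) An $A$-invariant connection on $V$ exists if and only if $\mathrm{obs}_{\mathcal A_{\mathrm{inv}}(A;V)}=0$.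
   Context: $A\Rightarrow M$ is a Lie algebroid with anchor $\rho$. A representation is a flat $A$-connection $\nabla^A$ on $V$; it induces a representation on $\operatorname{End}V$ by commutator. A linear connection $\nabla$ on $V$ is $A$-invariant if $\nabla^A_\alpha=\nabla_{\rho(\alpha)}$ and $\iota_{\rho(\alpha)}R^\nabla=0$ for all $\alpha\in A$. Its $A$-invariance form is the pair $(T,\theta)$, $$\theta\colon A\to\operatorname{End}(V),\ \theta(\alpha)=\nabla^A_\alpha-\nabla_{\rho(\alpha)},\qquad T\colon\Gamma(A)\to\Omega^1(M;\operatorname{End}V),\ T(\alpha)=d^\nabla\theta(\alpha)-\iota_{\rho(\alpha)}R^\nabla,$$ where $d^\nabla$ uses the induced connection on $\operatorname{End}V$. For a representation $W$ of $A$ (here $W=\operatorname{End}V$): $(\mathcal L^A_\alpha\gamma)(\underline X)=\nabla^A_\alpha(\gamma(\underline X))-\sum_j\gamma(\dots,[\rho(\alpha),X_j],\dots)$ for $\gamma\in\Omega^q(M;W)$. $\Omega^q_{im}(A;W)$ is the space of pairs $(c_0,c_1)$, $c_0\colon\Gamma(A)\to\Omega^q(M;W)$ $\mathbb R$-linear, $c_1\colon A\to\Lambda^{q-1}T^*M\otimes W$ a bundle map, with $c_0(f\alpha)=fc_0(\alpha)+df\wedge c_1(\alpha)$, $c_0[\alpha,\beta]=\mathcal L^A_\alpha c_0(\beta)-\mathcal L^A_\beta c_0(\alpha)$, $c_1[\alpha,\beta]=\mathcal L^A_\alpha(c_1(\beta))-\iota_{\rho(\beta)}c_0(\alpha)$,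 $\iota_{\rho(\alpha)}c_1(\beta)=-\iota_{\rho(\beta)}c_1(\alpha)$. For $\gamma\in\Omega^q(M;W)$, $(\delta^0\gamma)_0(\alpha)=\mathcal L^A_\alpha\gamma$, $(\delta^0\gamma)_1(\beta)=\iota_{\rho(\beta)}\gamma$; $\Omega^q_{\mathrm{inv}}(M;W)=\ker\delta^0$ and $H^{1,q}(A;W)=\Omega^q_{im}(A;W)/\operatorname{im}\delta^0$. Affine spaces are allowed to be empty. *)

theory Defs
  imports "HOL-Analysis.Analysis" "HOL-Library.Function_Algebras"
begin

text \<open>
  Fibres of bundles, derivations, sections, forms and connections are all functions or sets of
  functions, so functions into a real vector space are made a real vector space, pointwise.

  Convention used throughout: objects that only make sense on a carrier (functions and sections
  on \<open>M\<close>, linear maps on a fibre, operators on spaces of sections) are total functions that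
  are \<open>0\<close> off the carrier.  Hence equality of such objects is HOL equality.
\<close>

instantiation "fun" :: (type, real_vector) real_vector
begin

definition scaleR_fun :: "real \<Rightarrow> ('a \<Rightarrow> 'b) \<Rightarrow> 'a \<Rightarrow> 'b" where
  "scaleR_fun r f = (\<lambda>x. r *\<^sub>R f x)"

instance
  by standard (auto simp: scaleR_fun_def fun_eq_iff algebra_simps)

end

section \<open>Smooth manifolds\<close>

primrec Ck_on :: "nat \<Rightarrow> ('b::euclidean_space \<Rightarrow> 'c::real_normed_vector) \<Rightarrow> 'b set \<Rightarrow> bool" where
  "Ck_on 0 f S \<longleftrightarrow> continuous_on S f"
| "Ck_on (Suc k) f S \<longleftrightarrow>
     f differentiable_on S \<and> (\<forall>v. Ck_on k (\<lambda>x. frechet_derivative f (at x) v) S)"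

text \<open>Smoothness on an arbitrary subset: local extendability to a \<open>C\<^sup>\<infinity>\<close> map on an open set.
  For an open subset of a linear subspace this is the usual notion.\<close>

definition smooth_on :: "'b::euclidean_space set \<Rightarrow> ('b \<Rightarrow> 'c::real_normed_vector) \<Rightarrow> bool" where
  "smooth_on S f \<longleftrightarrow>
     (\<forall>x\<in>S. \<exists>U g. open U \<and> x \<in> U \<and> (\<forall>k. Ck_on k g U) \<and> (\<forall>y\<in>U \<inter> S. g y = f y))"

text \<open>The model is a linear subspace of a Euclidean space, the dimension of the manifold being the
  dimension of the subspace; in this way dimension \<open>0\<close> is included (a Lie algebra is a Lie
  algebroid over a point).\<close>

record ('m, 'b) manifold =
  mtop :: "'m topology"
  model :: "'b set"
  atlas :: "('m set \<times> ('m \<Rightarrow> 'b)) set"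

abbreviation points :: "('m, 'b) manifold \<Rightarrow> 'm set" where
  "points M \<equiv> topspace (mtop M)"

definition smooth_manifold :: "('m, 'b::euclidean_space) manifold \<Rightarrow> bool" where
  "smooth_manifold M \<longleftrightarrow>
     Hausdorff_space (mtop M) \<and> second_countable (mtop M) \<and> subspace (model M) \<and>
     (\<Union>(U, \<phi>)\<in>atlas M. U) = points M \<and>
     (\<forall>(U, \<phi>)\<in>atlas M.
        openin (mtop M) U \<and>
        openin (top_of_set (model M)) (\<phi> ` U) \<and>
        homeomorphic_map (subtopology (mtop M) U) (top_of_set (\<phi> ` U)) \<phi>) \<and>
     (\<forall>(U, \<phi>)\<in>atlas M. \<forall>(U', \<phi>')\<in>atlas M.
        smooth_on (\<phi> ` (U \<inter> U')) (\<phi>' \<circ> inv_into U \<phi>))"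

definition smooth_at_points ::
    "('m, 'b::euclidean_space) manifold \<Rightarrow> 'm set \<Rightarrow> ('m \<Rightarrow> real) \<Rightarrow> bool" where
  "smooth_at_points M W f \<longleftrightarrow>
     (\<forall>(U, \<phi>)\<in>atlas M. smooth_on (\<phi> ` (U \<inter> W)) (f \<circ> inv_into U \<phi>))"

definition smooth_functions :: "('m, 'b::euclidean_space) manifold \<Rightarrow> ('m \<Rightarrow> real) set" where
  "smooth_functions M =
     {f. (\<forall>x. x \<notin> points M \<longrightarrow> f x = 0) \<and> smooth_at_points M (points M) f}"

section \<open>Vector bundles\<close>

text \<open>A bundle is given by its fibres, which are linear subspaces of one ambient real vector space
  \<open>'e\<close> (e.g. of the direct sum of all fibres, so this is no restriction; the ambient space has no
  topology), and by its global smooth sections.  The latter encode the smooth structure: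
  \<open>vector_bundle\<close> requires them to be the sections that are smooth for an atlas of local frames
  with smooth transition functions.\<close>

record ('m, 'e) vbundle =
  fibre :: "'m \<Rightarrow> 'e set"
  sections :: "('m \<Rightarrow> 'e) set"

definition local_frame ::
    "('m, 'b::euclidean_space) manifold \<Rightarrow> ('m, 'e::real_vector, 'z) vbundle_scheme \<Rightarrow>
     nat \<Rightarrow> 'm set \<Rightarrow> (nat \<Rightarrow> 'm \<Rightarrow> 'e) \<Rightarrow> bool" where
  "local_frame M E k U e \<longleftrightarrow>
     openin (mtop M) U \<and>
     (\<forall>x\<in>U. inj_on (\<lambda>i. e i x) {..<k} \<and> independent ((\<lambda>i. e i x) ` {..<k}) \<and>
             span ((\<lambda>i. e i x) ` {..<k}) = fibre E x)"

definition smooth_wrt_frame ::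
    "('m, 'b::euclidean_space) manifold \<Rightarrow> nat \<Rightarrow> (nat \<Rightarrow> 'm \<Rightarrow> 'e::real_vector) \<Rightarrow>
     'm set \<Rightarrow> ('m \<Rightarrow> 'e) \<Rightarrow> bool" where
  "smooth_wrt_frame M k e W s \<longleftrightarrow>
     (\<exists>c. (\<forall>i<k. smooth_at_points M W (c i)) \<and> (\<forall>x\<in>W. s x = (\<Sum>i<k. c i x *\<^sub>R e i x)))"

definition vector_bundle ::
    "('m, 'b::euclidean_space) manifold \<Rightarrow> ('m, 'e::real_vector, 'z) vbundle_scheme \<Rightarrow> bool" where
  "vector_bundle M E \<longleftrightarrow>
     (\<exists>k \<F>.
        (\<forall>(U, e)\<in>\<F>. local_frame M E k U e) \<and>
        (\<Union>(U, e)\<in>\<F>. U) = points M \<and>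
        (\<forall>(U, e)\<in>\<F>. \<forall>(U', e')\<in>\<F>. \<forall>j<k. smooth_wrt_frame M k e (U \<inter> U') (e' j)) \<and>
        sections E =
          {s. (\<forall>x. x \<notin> points M \<longrightarrow> s x = 0) \<and> (\<forall>x\<in>points M. s x \<in> fibre E x) \<and>
              (\<forall>(U, e)\<in>\<F>. smooth_wrt_frame M k e U s)})"

definition smul :: "('m \<Rightarrow> real) \<Rightarrow> ('m \<Rightarrow> 'e::real_vector) \<Rightarrow> 'm \<Rightarrow> 'e" where
  "smul f s = (\<lambda>x. f x *\<^sub>R s x)"

text \<open>A global section through a given vector.  It is used to evaluate at a point of \<open>M\<close>
  expressions that are \<open>C\<^sup>\<infinity>(M)\<close>-linear in a section, and whose value at a point therefore
  depends only on the value of the section there.\<close>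

definition section_through :: "('m, 'e, 'z) vbundle_scheme \<Rightarrow> 'm \<Rightarrow> 'e \<Rightarrow> 'm \<Rightarrow> 'e" where
  "section_through E x e = (SOME s. s \<in> sections E \<and> s x = e)"

definition hom_space :: "'e::real_vector set \<Rightarrow> 'f::real_vector set \<Rightarrow> ('e \<Rightarrow> 'f) set" where
  "hom_space S T =
     {h. (\<forall>u\<in>S. h u \<in> T) \<and> (\<forall>u. u \<notin> S \<longrightarrow> h u = 0) \<and>
         (\<forall>u\<in>S. \<forall>v\<in>S. \<forall>a b. h (a *\<^sub>R u + b *\<^sub>R v) = a *\<^sub>R h u + b *\<^sub>R h v)}"

definition apply_section :: "('m \<Rightarrow> 'e \<Rightarrow> 'f) \<Rightarrow> ('m \<Rightarrow> 'e) \<Rightarrow> 'm \<Rightarrow> 'f" where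
  "apply_section h s = (\<lambda>x. h x (s x))"

text \<open>Bundle maps over the identity of \<open>M\<close>.  Here, and for forms below, smoothness of a family of
  fibrewise (multi)linear maps means that it takes smooth sections to smooth sections.\<close>

definition bundle_map ::
    "('m, 'b::euclidean_space) manifold \<Rightarrow> ('m, 'e::real_vector, 'y) vbundle_scheme \<Rightarrow>
     ('m, 'f::real_vector, 'z) vbundle_scheme \<Rightarrow> ('m \<Rightarrow> 'e \<Rightarrow> 'f) \<Rightarrow> bool" where
  "bundle_map M E F h \<longleftrightarrow>
     (\<forall>x\<in>points M. h x \<in> hom_space (fibre E x) (fibre F x)) \<and>
     (\<forall>x. x \<notin> points M \<longrightarrow> h x = 0) \<and>
     (\<forall>s\<in>sections E. apply_section h s \<in> sections F)"

definition End_bundle ::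
    "('m, 'b::euclidean_space) manifold \<Rightarrow> ('m, 'v::real_vector, 'z) vbundle_scheme \<Rightarrow>
     ('m, 'v \<Rightarrow> 'v) vbundle" where
  "End_bundle M V =
     \<lparr>fibre = (\<lambda>x. hom_space (fibre V x) (fibre V x)), sections = {h. bundle_map M V V h}\<rparr>"

section \<open>Lie algebroids\<close>

text \<open>Tangent vectors are point derivations of \<open>C\<^sup>\<infinity>(M)\<close>.\<close>

type_synonym 'm tvec = "('m \<Rightarrow> real) \<Rightarrow> real"

definition tangent_space :: "('m, 'b::euclidean_space) manifold \<Rightarrow> 'm \<Rightarrow> 'm tvec set" where
  "tangent_space M x =
     {v. (\<forall>f. f \<notin> smooth_functions M \<longrightarrow> v f = 0) \<and>
         (\<forall>f\<in>smooth_functions M. \<forall>g\<in>smooth_functions M.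
            (\<forall>a b. v (\<lambda>y. a * f y + b * g y) = a * v f + b * v g) \<and>
            v (\<lambda>y. f y * g y) = v f * g x + f x * v g)}"

definition derive_by :: "('m \<Rightarrow> 'm tvec) \<Rightarrow> ('m \<Rightarrow> real) \<Rightarrow> 'm \<Rightarrow> real" where
  "derive_by X f = (\<lambda>x. X x f)"

definition vector_fields :: "('m, 'b::euclidean_space) manifold \<Rightarrow> ('m \<Rightarrow> 'm tvec) set" where
  "vector_fields M =
     {X. (\<forall>x. x \<notin> points M \<longrightarrow> X x = 0) \<and> (\<forall>x\<in>points M. X x \<in> tangent_space M x) \<and>
         (\<forall>f\<in>smooth_functions M. derive_by X f \<in> smooth_functions M)}"

record ('m, 'a) algebroid = "('m, 'a) vbundle" +
  bracket :: "('m \<Rightarrow> 'a) \<Rightarrow> ('m \<Rightarrow> 'a) \<Rightarrow> 'm \<Rightarrow> 'a"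
  anchor :: "'m \<Rightarrow> 'a \<Rightarrow> 'm tvec"

definition tangent_algebroid ::
    "('m, 'b::euclidean_space) manifold \<Rightarrow> ('m, 'm tvec) algebroid" where
  "tangent_algebroid M =
     \<lparr>fibre = tangent_space M, sections = vector_fields M,
      bracket = (\<lambda>X Y x f. X x (derive_by Y f) - Y x (derive_by X f)),
      anchor = (\<lambda>x v. v)\<rparr>"

definition anchor_field :: "('m, 'a) algebroid \<Rightarrow> ('m \<Rightarrow> 'a) \<Rightarrow> 'm \<Rightarrow> 'm tvec" where
  "anchor_field A \<alpha> = apply_section (anchor A) \<alpha>"

definition lie_algebroid ::
    "('m, 'b::euclidean_space) manifold \<Rightarrow> ('m, 'a::real_vector) algebroid \<Rightarrow> bool" where
  "lie_algebroid M A \<longleftrightarrow>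
     vector_bundle M A \<and> bundle_map M A (tangent_algebroid M) (anchor A) \<and>
     (\<forall>\<alpha>\<in>sections A. \<forall>\<beta>\<in>sections A.
        bracket A \<alpha> \<beta> \<in> sections A \<and> bracket A \<alpha> \<beta> = - bracket A \<beta> \<alpha> \<and>
        (\<forall>\<gamma>\<in>sections A.
           (\<forall>a b. bracket A (a *\<^sub>R \<alpha> + b *\<^sub>R \<beta>) \<gamma> = a *\<^sub>R bracket A \<alpha> \<gamma> + b *\<^sub>R bracket A \<beta> \<gamma>) \<and>
           bracket A \<alpha> (bracket A \<beta> \<gamma>) + bracket A \<beta> (bracket A \<gamma> \<alpha>)
             + bracket A \<gamma> (bracket A \<alpha> \<beta>) = 0) \<and>
        (\<forall>f\<in>smooth_functions M.
           bracket A \<alpha> (smul f \<beta>) =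
             smul f (bracket A \<alpha> \<beta>) + smul (derive_by (anchor_field A \<alpha>) f) \<beta>))"

section \<open>Connections and representations\<close>

type_synonym ('m, 'a, 'v) covariant = "('m \<Rightarrow> 'a) \<Rightarrow> ('m \<Rightarrow> 'v) \<Rightarrow> 'm \<Rightarrow> 'v"

definition A_connection ::
    "('m, 'b::euclidean_space) manifold \<Rightarrow> ('m, 'a::real_vector) algebroid \<Rightarrow>
     ('m, 'v::real_vector, 'z) vbundle_scheme \<Rightarrow>
     ('m, 'a, 'v) covariant \<Rightarrow> bool" where
  "A_connection M A V D \<longleftrightarrow>
     (\<forall>\<alpha> s. \<alpha> \<notin> sections A \<or> s \<notin> sections V \<longrightarrow> D \<alpha> s = 0) \<and>
     (\<forall>\<alpha>\<in>sections A. \<forall>s\<in>sections V.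
        D \<alpha> s \<in> sections V \<and>
        (\<forall>\<beta>\<in>sections A. D (\<alpha> + \<beta>) s = D \<alpha> s + D \<beta> s) \<and>
        (\<forall>t\<in>sections V. \<forall>a b. D \<alpha> (a *\<^sub>R s + b *\<^sub>R t) = a *\<^sub>R D \<alpha> s + b *\<^sub>R D \<alpha> t) \<and>
        (\<forall>f\<in>smooth_functions M.
           D (smul f \<alpha>) s = smul f (D \<alpha> s) \<and>
           D \<alpha> (smul f s) = smul f (D \<alpha> s) + smul (derive_by (anchor_field A \<alpha>) f) s))"

definition curvature ::
    "('m, 'a) algebroid \<Rightarrow> ('m, 'a, 'v::real_vector) covariant \<Rightarrow>
     ('m \<Rightarrow> 'a) \<Rightarrow> ('m \<Rightarrow> 'a) \<Rightarrow> ('m \<Rightarrow> 'v) \<Rightarrow> 'm \<Rightarrow> 'v" where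
  "curvature A D \<alpha> \<beta> s = D \<alpha> (D \<beta> s) - D \<beta> (D \<alpha> s) - D (bracket A \<alpha> \<beta>) s"

definition representation ::
    "('m, 'b::euclidean_space) manifold \<Rightarrow> ('m, 'a::real_vector) algebroid \<Rightarrow>
     ('m, 'v::real_vector, 'z) vbundle_scheme \<Rightarrow>
     ('m, 'a, 'v) covariant \<Rightarrow> bool" where
  "representation M A V D \<longleftrightarrow>
     A_connection M A V D \<and>
     (\<forall>\<alpha>\<in>sections A. \<forall>\<beta>\<in>sections A. \<forall>s\<in>sections V. curvature A D \<alpha> \<beta> s = 0)"

abbreviation linear_connection ::
    "('m, 'b::euclidean_space) manifold \<Rightarrow> ('m, 'v::real_vector, 'z) vbundle_scheme \<Rightarrow>
     ('m, 'm tvec, 'v) covariant \<Rightarrow> bool" where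
  "linear_connection M V \<equiv> A_connection M (tangent_algebroid M) V"

text \<open>The induced connection on \<open>End V\<close>: \<open>(D\<^sub>\<alpha> h) s = D\<^sub>\<alpha> (h s) - h (D\<^sub>\<alpha> s)\<close>.\<close>

definition End_connection ::
    "('m, 'b::euclidean_space) manifold \<Rightarrow> ('m, 'a::real_vector) algebroid \<Rightarrow>
     ('m, 'v::real_vector, 'z) vbundle_scheme \<Rightarrow>
     ('m, 'a, 'v) covariant \<Rightarrow>
     ('m \<Rightarrow> 'a) \<Rightarrow> ('m \<Rightarrow> 'v \<Rightarrow> 'v) \<Rightarrow> 'm \<Rightarrow> 'v \<Rightarrow> 'v" where
  "End_connection M A V D \<alpha> h =
     (if \<alpha> \<in> sections A \<and> h \<in> sections (End_bundle M V)
      then (\<lambda>x e. if x \<in> points M \<and> e \<in> fibre V x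
                  then (let s = section_through V x e
                        in (D \<alpha> (apply_section h s) - apply_section h (D \<alpha> s)) x)
                  else 0)
      else 0)"

section \<open>Forms with values in a vector bundle\<close>

type_synonym ('m, 'w) vform = "'m \<Rightarrow> 'm tvec list \<Rightarrow> 'w"

text \<open>The bundle \<open>\<Lambda>\<^sup>qT\<^sup>*M \<otimes> W\<close>: a \<open>q\<close>-form at \<open>x\<close> is an alternating multilinear function of
  lists of \<open>q\<close> tangent vectors at \<open>x\<close>.\<close>

definition tangent_list :: "('m, 'b::euclidean_space) manifold \<Rightarrow> 'm \<Rightarrow> 'm tvec list \<Rightarrow> bool" where
  "tangent_list M x vs \<longleftrightarrow> x \<in> points M \<and> set vs \<subseteq> tangent_space M x"

definition alternating_forms ::
    "('m, 'b::euclidean_space) manifold \<Rightarrow> 'm \<Rightarrow> nat \<Rightarrow> 'w::real_vector set \<Rightarrow>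
     ('m tvec list \<Rightarrow> 'w) set" where
  "alternating_forms M x q S =
     {\<omega>. (\<forall>vs. \<not> (tangent_list M x vs \<and> length vs = q) \<longrightarrow> \<omega> vs = 0) \<and>
         (\<forall>vs. tangent_list M x vs \<and> length vs = q \<longrightarrow>
            \<omega> vs \<in> S \<and>
            (\<forall>i<q. \<forall>v\<in>tangent_space M x. \<forall>w\<in>tangent_space M x. \<forall>a b.
               \<omega> (vs[i := a *\<^sub>R v + b *\<^sub>R w]) = a *\<^sub>R \<omega> (vs[i := v]) + b *\<^sub>R \<omega> (vs[i := w])) \<and>
            (\<forall>i<q. \<forall>j<q. i \<noteq> j \<and> vs ! i = vs ! j \<longrightarrow> \<omega> vs = 0))}"

definition eval_form ::
    "('m, 'w) vform \<Rightarrow> ('m \<Rightarrow> 'm tvec) list \<Rightarrow> 'm \<Rightarrow> 'w" where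
  "eval_form \<gamma> Xs = (\<lambda>x. \<gamma> x (map (\<lambda>X. X x) Xs))"

definition form_bundle ::
    "('m, 'b::euclidean_space) manifold \<Rightarrow> nat \<Rightarrow> ('m, 'w::real_vector, 'z) vbundle_scheme \<Rightarrow>
     ('m, 'm tvec list \<Rightarrow> 'w) vbundle" where
  "form_bundle M q W =
     \<lparr>fibre = (\<lambda>x. alternating_forms M x q (fibre W x)),
      sections =
        {\<gamma>. (\<forall>x. x \<notin> points M \<longrightarrow> \<gamma> x = 0) \<and>
            (\<forall>x\<in>points M. \<gamma> x \<in> alternating_forms M x q (fibre W x)) \<and>
            (\<forall>Xs. length Xs = q \<and> set Xs \<subseteq> vector_fields M \<longrightarrow> eval_form \<gamma> Xs \<in> sections W)}\<rparr>"

abbreviation forms ::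
    "('m, 'b::euclidean_space) manifold \<Rightarrow> nat \<Rightarrow> ('m, 'w::real_vector, 'z) vbundle_scheme \<Rightarrow>
     ('m, 'w) vform set" where
  "forms M q W \<equiv> sections (form_bundle M q W)"

definition contract ::
    "('m \<Rightarrow> 'm tvec) \<Rightarrow> ('m, 'w) vform \<Rightarrow> ('m, 'w) vform" where
  "contract X \<gamma> = (\<lambda>x vs. \<gamma> x (X x # vs))"

text \<open>\<open>df \<and> \<eta>\<close>\<close>

definition d_wedge ::
    "('m, 'b::euclidean_space) manifold \<Rightarrow> ('m \<Rightarrow> real) \<Rightarrow>
     ('m, 'w::real_vector) vform \<Rightarrow> ('m, 'w) vform" where
  "d_wedge M f \<eta> = (\<lambda>x vs.
     if tangent_list M x vs
     then (\<Sum>i<length vs. ((-1) ^ i * (vs ! i) f) *\<^sub>R \<eta> x (take i vs @ drop (Suc i) vs))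
     else 0)"

definition lie_derivative ::
    "('m, 'b::euclidean_space) manifold \<Rightarrow> ('m, 'a::real_vector) algebroid \<Rightarrow>
     ('m, 'a, 'w::real_vector) covariant \<Rightarrow>
     ('m \<Rightarrow> 'a) \<Rightarrow> ('m, 'w) vform \<Rightarrow> ('m, 'w) vform" where
  "lie_derivative M A D \<alpha> \<gamma> = (\<lambda>x vs.
     if tangent_list M x vs
     then (let TM = tangent_algebroid M; Xs = map (section_through TM x) vs
           in D \<alpha> (eval_form \<gamma> Xs) x
              - (\<Sum>j<length Xs. eval_form \<gamma> (Xs[j := bracket TM (anchor_field A \<alpha>) (Xs ! j)]) x))
     else 0)"

section \<open>Infinitesimally multiplicative forms and their cohomology\<close>

type_synonym ('m, 'a, 'w) im_pair =
  "(('m \<Rightarrow> 'a) \<Rightarrow> ('m, 'w) vform) \<times> ('m \<Rightarrow> 'a \<Rightarrow> 'm tvec list \<Rightarrow> 'w)"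

text \<open>\<open>D\<close> is the representation of \<open>A\<close> on \<open>W\<close>.  For \<open>q = 0\<close> the form degree \<open>q - 1\<close> of the
  second component is to be read as \<open>-1\<close>, i.e. that component vanishes.\<close>

definition im_forms ::
    "('m, 'b::euclidean_space) manifold \<Rightarrow> ('m, 'a::real_vector) algebroid \<Rightarrow> nat \<Rightarrow>
     ('m, 'w::real_vector, 'z) vbundle_scheme \<Rightarrow> ('m, 'a, 'w) covariant \<Rightarrow>
     ('m, 'a, 'w) im_pair set" where
  "im_forms M A q W D =
     {(c0, c1).
        (\<forall>\<alpha>. \<alpha> \<notin> sections A \<longrightarrow> c0 \<alpha> = 0) \<and>
        (\<forall>\<alpha>\<in>sections A. c0 \<alpha> \<in> forms M q W) \<and>
        (\<forall>\<alpha>\<in>sections A. \<forall>\<beta>\<in>sections A. \<forall>a b.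
           c0 (a *\<^sub>R \<alpha> + b *\<^sub>R \<beta>) = a *\<^sub>R c0 \<alpha> + b *\<^sub>R c0 \<beta>) \<and>
        bundle_map M A (form_bundle M (q - 1) W) c1 \<and> (q = 0 \<longrightarrow> c1 = 0) \<and>
        (\<forall>\<alpha>\<in>sections A. \<forall>f\<in>smooth_functions M.
           c0 (smul f \<alpha>) = smul f (c0 \<alpha>) + d_wedge M f (apply_section c1 \<alpha>)) \<and>
        (\<forall>\<alpha>\<in>sections A. \<forall>\<beta>\<in>sections A.
           c0 (bracket A \<alpha> \<beta>) = lie_derivative M A D \<alpha> (c0 \<beta>) - lie_derivative M A D \<beta> (c0 \<alpha>) \<and>
           apply_section c1 (bracket A \<alpha> \<beta>) =
             lie_derivative M A D \<alpha> (apply_section c1 \<beta>) - contract (anchor_field A \<beta>) (c0 \<alpha>) \<and>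
           contract (anchor_field A \<alpha>) (apply_section c1 \<beta>) =
             - contract (anchor_field A \<beta>) (apply_section c1 \<alpha>))}"

definition delta0 ::
    "('m, 'b::euclidean_space) manifold \<Rightarrow> ('m, 'a::real_vector) algebroid \<Rightarrow>
     ('m, 'a, 'w::real_vector) covariant \<Rightarrow> ('m, 'w) vform \<Rightarrow>
     ('m, 'a, 'w) im_pair" where
  "delta0 M A D \<gamma> =
     (\<lambda>\<alpha>. if \<alpha> \<in> sections A then lie_derivative M A D \<alpha> \<gamma> else 0,
      \<lambda>x b. if x \<in> points M \<and> b \<in> fibre A x then (\<lambda>vs. \<gamma> x (anchor A x b # vs)) else 0)"

definition invariant_forms ::
    "('m, 'b::euclidean_space) manifold \<Rightarrow> ('m, 'a::real_vector) algebroid \<Rightarrow> nat \<Rightarrow>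
     ('m, 'w::real_vector, 'z) vbundle_scheme \<Rightarrow> ('m, 'a, 'w) covariant \<Rightarrow>
     ('m, 'w) vform set" where
  "invariant_forms M A q W D = {\<gamma> \<in> forms M q W. delta0 M A D \<gamma> = 0}"

definition cohomologous ::
    "('m, 'b::euclidean_space) manifold \<Rightarrow> ('m, 'a::real_vector) algebroid \<Rightarrow> nat \<Rightarrow>
     ('m, 'w::real_vector, 'z) vbundle_scheme \<Rightarrow> ('m, 'a, 'w) covariant \<Rightarrow>
     ('m, 'a, 'w) im_pair rel" where
  "cohomologous M A q W D =
     {(c, c'). c \<in> im_forms M A q W D \<and> c' \<in> im_forms M A q W D \<and>
               c - c' \<in> delta0 M A D ` forms M q W}"

text \<open>\<open>H\<^sup>1\<^sup>,\<^sup>q(A; W)\<close>, as the quotient set; its zero is the class of \<open>0\<close>.\<close>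

definition H1 ::
    "('m, 'b::euclidean_space) manifold \<Rightarrow> ('m, 'a::real_vector) algebroid \<Rightarrow> nat \<Rightarrow>
     ('m, 'w::real_vector, 'z) vbundle_scheme \<Rightarrow> ('m, 'a, 'w) covariant \<Rightarrow>
     ('m, 'a, 'w) im_pair set set" where
  "H1 M A q W D = im_forms M A q W D // cohomologous M A q W D"

definition im_class ::
    "('m, 'b::euclidean_space) manifold \<Rightarrow> ('m, 'a::real_vector) algebroid \<Rightarrow> nat \<Rightarrow>
     ('m, 'w::real_vector, 'z) vbundle_scheme \<Rightarrow> ('m, 'a, 'w) covariant \<Rightarrow>
     ('m, 'a, 'w) im_pair \<Rightarrow>
     ('m, 'a, 'w) im_pair set" where
  "im_class M A q W D c = cohomologous M A q W D `` {c}"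

section \<open>Invariant linear connections\<close>

definition curvature_form ::
    "('m, 'b::euclidean_space) manifold \<Rightarrow> ('m, 'v::real_vector, 'z) vbundle_scheme \<Rightarrow>
     ('m, 'm tvec, 'v) covariant \<Rightarrow> ('m, 'v \<Rightarrow> 'v) vform" where
  "curvature_form M V nabla = (\<lambda>x vs e.
     if tangent_list M x vs \<and> length vs = 2 \<and> e \<in> fibre V x
     then (let TM = tangent_algebroid M
           in curvature TM nabla (section_through TM x (vs ! 0)) (section_through TM x (vs ! 1))
                (section_through V x e) x)
     else 0)"

definition invariant_connections ::
    "('m, 'b::euclidean_space) manifold \<Rightarrow> ('m, 'a::real_vector) algebroid \<Rightarrow>
     ('m, 'v::real_vector, 'z) vbundle_scheme \<Rightarrow> ('m, 'a, 'v) covariant \<Rightarrow>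
     ('m, 'm tvec, 'v) covariant set" where
  "invariant_connections M A V D =
     {nabla. linear_connection M V nabla \<and>
         (\<forall>\<alpha>\<in>sections A. D \<alpha> = nabla (anchor_field A \<alpha>) \<and>
            contract (anchor_field A \<alpha>) (curvature_form M V nabla) = 0)}"

text \<open>The covariant exterior derivative \<open>(d\<^sup>\<nabla>h)(X) = \<nabla>\<^sub>X h\<close> of a section \<open>h\<close> of \<open>End V\<close>.\<close>

definition d_nabla ::
    "('m, 'b::euclidean_space) manifold \<Rightarrow> ('m, 'v::real_vector, 'z) vbundle_scheme \<Rightarrow>
     ('m, 'm tvec, 'v) covariant \<Rightarrow> ('m \<Rightarrow> 'v \<Rightarrow> 'v) \<Rightarrow>
     ('m, 'v \<Rightarrow> 'v) vform" where
  "d_nabla M V nabla h = (\<lambda>x vs.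
     if tangent_list M x vs \<and> length vs = 1
     then (let TM = tangent_algebroid M
           in End_connection M TM V nabla (section_through TM x (vs ! 0)) h x)
     else 0)"

definition invariance_theta ::
    "('m, 'b::euclidean_space) manifold \<Rightarrow> ('m, 'a::real_vector) algebroid \<Rightarrow>
     ('m, 'v::real_vector, 'z) vbundle_scheme \<Rightarrow> ('m, 'a, 'v) covariant \<Rightarrow>
     ('m, 'm tvec, 'v) covariant \<Rightarrow> 'm \<Rightarrow> 'a \<Rightarrow> 'v \<Rightarrow> 'v" where
  "invariance_theta M A V D nabla = (\<lambda>x a e.
     if x \<in> points M \<and> a \<in> fibre A x \<and> e \<in> fibre V x
     then (let \<alpha> = section_through A x a; s = section_through V x e
           in (D \<alpha> s - nabla (anchor_field A \<alpha>) s) x)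
     else 0)"

definition invariance_T ::
    "('m, 'b::euclidean_space) manifold \<Rightarrow> ('m, 'a::real_vector) algebroid \<Rightarrow>
     ('m, 'v::real_vector, 'z) vbundle_scheme \<Rightarrow> ('m, 'a, 'v) covariant \<Rightarrow>
     ('m, 'm tvec, 'v) covariant \<Rightarrow>
     ('m \<Rightarrow> 'a) \<Rightarrow> ('m, 'v \<Rightarrow> 'v) vform" where
  "invariance_T M A V D nabla \<alpha> =
     (if \<alpha> \<in> sections A
      then d_nabla M V nabla (apply_section (invariance_theta M A V D nabla) \<alpha>)
             - contract (anchor_field A \<alpha>) (curvature_form M V nabla)
      else 0)"

text \<open>The pair \<open>(T, \<theta>)\<close>.  An endomorphism is a \<open>0\<close>-form with values in \<open>End V\<close>, i.e. a function
  of the empty list of tangent vectors.\<close>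

definition invariance_form ::
    "('m, 'b::euclidean_space) manifold \<Rightarrow> ('m, 'a::real_vector) algebroid \<Rightarrow>
     ('m, 'v::real_vector, 'z) vbundle_scheme \<Rightarrow> ('m, 'a, 'v) covariant \<Rightarrow>
     ('m, 'm tvec, 'v) covariant \<Rightarrow>
     ('m, 'a, 'v \<Rightarrow> 'v) im_pair" where
  "invariance_form M A V D nabla =
     (invariance_T M A V D nabla,
      \<lambda>x a vs. if vs = [] then invariance_theta M A V D nabla x a else 0)"

text \<open>The class of the invariance form of a chosen linear connection.\<close>

definition obstruction ::
    "('m, 'b::euclidean_space) manifold \<Rightarrow> ('m, 'a::real_vector) algebroid \<Rightarrow>
     ('m, 'v::real_vector, 'z) vbundle_scheme \<Rightarrow> ('m, 'a, 'v) covariant \<Rightarrow>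
     ('m, 'a, 'v \<Rightarrow> 'v) im_pair set" where
  "obstruction M A V D =
     im_class M A 1 (End_bundle M V) (End_connection M A V D)
       (invariance_form M A V D (SOME nabla. linear_connection M V nabla))"

text \<open>Translation of a linear connection by an \<open>End V\<close>-valued \<open>1\<close>-form:
  \<open>(\<nabla> + \<gamma>)\<^sub>X s = \<nabla>\<^sub>X s + \<gamma>(X) s\<close>.\<close>

definition translate_connection ::
    "('m, 'b::euclidean_space) manifold \<Rightarrow> ('m, 'v::real_vector, 'z) vbundle_scheme \<Rightarrow>
     ('m, 'm tvec, 'v) covariant \<Rightarrow>
     ('m, 'v \<Rightarrow> 'v) vform \<Rightarrow> ('m \<Rightarrow> 'm tvec) \<Rightarrow> ('m \<Rightarrow> 'v) \<Rightarrow> 'm \<Rightarrow> 'v" where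
  "translate_connection M V nabla \<gamma> = (\<lambda>X s.
     if X \<in> vector_fields M \<and> s \<in> sections V
     then nabla X s + apply_section (eval_form \<gamma> [X]) s
     else 0)"

text \<open>\<open>P\<close> is an affine space, possibly empty, over the vector space \<open>S\<close> acting by \<open>tr\<close>.\<close>

definition affine_space_over :: "'p set \<Rightarrow> 'v::real_vector set \<Rightarrow> ('p \<Rightarrow> 'v \<Rightarrow> 'p) \<Rightarrow> bool" where
  "affine_space_over P S tr \<longleftrightarrow>
     subspace S \<and>
     (\<forall>p\<in>P. tr p 0 = p \<and>
        (\<forall>u\<in>S. tr p u \<in> P \<and> (\<forall>v\<in>S. tr (tr p u) v = tr p (u + v))) \<and>
        (\<forall>p'\<in>P. \<exists>!u. u \<in> S \<and> tr p u = p'))"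

end

theory Submission
  imports Defs
begin

text \<open>A linear connection \<open>\<nabla>\<close> on \<open>V\<close> behaves like a one-form whose coboundary, taken relative to \<open>\<nabla>\<^sup>A\<close>, is
\<open>-(T, \<theta>)\<close>.  To see this, read
\<open>\<nabla>\<^sub>X\<close> and the flat operators \<open>\<nabla>\<^sup>A\<^sub>\<alpha>\<close> as operators on the sections of \<open>V\<close>.  Since \<open>\<theta>(\<alpha>)\<close> is the difference of
\<open>\<nabla>\<^sup>A\<^sub>\<alpha>\<close> and \<open>\<nabla>\<^sub>\<rho>\<^sub>\<alpha>\<close>, the commutators of \<open>\<nabla>\<^sub>X\<close> and \<open>\<nabla>\<^sub>\<rho>\<^sub>\<alpha>\<close> in \<open>d\<^sup>\<nabla>\<theta>(\<alpha>)\<close> and in \<open>\<iota>\<^sub>\<rho>\<^sub>\<alpha>R\<^sup>\<nabla>\<close> cancel, and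
  \<open>T(\<alpha>)(X) = [\<nabla>\<^sub>X, \<nabla>\<^sup>A\<^sub>\<alpha>] + \<nabla>\<^bsub>[\<rho>\<alpha>, X]\<^esub>\<close>
remains (\<open>invariance_T_apply\<close>): formally, minus the Lie derivative of \<open>\<nabla>\<close> along \<open>\<alpha>\<close>.  In this form the
equations of an IM form are identities between commutators.  They follow from the Jacobi identity,
the flatness of \<open>\<nabla>\<^sup>A\<close> and the fact that the anchor preserves brackets (\<open>rho_bracket\<close>), and they are
collected in \<open>invariance_form_im\<close>.

The other parts rest on three facts.  Replacing \<open>\<nabla>\<close> by \<open>\<nabla> + \<gamma>\<close> changes \<open>(T, \<theta>)\<close> by \<open>-\<delta>\<^sup>0\<gamma>\<close>
(\<open>inv_form_translate\<close>); any two linear connections differ by a unique \<open>\<gamma>\<close> (\<open>tr_exists\<close>, \<open>tr_inj\<close>); and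
\<open>\<nabla>\<close> is invariant if and only if \<open>(T, \<theta>) = 0\<close> (\<open>invariant_iff\<close>).  Hence two invariant connections differ by
a \<open>\<gamma>\<close> with \<open>\<delta>\<^sup>0\<gamma> = 0\<close>, the class of \<open>(T, \<theta>)\<close> does not depend on \<open>\<nabla>\<close>, and if \<open>(T, \<theta>) = \<delta>\<^sup>0\<gamma>\<close> then \<open>\<nabla> + \<gamma>\<close> is
invariant.

Two facts from differential geometry have to be supplied first.  Curvature, \<open>\<theta>\<close> and the Lie derivative
are evaluated at a point by choosing global sections through given vectors, so such sections must
exist and the result must not depend on them.  The locale \<open>section_module\<close> isolates what is needed, and
\<open>tensorial_at\<close> draws the conclusion.  Vector bundles satisfy the locale by cutting off local frames; for
the tangent bundle, whose elements are derivations, this takes Hadamard's lemma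
(\<open>tangent_expansion\<close>).  Moreover the obstruction is the class of the form of a chosen connection, so
that a linear connection has to exist; \<open>connection_exists\<close> glues local ones.\<close>

section \<open>Functions of class \<open>C\<^sup>k\<close>\<close>

lemma Ck_on_cong:
  assumes "open S" "\<And>x. x \<in> S \<Longrightarrow> f x = g x" "Ck_on k f S"
  shows "Ck_on k g S"
  using assms(2,3)
proof (induction k arbitrary: f g)
  case 0
  then show ?case by (auto cong: continuous_on_cong)
next
  case (Suc k)
  have fd: "(g has_derivative D) (at x)" if "x \<in> S" "(f has_derivative D) (at x)" for x D
    by (rule has_derivative_transform_within_open[OF that(2) assms(1) that(1)]) (use Suc.prems(1) in auto)
  have df: "f differentiable (at x)" if "x \<in> S" for x
    using Suc.prems(2) that differentiable_on_eq_differentiable_at[OF assms(1)] by auto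
  have "g differentiable (at x)" if "x \<in> S" for x
    using df[OF that] fd[OF that] unfolding differentiable_def by fast
  then have "g differentiable_on S"
    using differentiable_on_eq_differentiable_at[OF assms(1)] by auto
  moreover have "frechet_derivative f (at x) = frechet_derivative g (at x)" if "x \<in> S" for x
    by (rule frechet_derivative_at[OF fd[OF that iffD1[OF frechet_derivative_works df[OF that]]]])
  ultimately show ?case
    using Suc.prems(2) Suc.IH[of "\<lambda>x. frechet_derivative f (at x) v" "\<lambda>x. frechet_derivative g (at x) v" for v]
    by auto
qed

lemma Ck_on_derivative:
  assumes "Ck_on (Suc k) f S" "open S" "x \<in> S"
  shows "(f has_derivative frechet_derivative f (at x)) (at x)"
proof -
  have "f differentiable (at x)"
    using assms differentiable_on_eq_differentiable_at by auto
  then show ?thesis by (rule iffD1[OF frechet_derivative_works])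
qed

text \<open>Lets a derivative found by the usual rules stand for the one selected by \<^const>\<open>frechet_derivative\<close>.\<close>

lemma Ck_on_SucI:
  assumes "open S" "\<And>x. x \<in> S \<Longrightarrow> (f has_derivative f' x) (at x)"
    "\<And>v. Ck_on k (\<lambda>x. f' x v) S"
  shows "Ck_on (Suc k) f S"
proof -
  have "f differentiable_on S"
    using differentiable_on_eq_differentiable_at[OF assms(1)] assms(2) differentiableI by blast
  moreover have "Ck_on k (\<lambda>x. frechet_derivative f (at x) v) S" for v
    by (rule Ck_on_cong[OF assms(1) _ assms(3)[of v]])
       (use assms(2) frechet_derivative_at in metis)
  ultimately show ?thesis by simp
qed

lemma Ck_on_SucD:
  assumes "Ck_on (Suc k) f S"
  shows "Ck_on k f S"
  using assms
proof (induction k arbitrary: f)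
  case 0
  then show ?case by (simp add: differentiable_imp_continuous_on)
qed auto

lemma Ck_on_continuous: "Ck_on k f S \<Longrightarrow> continuous_on S f"
  by (cases k) (auto simp: differentiable_imp_continuous_on)

lemma Ck_on_subset: "Ck_on k f S \<Longrightarrow> T \<subseteq> S \<Longrightarrow> Ck_on k f T"
  by (induction k arbitrary: f) (auto intro: continuous_on_subset differentiable_on_subset)

lemma Ck_on_local:
  assumes "open S" "\<And>x. x \<in> S \<Longrightarrow> \<exists>U. open U \<and> x \<in> U \<and> Ck_on k f U"
  shows "Ck_on k f S"
  using assms(2)
proof (induction k arbitrary: f)
  case 0
  then have "continuous (at x) f" if "x \<in> S" for x
    using that by (metis Ck_on.simps(1) continuous_on_eq_continuous_at)
  then show ?case by (simp add: continuous_at_imp_continuous_on)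
next
  case (Suc k)
  have "f differentiable (at x)" if "x \<in> S" for x
    using Suc.prems[OF that] Ck_on_derivative differentiableI by metis
  then have "f differentiable_on S"
    by (simp add: differentiable_at_imp_differentiable_on)
  moreover have "Ck_on k (\<lambda>x. frechet_derivative f (at x) v) S" for v
    by (rule Suc.IH) (use Suc.prems in fastforce)
  ultimately show ?case by simp
qed

lemma Ck_on_const [simp]: "open S \<Longrightarrow> Ck_on k (\<lambda>x. c) S"
  by (induction k arbitrary: c) (auto intro!: Ck_on_SucI derivative_eq_intros simp del: Ck_on.simps(2))

lemma Ck_on_bounded_linear:
  assumes "open S" "bounded_linear f"
  shows "Ck_on k f S"
proof (cases k)
  case 0
  then show ?thesis using assms by (simp add: linear_continuous_on)
next
  case (Suc j)
  have "Ck_on (Suc j) f S"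
    by (rule Ck_on_SucI[where f' = "\<lambda>_. f"])
       (use assms in \<open>auto intro: bounded_linear_imp_has_derivative\<close>)
  then show ?thesis by (simp only: Suc)
qed

lemma Ck_on_add:
  assumes "open S" "Ck_on k f S" "Ck_on k g S"
  shows "Ck_on k (\<lambda>x. f x + g x) S"
  using assms(2,3)
proof (induction k arbitrary: f g)
  case 0
  then show ?case by (simp add: continuous_on_add)
next
  case (Suc k)
  show ?case
    by (rule Ck_on_SucI[OF assms(1) has_derivative_add[OF
          Ck_on_derivative[OF Suc.prems(1) assms(1)] Ck_on_derivative[OF Suc.prems(2) assms(1)]]])
       (use Suc.prems in \<open>auto intro!: Suc.IH\<close>)
qed

lemma Ck_on_scaleR:
  assumes "open S" "Ck_on k f S" "Ck_on k g S"
  shows "Ck_on k (\<lambda>x. f x *\<^sub>R g x) S"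
  using assms(2,3)
proof (induction k arbitrary: f g)
  case 0
  then show ?case by (simp add: continuous_on_scaleR)
next
  case (Suc k)
  show ?case
    by (rule Ck_on_SucI[OF assms(1) has_derivative_scaleR[OF
          Ck_on_derivative[OF Suc.prems(1) assms(1)] Ck_on_derivative[OF Suc.prems(2) assms(1)]]])
       (use Suc.prems Suc.prems[THEN Ck_on_SucD] in \<open>auto intro!: Suc.IH Ck_on_add[OF assms(1)]\<close>)
qed

lemma Ck_on_mult:
  fixes f g :: "'b::euclidean_space \<Rightarrow> real"
  shows "open S \<Longrightarrow> Ck_on k f S \<Longrightarrow> Ck_on k g S \<Longrightarrow> Ck_on k (\<lambda>x. f x * g x) S"
  using Ck_on_scaleR[of S k f g] by simp

lemma Ck_on_sum:
  assumes "open S" "\<And>i. i \<in> I \<Longrightarrow> Ck_on k (f i) S"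
  shows "Ck_on k (\<lambda>x. \<Sum>i\<in>I. f i x) S"
  using assms(2) by (induction I rule: infinite_finite_induct) (auto simp: assms(1) intro: Ck_on_add)

text \<open>A directional derivative of \<open>g \<circ> h\<close> is a sum of products of a component of a derivative of \<open>h\<close> and of
a partial derivative of \<open>g\<close> composed with \<open>h\<close>.  The induction hypothesis is used for the partial
derivatives of \<open>g\<close>, with the same \<open>h\<close>.\<close>

lemma Ck_on_compose:
  fixes h :: "'c::euclidean_space \<Rightarrow> 'b::euclidean_space"
  assumes "open S" "open T" "h ` S \<subseteq> T" "Ck_on k h S" "Ck_on k g T"
  shows "Ck_on k (\<lambda>x. g (h x)) S"
  using assms(4,5)
proof (induction k arbitrary: g)
  case 0
  then show ?case
    using continuous_on_compose2[of T g S h] assms(3) by simp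
next
  case (Suc k)
  let ?Dg = "\<lambda>y. frechet_derivative g (at y)" and ?Dh = "\<lambda>x. frechet_derivative h (at x)"
  have dg: "(g has_derivative ?Dg (h x)) (at (h x))" if "x \<in> S" for x
    using Ck_on_derivative[OF Suc.prems(2) assms(2)] assms(3) that by blast
  have d: "((\<lambda>x. g (h x)) has_derivative (\<lambda>v. \<Sum>b\<in>Basis. (?Dh x v \<bullet> b) *\<^sub>R ?Dg (h x) b)) (at x)"
    if "x \<in> S" for x
  proof -
    have "((\<lambda>x. g (h x)) has_derivative (\<lambda>v. ?Dg (h x) (?Dh x v))) (at x)"
      using diff_chain_at[OF Ck_on_derivative[OF Suc.prems(1) assms(1) that] dg[OF that]]
      by (simp add: o_def)
    moreover have "?Dg (h x) w = (\<Sum>b\<in>Basis. (w \<bullet> b) *\<^sub>R ?Dg (h x) b)" for w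
    proof -
      have lin: "linear (?Dg (h x))" using dg[OF that] has_derivative_linear by blast
      have "?Dg (h x) w = ?Dg (h x) (\<Sum>b\<in>Basis. (w \<bullet> b) *\<^sub>R b)" by (simp add: euclidean_representation)
      also have "\<dots> = (\<Sum>b\<in>Basis. (w \<bullet> b) *\<^sub>R ?Dg (h x) b)"
        using lin by (simp add: linear_sum linear_scale)
      finally show ?thesis .
    qed
    ultimately show ?thesis by (metis (no_types, lifting) ext)
  qed
  have "Ck_on k (\<lambda>x. ?Dh x v \<bullet> b) S" for v b
  proof -
    have "Ck_on k (\<lambda>x. ?Dh x v) S" using Suc.prems(1) by simp
    then show ?thesis
    proof (induction k arbitrary: h v)
      case 0
      then show ?case by (simp add: continuous_on_inner)
    next
      case (Suc k)
      show ?case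
        by (rule Ck_on_SucI[OF assms(1) has_derivative_inner_left[OF Ck_on_derivative[OF Suc.prems assms(1)]]])
           (use Suc in auto)
    qed
  qed
  moreover have "Ck_on k (\<lambda>x. ?Dg (h x) b) S" for b
    by (rule Suc.IH) (use Suc.prems Ck_on_SucD in auto)
  ultimately show ?case
    by (intro Ck_on_SucI[OF assms(1) d] Ck_on_sum Ck_on_scaleR assms(1)) auto
qed

lemma Ck_on_inverse:
  fixes f :: "'b::euclidean_space \<Rightarrow> real"
  assumes "open S" "Ck_on k f S" "\<And>x. x \<in> S \<Longrightarrow> f x \<noteq> 0"
  shows "Ck_on k (\<lambda>x. inverse (f x)) S"
  using assms(2)
proof (induction k)
  case 0
  then show ?case using assms(3) by (auto intro: continuous_on_inverse)
next
  case (Suc k)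
  have c: "Ck_on k (\<lambda>x. inverse (f x)) S" using Suc Ck_on_SucD by blast
  show ?case
  proof (rule Ck_on_SucI[OF assms(1) Deriv.has_derivative_inverse[OF assms(3)
          Ck_on_derivative[OF Suc.prems assms(1)]]])
    fix v
    have "Ck_on k (\<lambda>x. (- 1) * ((inverse (f x) * frechet_derivative f (at x) v) * inverse (f x))) S"
      using Suc.prems by (intro Ck_on_mult Ck_on_const assms(1) c) auto
    then show "Ck_on k (\<lambda>x. - (inverse (f x) * frechet_derivative f (at x) v * inverse (f x))) S" by simp
  qed auto
qed

section \<open>A smooth bump function\<close>

text \<open>For \<open>p = 1\<close> this is the flat function \<open>exp (-1/t)\<close>.  The polynomial factor makes the family closed under
differentiation, so that one induction over all \<open>p\<close> gives every order of smoothness.\<close>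

definition flat_exp :: "real poly \<Rightarrow> real \<Rightarrow> real" where
  "flat_exp p t = (if t > 0 then poly p (1 / t) * exp (- (1 / t)) else 0)"

lemma poly_div_exp_tendsto_0: "((\<lambda>y::real. poly p y * exp (- y)) \<longlongrightarrow> 0) at_top"
proof -
  have "((\<lambda>y. \<Sum>i\<le>degree p. coeff p i * (y ^ i / exp y)) \<longlongrightarrow> (\<Sum>i\<le>degree p. coeff p i * 0)) at_top"
    by (intro tendsto_sum tendsto_mult tendsto_const tendsto_power_div_exp_0)
  then show ?thesis by (simp add: poly_altdef sum_divide_distrib exp_minus divide_inverse mult.assoc sum_distrib_right)
qed

lemma flat_exp_derivative:
  "(flat_exp p has_real_derivative flat_exp ([:0, 0, 1:] * (p - pderiv p)) t) (at t)"
proof (cases t "0::real" rule: linorder_cases)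
  case greater
  have "((\<lambda>t. poly p (1 / t) * exp (- (1 / t))) has_real_derivative
      flat_exp ([:0, 0, 1:] * (p - pderiv p)) t) (at t)"
    using greater
    by (auto intro!: derivative_eq_intros DERIV_chain'[where g = "poly p"] poly_DERIV
        simp: flat_exp_def field_simps power2_eq_square)
  then show ?thesis
    by (rule has_field_derivative_transform_within_open[where S = "{0<..}"])
       (use greater in \<open>auto simp: flat_exp_def\<close>)
next
  case less
  have "((\<lambda>t. 0) has_real_derivative 0) (at t)" by simp
  then have "(flat_exp p has_real_derivative 0) (at t)"
    by (rule has_field_derivative_transform_within_open[where S = "{..<0}"])
       (use less in \<open>auto simp: flat_exp_def\<close>)
  then show ?thesis using less by (simp add: flat_exp_def)
next
  case equal
  have "((\<lambda>h. poly ([:0, 1:] * p) (inverse h) * exp (- inverse h)) \<longlongrightarrow> 0) (at_right 0)"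
    by (rule filterlim_compose[OF poly_div_exp_tendsto_0 filterlim_inverse_at_top_right])
  then have "((\<lambda>h. flat_exp p h / h) \<longlongrightarrow> 0) (at_right 0)"
    by (rule Lim_transform_eventually)
       (auto simp: flat_exp_def eventually_at_right_less field_simps intro!: eventually_at_right_less[THEN eventually_mono])
  moreover have "((\<lambda>h. flat_exp p h / h) \<longlongrightarrow> 0) (at_left 0)"
    by (rule Lim_transform_eventually[OF tendsto_const])
       (auto simp: flat_exp_def eventually_at_filter)
  ultimately have "((\<lambda>h. flat_exp p h / h) \<longlongrightarrow> 0) (at 0)"
    by (simp add: filterlim_split_at)
  then show ?thesis using equal by (simp add: DERIV_def flat_exp_def)
qed

lemma Ck_on_flat_exp: "Ck_on k (flat_exp p) UNIV"
proof (induction k arbitrary: p)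
  case 0
  then show ?case
    by (simp add: continuous_at_imp_continuous_on DERIV_isCont[OF flat_exp_derivative])
next
  case (Suc k)
  show ?case
    by (rule Ck_on_SucI[where f' = "\<lambda>t v. flat_exp ([:0, 0, 1:] * (p - pderiv p)) t * v"])
       (use flat_exp_derivative Suc.IH in
         \<open>auto simp: has_field_derivative_def intro!: Ck_on_mult\<close>)
qed

text \<open>The quotient \<open>\<beta>(t) / (\<beta>(t) + \<beta>(1 - t))\<close>, where \<open>\<beta>(t) = exp (-1/t)\<close> for positive \<open>t\<close> and \<open>0\<close> otherwise.\<close>

lemma smooth_step:
  "\<exists>\<sigma>::real \<Rightarrow> real. (\<forall>k. Ck_on k \<sigma> UNIV) \<and> (\<forall>t\<le>0. \<sigma> t = 0) \<and> (\<forall>t\<ge>1. \<sigma> t = 1)"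
proof -
  define \<sigma> where "\<sigma> t = flat_exp 1 t * inverse (flat_exp 1 t + flat_exp 1 (1 - t))" for t
  have pos: "flat_exp 1 t + flat_exp 1 (1 - t) \<noteq> 0" for t
    by (auto simp: flat_exp_def add_nonneg_eq_0_iff)
  have "Ck_on k (\<lambda>t. flat_exp 1 (1 - t)) UNIV" for k
  proof -
    have "Ck_on k (\<lambda>t::real. 1 + (- 1) * t) UNIV"
      by (intro Ck_on_add Ck_on_mult Ck_on_const Ck_on_bounded_linear) auto
    then show ?thesis
      using Ck_on_compose[of UNIV UNIV "\<lambda>t. 1 - t" k "flat_exp 1"] Ck_on_flat_exp by simp
  qed
  then have "Ck_on k \<sigma> UNIV" for k
    unfolding \<sigma>_def using pos by (intro Ck_on_mult Ck_on_inverse Ck_on_add Ck_on_flat_exp) auto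
  moreover have "\<sigma> t = 0" if "t \<le> 0" for t using that by (simp add: \<sigma>_def flat_exp_def)
  moreover have "\<sigma> t = 1" if "t \<ge> 1" for t using that pos[of t] by (simp add: \<sigma>_def flat_exp_def)
  ultimately show ?thesis by blast
qed

lemma smooth_bump:
  fixes p :: "'b::euclidean_space"
  assumes "r > 0"
  shows "\<exists>\<beta>::'b \<Rightarrow> real. \<exists>\<delta>>0. (\<forall>k. Ck_on k \<beta> UNIV) \<and> (\<forall>z\<in>ball p \<delta>. \<beta> z = 1) \<and> (\<forall>z. z \<notin> cball p r \<longrightarrow> \<beta> z = 0)"
proof -
  obtain \<sigma> :: "real \<Rightarrow> real" where \<sigma>: "\<And>k. Ck_on k \<sigma> UNIV" "\<And>t. t \<le> 0 \<Longrightarrow> \<sigma> t = 0" "\<And>t. t \<ge> 1 \<Longrightarrow> \<sigma> t = 1"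
    using smooth_step by blast
  \<comment> \<open>The step function is applied to \<open>2 - 2 |z - p|\<^sup>2 / r\<^sup>2\<close>, which is at least 1 on the ball of radius \<open>r / 2\<close>.\<close>
  let ?q = "\<lambda>z. 2 + (- 2 / r^2) * (\<Sum>b\<in>Basis. ((z - p) \<bullet> b) * ((z - p) \<bullet> b))"
  have q: "?q z = 2 - 2 * (dist p z)^2 / r^2" for z
  proof -
    have "(dist p z)^2 = (z - p) \<bullet> (z - p)"
      by (metis dist_commute dist_norm power2_norm_eq_inner)
    also have "\<dots> = (\<Sum>b\<in>Basis. ((z - p) \<bullet> b) * ((z - p) \<bullet> b))"
      by (rule euclidean_inner)
    finally show ?thesis by simp
  qed
  have "Ck_on k (\<lambda>z. (z - p) \<bullet> b) UNIV" for k b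
  proof -
    have "Ck_on k (\<lambda>z. z \<bullet> b + (- (p \<bullet> b))) UNIV"
      by (intro Ck_on_add Ck_on_const Ck_on_bounded_linear) (auto intro: bounded_linear_inner_left)
    then show ?thesis by (simp add: inner_diff_left)
  qed
  then have "Ck_on k ?q UNIV" for k
    by (intro Ck_on_add Ck_on_mult Ck_on_sum Ck_on_const) auto
  then have "Ck_on k (\<lambda>z. \<sigma> (?q z)) UNIV" for k
    using Ck_on_compose[of UNIV UNIV ?q k \<sigma>] \<sigma>(1) by simp
  moreover have "\<sigma> (?q z) = 1" if "z \<in> ball p (r / 2)" for z
  proof (rule \<sigma>(3))
    have "(dist p z)^2 \<le> (r / 2)^2" using that by (intro power_mono) auto
    then have "(dist p z)^2 * 4 \<le> r^2" by (simp add: power_divide)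
    then have "2 * (dist p z)^2 \<le> r^2" using zero_le_power2[of "dist p z"] by linarith
    then show "1 \<le> ?q z" unfolding q using assms by (simp add: field_simps)
  qed
  moreover have "\<sigma> (?q z) = 0" if "z \<notin> cball p r" for z
  proof (rule \<sigma>(2))
    have "r^2 \<le> (dist p z)^2" using that assms by (intro power_mono) auto
    then show "?q z \<le> 0" unfolding q using assms by (simp add: field_simps)
  qed
  ultimately show ?thesis using assms by (intro exI[of _ "\<lambda>z. \<sigma> (?q z)"] exI[of _ "r / 2"]) auto
qed

section \<open>Hadamard's lemma\<close>

lemma segment_in_ball:
  fixes p :: "'b::euclidean_space"
  assumes "z \<in> ball p r" "t \<in> {0..1}"
  shows "p + t *\<^sub>R (z - p) \<in> ball p r"
proof -
  have "norm (t *\<^sub>R (z - p)) \<le> norm (z - p)" using assms(2) by (simp add: mult_left_le_one_le)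
  then show ?thesis using assms(1) by (simp add: dist_norm norm_minus_commute)
qed

lemma continuous_on_segments:
  fixes p :: "'b::euclidean_space" and F :: "'b \<Rightarrow> real"
  assumes "continuous_on (ball p r) F"
  shows "continuous_on (ball p r \<times> {0..1}) (\<lambda>(z, t). t ^ m * F (p + t *\<^sub>R (z - p)))"
proof -
  have "continuous_on (ball p r \<times> {0..1}) (\<lambda>x. F (p + snd x *\<^sub>R (fst x - p)))"
    by (rule continuous_on_compose2[OF assms]) (auto intro!: continuous_intros dest: segment_in_ball simp del: mem_ball)
  then show ?thesis by (auto simp: split_beta intro!: continuous_intros)
qed

text \<open>A directional derivative of the integral is a combination of integrals of the same kind, with a
partial derivative in place of \<open>F\<close> and \<open>m + 1\<close> in place of \<open>m\<close>.  The power of \<open>t\<close> is there to make this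
induction close.\<close>

lemma Ck_on_segment_integral:
  fixes p :: "'b::euclidean_space" and F :: "'b \<Rightarrow> real"
  assumes "Ck_on k F (ball p r)"
  shows "Ck_on k (\<lambda>z. integral {0..1} (\<lambda>t. t ^ m * F (p + t *\<^sub>R (z - p)))) (ball p r)"
  using assms
proof (induction k arbitrary: F m)
  case 0
  then show ?case
    using integral_continuous_on_param[of "ball p r" 0 1 "\<lambda>z t. t ^ m * F (p + t *\<^sub>R (z - p))"]
      continuous_on_segments[of p r F m] by (simp add: box_real)
next
  case (Suc k)
  let ?D = "\<lambda>b z. frechet_derivative F (at z) b"
  let ?G = "\<lambda>b z. integral {0..1} (\<lambda>t. t ^ Suc m * ?D b (p + t *\<^sub>R (z - p)))"
  have Dc: "Ck_on k (?D b) (ball p r)" for b using Suc.prems by simp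
  define fx :: "'b \<Rightarrow> real \<Rightarrow> 'b \<Rightarrow>\<^sub>L real" where
    "fx z t = (\<Sum>b\<in>Basis. (t ^ Suc m * ?D b (p + t *\<^sub>R (z - p))) *\<^sub>R blinfun_inner_left b)" for z t
  have fx_apply: "blinfun_apply (fx z t) v = (\<Sum>b\<in>Basis. (t ^ Suc m * ?D b (p + t *\<^sub>R (z - p))) * (v \<bullet> b))" for z t v
    by (simp add: fx_def blinfun.sum_left blinfun.scaleR_left inner_commute)
  note F' = Ck_on_derivative[OF Suc.prems open_ball]
  have fx: "((\<lambda>z. t ^ m * F (p + t *\<^sub>R (z - p))) has_derivative blinfun_apply (fx z t)) (at z within ball p r)"
    if "z \<in> ball p r" "t \<in> cbox 0 1" for z t
  proof -
    let ?y = "p + t *\<^sub>R (z - p)"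
    have y: "?y \<in> ball p r" using segment_in_ball that by (simp add: box_real)
    have lin: "linear (frechet_derivative F (at ?y))"
      using F'[OF y] has_derivative_linear by blast
    have "((\<lambda>z. p + t *\<^sub>R (z - p)) has_derivative (\<lambda>v. t *\<^sub>R v)) (at z)"
      by (auto intro!: derivative_eq_intros)
    from diff_chain_at[OF this F'[OF y]]
    have "((\<lambda>z. F (p + t *\<^sub>R (z - p))) has_derivative (\<lambda>v. frechet_derivative F (at ?y) (t *\<^sub>R v))) (at z)"
      by (simp add: o_def)
    then have d: "((\<lambda>z. t ^ m * F (p + t *\<^sub>R (z - p))) has_derivative (\<lambda>v. t ^ m * frechet_derivative F (at ?y) (t *\<^sub>R v))) (at z)"
      by (auto intro!: derivative_eq_intros)
    have "t ^ m * frechet_derivative F (at ?y) (t *\<^sub>R v) = blinfun_apply (fx z t) v" for v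
    proof -
      have "frechet_derivative F (at ?y) v = frechet_derivative F (at ?y) (\<Sum>b\<in>Basis. (v \<bullet> b) *\<^sub>R b)"
        by (simp add: euclidean_representation)
      also have "\<dots> = (\<Sum>b\<in>Basis. (v \<bullet> b) * ?D b ?y)" using lin by (simp add: linear_sum linear_scale)
      finally show ?thesis using lin
        by (simp add: fx_apply linear_scale sum_distrib_left algebra_simps)
    qed
    then show ?thesis using d by (metis (no_types, lifting) ext has_derivative_at_withinI)
  qed
  have cont: "continuous_on (ball p r \<times> cbox 0 1) (\<lambda>(z, t). fx z t)"
  proof -
    have "continuous_on (ball p r \<times> {0..1}) (\<lambda>x. snd x ^ Suc m * ?D b (p + snd x *\<^sub>R (fst x - p)))" for b
      using continuous_on_segments[OF Ck_on_continuous[OF Dc[of b]], of "Suc m"] by (simp add: split_beta)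
    then show ?thesis unfolding fx_def split_beta box_real
      by (intro continuous_on_sum continuous_on_scaleR continuous_on_const)
  qed
  have cont_t: "continuous_on {0..1} (\<lambda>t. t ^ i * H (p + t *\<^sub>R (z - p)))"
    if "z \<in> ball p r" "continuous_on (ball p r) H" for z i and H :: "'b \<Rightarrow> real"
    by (intro continuous_intros continuous_on_compose2[OF that(2)])
       (use segment_in_ball[OF that(1)] in auto)
  have der: "((\<lambda>z. integral {0..1} (\<lambda>t. t ^ m * F (p + t *\<^sub>R (z - p)))) has_derivative
      (\<lambda>v. \<Sum>b\<in>Basis. ?G b z * (v \<bullet> b))) (at z)" if "z \<in> ball p r" for z
  proof -
    have "((\<lambda>z. integral (cbox 0 1) (\<lambda>t. t ^ m * F (p + t *\<^sub>R (z - p)))) has_derivative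
        blinfun_apply (integral (cbox 0 1) (fx z))) (at z within ball p r)"
      by (rule leibniz_rule[OF fx _ cont that])
         (use Ck_on_continuous[OF Suc.prems] cont_t in \<open>auto simp: box_real intro!: integrable_continuous_real\<close>)
    moreover have "blinfun_apply (integral (cbox 0 1) (fx z)) v = (\<Sum>b\<in>Basis. ?G b z * (v \<bullet> b))" for v
    proof -
      have "continuous_on {0..1} (fx z)"
        unfolding fx_def
        by (intro continuous_on_sum continuous_on_scaleR cont_t[OF that Ck_on_continuous[OF Dc]] continuous_on_const)
      then have "fx z integrable_on {0..1}" by (rule integrable_continuous_real)
      then have "blinfun_apply (integral {0..1} (fx z)) v = integral {0..1} (\<lambda>t. blinfun_apply (fx z t) v)"
        by (rule blinfun_apply_integral)
      also have "\<dots> = (\<Sum>b\<in>Basis. integral {0..1} (\<lambda>t. (t ^ Suc m * ?D b (p + t *\<^sub>R (z - p))) * (v \<bullet> b)))"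
        unfolding fx_apply
        by (intro integral_sum integrable_continuous_real continuous_on_mult cont_t[OF that Ck_on_continuous[OF Dc]] continuous_on_const) auto
      also have "\<dots> = (\<Sum>b\<in>Basis. ?G b z * (v \<bullet> b))" by simp
      finally show ?thesis by (simp add: box_real)
    qed
    then have "blinfun_apply (integral (cbox 0 1) (fx z)) = (\<lambda>v. \<Sum>b\<in>Basis. ?G b z * (v \<bullet> b))"
      by (rule ext)
    ultimately show ?thesis
      by (simp only: at_within_open[OF that open_ball] interval_cbox)
  qed
  show ?case
    by (rule Ck_on_SucI[OF open_ball der]) (auto intro!: Ck_on_sum Ck_on_mult Suc.IH Dc simp del: power_Suc)
qed

text \<open>Integrate the derivative of \<open>t \<mapsto> f (p + t (z - p))\<close> over the unit interval.\<close>

lemma Hadamard: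
  fixes p :: "'b::euclidean_space" and f :: "'b \<Rightarrow> real"
  assumes "r > 0" and f: "\<And>k. Ck_on k f (ball p r)"
  shows "\<exists>g. \<forall>b. (\<forall>k. Ck_on k (g b) (ball p r)) \<and> g b p = frechet_derivative f (at p) b \<and>
           (\<forall>z\<in>ball p r. f z = f p + (\<Sum>b\<in>Basis. ((z - p) \<bullet> b) * g b z))"
proof -
  let ?D = "\<lambda>b z. frechet_derivative f (at z) b"
  define g where "g b z = integral {0..1} (\<lambda>t. t ^ 0 * ?D b (p + t *\<^sub>R (z - p)))" for b z
  have D: "Ck_on k (?D b) (ball p r)" for k b using f[of "Suc k"] by simp
  have "f z = f p + (\<Sum>b\<in>Basis. ((z - p) \<bullet> b) * g b z)" if z: "z \<in> ball p r" for z
  proof -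
    have c: "continuous_on {0..1} (\<lambda>t. ?D b (p + t *\<^sub>R (z - p)))" for b
      by (intro continuous_intros continuous_on_compose2[OF Ck_on_continuous[OF D]])
         (use segment_in_ball[OF z] in auto)
    have "((\<lambda>t. f (p + t *\<^sub>R (z - p))) has_vector_derivative (\<Sum>b\<in>Basis. ((z - p) \<bullet> b) * ?D b (p + t *\<^sub>R (z - p))))
        (at t within {0..1})" if "t \<in> {0..1}" for t
    proof -
      let ?y = "p + t *\<^sub>R (z - p)"
      have F': "(f has_derivative frechet_derivative f (at ?y)) (at ?y)"
        using Ck_on_derivative[OF f[of "Suc 0"] open_ball segment_in_ball[OF z that]] .
      have lin: "linear (frechet_derivative f (at ?y))" using F' has_derivative_linear by blast
      have "((\<lambda>t. p + t *\<^sub>R (z - p)) has_derivative (\<lambda>h. h *\<^sub>R (z - p))) (at t)"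
        by (auto intro!: derivative_eq_intros)
      from diff_chain_at[OF this F']
      have "((\<lambda>t. f (p + t *\<^sub>R (z - p))) has_derivative (\<lambda>h. h *\<^sub>R frechet_derivative f (at ?y) (z - p))) (at t)"
        using lin by (simp add: o_def linear_scale)
      moreover have "frechet_derivative f (at ?y) (z - p) = (\<Sum>b\<in>Basis. ((z - p) \<bullet> b) * ?D b ?y)"
      proof -
        have "frechet_derivative f (at ?y) (z - p) = frechet_derivative f (at ?y) (\<Sum>b\<in>Basis. ((z - p) \<bullet> b) *\<^sub>R b)"
          by (simp only: euclidean_representation)
        also have "\<dots> = (\<Sum>b\<in>Basis. ((z - p) \<bullet> b) * ?D b ?y)" using lin by (simp add: linear_sum linear_scale)
        finally show ?thesis .
      qed
      ultimately show ?thesis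
        by (simp add: has_vector_derivative_def has_derivative_at_withinI)
    qed
    then have "((\<lambda>t. \<Sum>b\<in>Basis. ((z - p) \<bullet> b) * ?D b (p + t *\<^sub>R (z - p))) has_integral f z - f p) {0..1}"
      using fundamental_theorem_of_calculus[of 0 1 "\<lambda>t. f (p + t *\<^sub>R (z - p))"] by simp
    then have "f z - f p = integral {0..1} (\<lambda>t. \<Sum>b\<in>Basis. ((z - p) \<bullet> b) * ?D b (p + t *\<^sub>R (z - p)))"
      by (simp add: integral_unique)
    also have "\<dots> = (\<Sum>b\<in>Basis. integral {0..1} (\<lambda>t. ((z - p) \<bullet> b) * ?D b (p + t *\<^sub>R (z - p))))"
      by (intro integral_sum integrable_continuous_real continuous_on_mult c continuous_on_const) auto
    also have "\<dots> = (\<Sum>b\<in>Basis. ((z - p) \<bullet> b) * g b z)" by (simp add: g_def)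
    finally show ?thesis by simp
  qed
  moreover have "Ck_on k (g b) (ball p r)" for k b
    using Ck_on_segment_integral[OF D, where m = 0] by (simp add: g_def[abs_def])
  moreover have "g b p = ?D b p" for b by (simp add: g_def)
  ultimately show ?thesis by blast
qed

section \<open>Smooth functions on a manifold\<close>

lemma smooth_on_const: "smooth_on S (\<lambda>x. c)"
  unfolding smooth_on_def using Ck_on_const open_UNIV by blast

lemma smooth_on_add_mult:
  fixes f g :: "'b::euclidean_space \<Rightarrow> real"
  assumes "smooth_on S f" "smooth_on S g"
  shows "smooth_on S (\<lambda>x. f x + g x)" "smooth_on S (\<lambda>x. f x * g x)"
proof -
  have "\<exists>U h. open U \<and> x \<in> U \<and> (\<forall>k. Ck_on k h U) \<and> (\<forall>y\<in>U \<inter> S. h y = f y + g y)"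
    "\<exists>U h. open U \<and> x \<in> U \<and> (\<forall>k. Ck_on k h U) \<and> (\<forall>y\<in>U \<inter> S. h y = f y * g y)" if "x \<in> S" for x
  proof -
    obtain U f' U' g' where "open U" "x \<in> U" "\<forall>k. Ck_on k f' U" "\<forall>y\<in>U \<inter> S. f' y = f y"
      "open U'" "x \<in> U'" "\<forall>k. Ck_on k g' U'" "\<forall>y\<in>U' \<inter> S. g' y = g y"
      using assms \<open>x \<in> S\<close> unfolding smooth_on_def by metis
    then show "\<exists>U h. open U \<and> x \<in> U \<and> (\<forall>k. Ck_on k h U) \<and> (\<forall>y\<in>U \<inter> S. h y = f y + g y)"
      "\<exists>U h. open U \<and> x \<in> U \<and> (\<forall>k. Ck_on k h U) \<and> (\<forall>y\<in>U \<inter> S. h y = f y * g y)"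
      by (intro exI[of _ "U \<inter> U'"] exI[of _ "\<lambda>x. f' x + g' x"] exI[of _ "\<lambda>x. f' x * g' x"];
          auto intro!: Ck_on_add Ck_on_mult intro: Ck_on_subset)+
  qed
  then show "smooth_on S (\<lambda>x. f x + g x)" "smooth_on S (\<lambda>x. f x * g x)"
    by (simp_all add: smooth_on_def)
qed

lemma smooth_on_cong:
  assumes "smooth_on S f" "\<And>x. x \<in> S \<Longrightarrow> f x = g x"
  shows "smooth_on S g"
proof -
  have "(\<forall>y\<in>U \<inter> S. h y = f y) \<longleftrightarrow> (\<forall>y\<in>U \<inter> S. h y = g y)" for U h
    using assms(2) by auto
  then show ?thesis using assms(1) unfolding smooth_on_def by simp
qed

lemma smooth_on_subset:
  assumes "smooth_on S f" "T \<subseteq> S" shows "smooth_on T f"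
  unfolding smooth_on_def
proof
  fix x assume "x \<in> T"
  then obtain U g where "open U" "x \<in> U" "\<forall>k. Ck_on k g U" "\<forall>y\<in>U \<inter> S. g y = f y"
    using assms(1)[unfolded smooth_on_def, rule_format, OF subsetD[OF assms(2)]] by blast
  then show "\<exists>U g. open U \<and> x \<in> U \<and> (\<forall>k. Ck_on k g U) \<and> (\<forall>y\<in>U \<inter> T. g y = f y)"
    using assms(2) by (intro exI[of _ U] exI[of _ g]) auto
qed

lemma projection_onto_subspace:
  fixes L :: "'b::euclidean_space set"
  assumes "subspace L"
  shows "\<exists>P. linear P \<and> range P \<subseteq> L \<and> (\<forall>v\<in>L. P v = v)"
  using linear_exists_left_inverse_on[OF linear_id assms] by auto

locale smooth_mfd =
  fixes M :: "('m, 'b::euclidean_space) manifold"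
  assumes mfd: "smooth_manifold M"
begin

abbreviation "Cinf \<equiv> smooth_functions M"
abbreviation "Vect \<equiv> vector_fields M"

lemma chart_open: "(U, \<phi>) \<in> atlas M \<Longrightarrow> openin (mtop M) U"
  using mfd unfolding smooth_manifold_def by blast

lemma chart_subset: "(U, \<phi>) \<in> atlas M \<Longrightarrow> U \<subseteq> points M"
  using chart_open openin_subset by blast

lemma chart_exists: "x \<in> points M \<Longrightarrow> \<exists>U \<phi>. (U, \<phi>) \<in> atlas M \<and> x \<in> U"
  using mfd unfolding smooth_manifold_def by fast

lemma subspace_model: "subspace (model M)"
  using mfd unfolding smooth_manifold_def by blast

lemma chart_homeo:
  "(U, \<phi>) \<in> atlas M \<Longrightarrow> homeomorphic_map (subtopology (mtop M) U) (top_of_set (\<phi> ` U)) \<phi>"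
  using mfd unfolding smooth_manifold_def by blast

lemma chart_image_open: "(U, \<phi>) \<in> atlas M \<Longrightarrow> openin (top_of_set (model M)) (\<phi> ` U)"
  using mfd unfolding smooth_manifold_def by blast

lemma chart_inj: assumes "(U, \<phi>) \<in> atlas M" shows "inj_on \<phi> U"
  using homeomorphic_imp_injective_map[OF chart_homeo[OF assms]] chart_subset[OF assms]
  by (simp add: Int_absorb1)

lemma chart_inv [simp]: "(U, \<phi>) \<in> atlas M \<Longrightarrow> y \<in> U \<Longrightarrow> inv_into U \<phi> (\<phi> y) = y"
  by (simp add: chart_inj)

lemma chart_image_Int_open:
  assumes "(U, \<phi>) \<in> atlas M" "openin (mtop M) W"
  shows "\<exists>\<Omega>. open \<Omega> \<and> \<phi> ` (U \<inter> W) = model M \<inter> \<Omega>"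
proof -
  have "openin (subtopology (mtop M) U) (U \<inter> W)"
    using assms(2) by (metis inf_commute openin_subtopology)
  then have "openin (top_of_set (\<phi> ` U)) (\<phi> ` (U \<inter> W))"
    using homeomorphic_imp_open_map[OF chart_homeo[OF assms(1)]] unfolding open_map_def by blast
  then have "openin (top_of_set (model M)) (\<phi> ` (U \<inter> W))"
    using chart_image_open[OF assms(1)] openin_trans by blast
  then show ?thesis by (auto simp: openin_open)
qed

lemma chart_preimage_open:
  assumes "(U, \<phi>) \<in> atlas M" "open \<Omega>"
  shows "openin (mtop M) {y\<in>U. \<phi> y \<in> \<Omega>}"
proof -
  have "continuous_map (subtopology (mtop M) U) (top_of_set (\<phi> ` U)) \<phi>"
    using homeomorphic_imp_continuous_map[OF chart_homeo[OF assms(1)]] .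
  moreover have "openin (top_of_set (\<phi> ` U)) (\<phi> ` U \<inter> \<Omega>)" using assms(2) by blast
  ultimately have "openin (subtopology (mtop M) U) {y \<in> topspace (subtopology (mtop M) U). \<phi> y \<in> \<phi> ` U \<inter> \<Omega>}"
    unfolding continuous_map_def by blast
  moreover have "{y \<in> topspace (subtopology (mtop M) U). \<phi> y \<in> \<phi> ` U \<inter> \<Omega>} = {y\<in>U. \<phi> y \<in> \<Omega>}"
    using chart_subset[OF assms(1)] by auto
  ultimately show ?thesis
    using chart_open[OF assms(1)] openin_trans_full by metis
qed

lemma smooth_at_pointsD:
  "smooth_at_points M W f \<Longrightarrow> (U, \<phi>) \<in> atlas M \<Longrightarrow> smooth_on (\<phi> ` (U \<inter> W)) (f \<circ> inv_into U \<phi>)"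
  unfolding smooth_at_points_def by blast

lemma smooth_at_pointsI:
  "(\<And>U \<phi>. (U, \<phi>) \<in> atlas M \<Longrightarrow> smooth_on (\<phi> ` (U \<inter> W)) (f \<circ> inv_into U \<phi>)) \<Longrightarrow> smooth_at_points M W f"
  unfolding smooth_at_points_def by blast

lemma smooth_at_points_subset:
  assumes "smooth_at_points M W f" "W' \<subseteq> W"
  shows "smooth_at_points M W' f"
  by (rule smooth_at_pointsI, rule smooth_on_subset[OF smooth_at_pointsD[OF assms(1)]])
     (use assms(2) in auto)

text \<open>As \<open>g\<close> has to agree with \<open>f\<close> on \<open>N \<inter> W\<close> only, this both localizes smoothness and glues functions.\<close>

lemma smooth_at_points_local:
  assumes "\<And>x. x \<in> W \<Longrightarrow> \<exists>N g. openin (mtop M) N \<and> x \<in> N \<and> smooth_at_points M N g \<and> (\<forall>y\<in>N \<inter> W. g y = f y)"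
  shows "smooth_at_points M W f"
proof -
  have "smooth_on (\<phi> ` (U \<inter> W)) (f \<circ> inv_into U \<phi>)" if ch: "(U, \<phi>) \<in> atlas M" for U \<phi>
    unfolding smooth_on_def
  proof
    fix z assume "z \<in> \<phi> ` (U \<inter> W)"
    then obtain x where x: "x \<in> U" "x \<in> W" "z = \<phi> x" by auto
    obtain N g where N: "openin (mtop M) N" "x \<in> N" "smooth_at_points M N g" "\<forall>y\<in>N \<inter> W. g y = f y"
      using assms x(2) by blast
    from x N(2) have "z \<in> \<phi> ` (U \<inter> N)" by blast
    then obtain O1 h where h: "open O1" "z \<in> O1" "\<forall>k. Ck_on k h O1"
      "\<forall>w\<in>O1 \<inter> \<phi> ` (U \<inter> N). h w = (g \<circ> inv_into U \<phi>) w"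
      using bspec[OF smooth_at_pointsD[OF N(3) ch, unfolded smooth_on_def]] by blast
    obtain O2 where O2: "open O2" "\<phi> ` (U \<inter> N) = model M \<inter> O2"
      using chart_image_Int_open[OF ch N(1)] by blast
    have "h (\<phi> y) = f y" if "\<phi> y \<in> O1 \<inter> O2" "y \<in> U" "y \<in> W" for y
    proof -
      have "\<phi> y \<in> model M" using chart_image_open[OF ch] that openin_imp_subset by blast
      then have "\<phi> y \<in> \<phi> ` (U \<inter> N)" using O2 that by blast
      moreover from this have "y \<in> N" using chart_inj[OF ch] that by (auto dest: inj_onD)
      ultimately show ?thesis using h(4) N(4) that ch by simp
    qed
    moreover have "z \<in> O2" using O2 x N by blast
    ultimately show "\<exists>O1 h. open O1 \<and> z \<in> O1 \<and> (\<forall>k. Ck_on k h O1) \<and>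
        (\<forall>w\<in>O1 \<inter> \<phi> ` (U \<inter> W). h w = (f \<circ> inv_into U \<phi>) w)"
      using h O2(1) ch
      by (intro exI[of _ "O1 \<inter> O2"] exI[of _ h]) (auto intro: Ck_on_subset)
  qed
  then show ?thesis unfolding smooth_at_points_def by blast
qed

lemma smooth_at_points_cong:
  assumes "smooth_at_points M W f" "\<And>x. x \<in> W \<Longrightarrow> f x = g x"
  shows "smooth_at_points M W g"
  unfolding smooth_at_points_def
proof clarify
  fix U \<phi> assume ch: "(U, \<phi>) \<in> atlas M"
  then have "smooth_on (\<phi> ` (U \<inter> W)) (f \<circ> inv_into U \<phi>)"
    using assms(1) unfolding smooth_at_points_def by blast
  then show "smooth_on (\<phi> ` (U \<inter> W)) (g \<circ> inv_into U \<phi>)"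
    by (rule smooth_on_cong) (use ch assms(2) in auto)
qed

text \<open>One chart suffices: in any other chart, \<open>f\<close> is \<open>F\<close> composed with a transition map.\<close>

lemma smooth_at_points_chart:
  assumes ch: "(U, \<phi>) \<in> atlas M" and W: "openin (mtop M) W" "W \<subseteq> U"
    and F: "open \<Omega>" "\<phi> ` W \<subseteq> \<Omega>" "\<And>k. Ck_on k F \<Omega>" "\<And>y. y \<in> W \<Longrightarrow> f y = F (\<phi> y)"
  shows "smooth_at_points M W f"
proof -
  have "smooth_on (\<phi>' ` (U' \<inter> W)) (f \<circ> inv_into U' \<phi>')" if ch': "(U', \<phi>') \<in> atlas M" for U' \<phi>'
    unfolding smooth_on_def
  proof
    fix z assume "z \<in> \<phi>' ` (U' \<inter> W)"
    then obtain y where y: "y \<in> U'" "y \<in> W" "z = \<phi>' y" by blast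
    have "smooth_on (\<phi>' ` (U' \<inter> U)) (\<phi> \<circ> inv_into U' \<phi>')"
      using mfd ch ch' unfolding smooth_manifold_def by blast
    moreover have "z \<in> \<phi>' ` (U' \<inter> U)" using y W(2) by blast
    ultimately obtain \<Omega>' h where h: "open \<Omega>'" "z \<in> \<Omega>'" "\<And>k. Ck_on k h \<Omega>'"
      "\<forall>w\<in>\<Omega>' \<inter> \<phi>' ` (U' \<inter> U). h w = (\<phi> \<circ> inv_into U' \<phi>') w"
      unfolding smooth_on_def by blast
    let ?T = "\<Omega>' \<inter> h -` \<Omega>"
    have T: "open ?T"
      using continuous_open_preimage[OF Ck_on_continuous[OF h(3)] h(1) F(1)] .
    have hy: "h (\<phi>' w) = \<phi> w" if "w \<in> U'" "w \<in> W" "\<phi>' w \<in> \<Omega>'" for w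
      using h(4) that W(2) ch' by auto
    have "Ck_on k (\<lambda>w. F (h w)) ?T" for k
      by (rule Ck_on_compose[OF T F(1) _ _ F(3)]) (auto intro: Ck_on_subset[OF h(3)])
    moreover have "z \<in> ?T" using hy y h(2) F(2) by auto
    moreover have "\<forall>w\<in>?T \<inter> \<phi>' ` (U' \<inter> W). F (h w) = (f \<circ> inv_into U' \<phi>') w"
      using hy F(4) ch' by auto
    ultimately show "\<exists>O1 g. open O1 \<and> z \<in> O1 \<and> (\<forall>k. Ck_on k g O1) \<and>
        (\<forall>w\<in>O1 \<inter> \<phi>' ` (U' \<inter> W). g w = (f \<circ> inv_into U' \<phi>') w)"
      using T by (intro exI[of _ ?T] exI[of _ "\<lambda>w. F (h w)"]) blast
  qed
  then show ?thesis unfolding smooth_at_points_def by blast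
qed

lemma smooth_at_points_add:
  "smooth_at_points M W f \<Longrightarrow> smooth_at_points M W g \<Longrightarrow> smooth_at_points M W (\<lambda>x. f x + g x)"
  using smooth_at_pointsD[of W f] smooth_at_pointsD[of W g]
  by (auto intro!: smooth_at_pointsI smooth_on_add_mult simp: o_def)

lemma smooth_at_points_mult:
  "smooth_at_points M W f \<Longrightarrow> smooth_at_points M W g \<Longrightarrow> smooth_at_points M W (\<lambda>x. f x * g x)"
  using smooth_at_pointsD[of W f] smooth_at_pointsD[of W g]
  by (auto intro!: smooth_at_pointsI smooth_on_add_mult simp: o_def)

lemma smooth_at_points_const: "smooth_at_points M W (\<lambda>x. c)"
  by (auto intro!: smooth_at_pointsI smooth_on_const simp: o_def)

text \<open>Functions on \<open>M\<close> vanish off the carrier, and so do the constant ones.\<close>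

definition const_fn :: "real \<Rightarrow> 'm \<Rightarrow> real" where
  "const_fn c = (\<lambda>x. if x \<in> points M then c else 0)"

lemma const_fn_smooth: "const_fn c \<in> Cinf"
  unfolding smooth_functions_def const_fn_def
  using smooth_at_points_cong[OF smooth_at_points_const] by auto

lemma smooth_fn_add:
  "f \<in> Cinf \<Longrightarrow> g \<in> Cinf \<Longrightarrow> (\<lambda>x. f x + g x) \<in> Cinf"
  unfolding smooth_functions_def by (auto intro: smooth_at_points_add)

lemma smooth_fn_mult:
  "f \<in> Cinf \<Longrightarrow> g \<in> Cinf \<Longrightarrow> (\<lambda>x. f x * g x) \<in> Cinf"
  unfolding smooth_functions_def by (auto intro: smooth_at_points_mult)

lemma smooth_fn_cmult:
  assumes "f \<in> Cinf" shows "(\<lambda>x. a * f x) \<in> Cinf"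
proof -
  have "(\<lambda>x. const_fn a x * f x) = (\<lambda>x. a * f x)"
    using assms by (auto simp: smooth_functions_def const_fn_def)
  then show ?thesis using smooth_fn_mult[OF const_fn_smooth assms, of a] by simp
qed

lemma smooth_fn_diff:
  assumes "f \<in> Cinf" "g \<in> Cinf"
  shows "(\<lambda>x. f x - g x) \<in> Cinf"
  using smooth_fn_add[OF assms(1) smooth_fn_cmult[OF assms(2), of "-1"]] by simp

lemma smooth_fn_zero: "(\<lambda>x. 0) \<in> Cinf"
  using const_fn_smooth[of 0] by (simp add: const_fn_def)

lemma smooth_fn_off: "f \<in> Cinf \<Longrightarrow> x \<notin> points M \<Longrightarrow> f x = 0"
  unfolding smooth_functions_def by blast

lemma smooth_fn_at: "f \<in> Cinf \<Longrightarrow> W \<subseteq> points M \<Longrightarrow> smooth_at_points M W f"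
  unfolding smooth_functions_def using smooth_at_points_subset by blast

text \<open>A closed set inside \<open>W\<close> off which \<open>\<eta>\<close> vanishes is what extension by zero from \<open>W\<close> requires.\<close>

definition supported_in :: "('m \<Rightarrow> real) \<Rightarrow> 'm set \<Rightarrow> bool" where
  "supported_in \<eta> W \<longleftrightarrow> (\<exists>C. closedin (mtop M) C \<and> C \<subseteq> W \<and> (\<forall>y. y \<notin> C \<longrightarrow> \<eta> y = 0))"

lemma supported_in_mono: "supported_in \<eta> W \<Longrightarrow> W \<subseteq> W' \<Longrightarrow> supported_in \<eta> W'"
  unfolding supported_in_def by blast

lemma supported_in_off: "supported_in \<eta> W \<Longrightarrow> y \<notin> W \<Longrightarrow> \<eta> y = 0"
  unfolding supported_in_def by blast

text \<open>The product is smooth at points of \<open>W\<close>, and it vanishes on the complement of a closed subset of \<open>W\<close>.\<close>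

lemma cutoff_at:
  assumes "openin (mtop M) W" "openin (mtop M) V" "supported_in \<eta> W"
    "smooth_at_points M V \<eta>" "smooth_at_points M (W \<inter> V) f"
  shows "smooth_at_points M V (\<lambda>y. \<eta> y * f y)"
proof (rule smooth_at_points_local)
  obtain C where C: "closedin (mtop M) C" "C \<subseteq> W" "\<And>y. y \<notin> C \<Longrightarrow> \<eta> y = 0"
    using assms(3) unfolding supported_in_def by blast
  fix x assume x: "x \<in> V"
  show "\<exists>N g. openin (mtop M) N \<and> x \<in> N \<and> smooth_at_points M N g \<and> (\<forall>y\<in>N \<inter> V. g y = \<eta> y * f y)"
  proof (cases "x \<in> W")
    case True
    then show ?thesis
      using x assms smooth_at_points_mult[OF smooth_at_points_subset[OF assms(4)] assms(5)]
      by (intro exI[of _ "W \<inter> V"] exI[of _ "\<lambda>y. \<eta> y * f y"]) (auto intro: openin_Int)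
  next
    case False
    then have "x \<in> topspace (mtop M) - C" using x C assms(2) openin_subset by blast
    then show ?thesis
      using C by (intro exI[of _ "topspace (mtop M) - C"] exI[of _ "\<lambda>y. 0"])
        (auto intro: smooth_at_points_const)
  qed
qed

lemma cutoff_smooth:
  assumes "openin (mtop M) W" "supported_in \<eta> W"
    "\<eta> \<in> Cinf" "smooth_at_points M W f"
  shows "(\<lambda>y. \<eta> y * f y) \<in> Cinf"
proof -
  have "smooth_at_points M (points M) (\<lambda>y. \<eta> y * f y)"
    using assms smooth_at_points_subset
    by (intro cutoff_at[OF assms(1) _ assms(2)]) (auto simp: smooth_functions_def)
  then show ?thesis using assms(3) by (auto simp: smooth_functions_def)
qed

text \<open>A Euclidean bump function is transported by a chart.  It vanishes off the image of a compact set,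
and this image is closed because \<open>M\<close> is a Hausdorff space.\<close>

lemma bump_exists:
  assumes "openin (mtop M) W" "x \<in> W"
  obtains \<eta> N where "\<eta> \<in> Cinf" "supported_in \<eta> W"
    "openin (mtop M) N" "x \<in> N" "N \<subseteq> W" "\<And>y. y \<in> N \<Longrightarrow> \<eta> y = 1"
proof -
  obtain U \<phi> where ch: "(U, \<phi>) \<in> atlas M" "x \<in> U"
    using chart_exists assms openin_subset by blast
  obtain \<Omega> where \<Omega>: "open \<Omega>" "\<phi> ` (U \<inter> W) = model M \<inter> \<Omega>"
    using chart_image_Int_open[OF ch(1) assms(1)] by blast
  have "\<phi> x \<in> \<Omega>" using \<Omega>(2) assms(2) ch(2) by blast
  then obtain r where r: "r > 0" "cball (\<phi> x) r \<subseteq> \<Omega>" using \<Omega>(1) open_contains_cball by blast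
  obtain \<beta> \<delta> where \<beta>: "\<delta> > 0" "\<And>k. Ck_on k \<beta> UNIV" "\<And>z. z \<in> ball (\<phi> x) \<delta> \<Longrightarrow> \<beta> z = (1::real)"
     "\<And>z. z \<notin> cball (\<phi> x) r \<Longrightarrow> \<beta> z = 0"
    using smooth_bump[OF r(1), of "\<phi> x"] by blast
  have im: "\<phi> ` U \<subseteq> model M" using chart_image_open[OF ch(1)] openin_imp_subset by blast
  define \<eta> where "\<eta> y = (if y \<in> U then \<beta> (\<phi> y) else 0)" for y
  define C where "C = {y\<in>U. \<phi> y \<in> cball (\<phi> x) r}"
  have CW: "C \<subseteq> U \<inter> W"
  proof
    fix y assume y: "y \<in> C"
    then have "\<phi> y \<in> \<phi> ` (U \<inter> W)" using \<Omega>(2) im r(2) unfolding C_def by blast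
    then show "y \<in> U \<inter> W" using chart_inj[OF ch(1)] y unfolding C_def by (auto dest: inj_onD)
  qed
  have "closedin (mtop M) C"
  proof -
    let ?K = "model M \<inter> cball (\<phi> x) r"
    have K: "?K \<subseteq> \<phi> ` U" using \<Omega>(2) r(2) by blast
    obtain \<psi> where \<psi>: "homeomorphic_maps (subtopology (mtop M) U) (top_of_set (\<phi> ` U)) \<phi> \<psi>"
      using chart_homeo[OF ch(1)] homeomorphic_map_maps by blast
    have "compactin (top_of_set (\<phi> ` U)) ?K"
      using K compact_Int_closed[OF compact_cball closed_subspace[OF subspace_model]]
      by (simp add: compactin_subtopology Int_commute)
    then have "compactin (subtopology (mtop M) U) (\<psi> ` ?K)"
      using image_compactin \<psi> unfolding homeomorphic_maps_def by blast
    moreover have "\<psi> ` ?K = C"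
    proof -
      have "?K = \<phi> ` C" using K im unfolding C_def by auto
      moreover have "\<psi> (\<phi> y) = y" if "y \<in> C" for y
        using \<psi> that CW chart_subset[OF ch(1)] unfolding homeomorphic_maps_def by auto
      ultimately show ?thesis by (simp add: image_image)
    qed
    ultimately have "compactin (mtop M) C" by (metis compactin_subtopology)
    moreover have "Hausdorff_space (mtop M)" using mfd unfolding smooth_manifold_def by (elim conjE)
    ultimately show ?thesis by (intro compactin_imp_closedin)
  qed
  then have supp: "supported_in \<eta> (U \<inter> W)"
    unfolding supported_in_def using CW \<beta>(4) by (intro exI[of _ C]) (auto simp: \<eta>_def C_def)
  have "smooth_at_points M U (\<lambda>y. \<beta> (\<phi> y))"
    by (rule smooth_at_points_chart[OF ch(1) chart_open[OF ch(1)] order_refl open_UNIV]) (use \<beta> in auto)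
  then have U: "smooth_at_points M U \<eta>" by (rule smooth_at_points_cong) (simp add: \<eta>_def)
  have "smooth_at_points M (points M) \<eta>"
  proof (rule smooth_at_points_local)
    fix y assume y: "y \<in> points M"
    show "\<exists>N g. openin (mtop M) N \<and> y \<in> N \<and> smooth_at_points M N g \<and> (\<forall>z\<in>N \<inter> points M. g z = \<eta> z)"
    proof (cases "y \<in> U")
      case True
      then show ?thesis using U chart_open[OF ch(1)] by blast
    next
      case False
      then have "y \<in> points M - C" using y CW by blast
      moreover have "\<eta> z = 0" if "z \<notin> C" for z using that \<beta>(4) by (auto simp: \<eta>_def C_def)
      ultimately show ?thesis using \<open>closedin (mtop M) C\<close>
        by (intro exI[of _ "points M - C"] exI[of _ "\<lambda>y. 0"]) (auto intro: smooth_at_points_const)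
    qed
  qed
  then have "\<eta> \<in> Cinf"
    using chart_subset[OF ch(1)] by (auto simp: smooth_functions_def \<eta>_def)
  moreover have "openin (mtop M) ({y\<in>U. \<phi> y \<in> ball (\<phi> x) \<delta>} \<inter> W)"
    using chart_preimage_open[OF ch(1) open_ball] assms(1) by blast
  ultimately show thesis
    using that[of \<eta> "{y\<in>U. \<phi> y \<in> ball (\<phi> x) \<delta>} \<inter> W"] supported_in_mono[OF supp] ch(2) assms(2) \<beta>(1,3)
    by (auto simp: \<eta>_def)
qed

section \<open>Coordinate expressions\<close>

text \<open>The model may be a proper subspace of the Euclidean space.  Composing with a linear projection onto
it makes a coordinate expression a function on an open subset of the Euclidean space, where
Frechet derivatives are determined.\<close>

definition proj :: "'b \<Rightarrow> 'b" where
  "proj = (SOME P. linear P \<and> range P \<subseteq> model M \<and> (\<forall>v\<in>model M. P v = v))"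

lemma proj: "linear proj" "proj z \<in> model M" "v \<in> model M \<Longrightarrow> proj v = v"
  using someI_ex[OF projection_onto_subspace[OF subspace_model]] unfolding proj_def by auto

definition coord_rep :: "'m set \<Rightarrow> ('m \<Rightarrow> 'b) \<Rightarrow> ('m \<Rightarrow> real) \<Rightarrow> 'b \<Rightarrow> real" where
  "coord_rep U \<phi> f = (\<lambda>z. f (inv_into U \<phi> (proj z)))"

definition coord_dom :: "'m set \<Rightarrow> ('m \<Rightarrow> 'b) \<Rightarrow> 'b set" where
  "coord_dom U \<phi> = {z. proj z \<in> \<phi> ` U}"

lemma chart_in_model: "(U, \<phi>) \<in> atlas M \<Longrightarrow> y \<in> U \<Longrightarrow> \<phi> y \<in> model M"
  using chart_image_open openin_imp_subset by blast

lemma coord_rep_chart [simp]: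
  "(U, \<phi>) \<in> atlas M \<Longrightarrow> y \<in> U \<Longrightarrow> coord_rep U \<phi> f (\<phi> y) = f y"
  by (simp add: coord_rep_def proj chart_in_model)

lemma chart_in_coord_dom: "(U, \<phi>) \<in> atlas M \<Longrightarrow> y \<in> U \<Longrightarrow> \<phi> y \<in> coord_dom U \<phi>"
  by (simp add: coord_dom_def proj chart_in_model)

lemma open_coord_dom:
  assumes "(U, \<phi>) \<in> atlas M" shows "open (coord_dom U \<phi>)"
proof -
  obtain \<Omega> where \<Omega>: "open \<Omega>" "\<phi> ` U = model M \<inter> \<Omega>"
    using chart_image_Int_open[OF assms chart_open[OF assms]] by auto
  then have "coord_dom U \<phi> = proj -` \<Omega>" by (auto simp: coord_dom_def proj)
  then show ?thesis using \<Omega>(1) linear_continuous_on[of proj UNIV] proj(1)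
    by (metis continuous_open_vimage linear_conv_bounded_linear continuous_on_eq_continuous_at open_UNIV UNIV_I)
qed

lemma coord_rep_smooth:
  assumes ch: "(U, \<phi>) \<in> atlas M" and f: "f \<in> Cinf"
  shows "Ck_on k (coord_rep U \<phi> f) (coord_dom U \<phi>)"
proof (rule Ck_on_local[OF open_coord_dom[OF ch]])
  fix z assume z: "z \<in> coord_dom U \<phi>"
  have "smooth_on (\<phi> ` (U \<inter> U)) (f \<circ> inv_into U \<phi>)"
    by (rule smooth_at_pointsD[OF smooth_fn_at[OF f chart_subset[OF ch]] ch])
  then obtain \<Omega> g where g: "open \<Omega>" "proj z \<in> \<Omega>" "\<And>k. Ck_on k g \<Omega>"
      "\<forall>w\<in>\<Omega> \<inter> \<phi> ` U. g w = (f \<circ> inv_into U \<phi>) w"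
    using z unfolding smooth_on_def coord_dom_def Int_absorb mem_Collect_eq by blast
  let ?T = "coord_dom U \<phi> \<inter> proj -` \<Omega>"
  have bl: "bounded_linear proj" using proj(1) linear_conv_bounded_linear by blast
  have T: "open ?T"
    by (rule continuous_open_preimage[OF linear_continuous_on[OF bl] open_coord_dom[OF ch] g(1)])
  have "Ck_on k (\<lambda>w. g (proj w)) ?T"
    by (rule Ck_on_compose[OF T g(1) _ Ck_on_bounded_linear[OF T bl] g(3)]) auto
  then have "Ck_on k (coord_rep U \<phi> f) ?T"
    by (rule Ck_on_cong[OF T, rotated]) (use g(4) in \<open>auto simp: coord_rep_def coord_dom_def\<close>)
  then show "\<exists>V. open V \<and> z \<in> V \<and> Ck_on k (coord_rep U \<phi> f) V"
    using T z g(2) by blast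
qed

end

section \<open>Modules of sections\<close>

lemma fun_scaleR_apply [simp]: "(r *\<^sub>R f) x = r *\<^sub>R (f x :: 'e::real_vector)"
  by (simp add: scaleR_fun_def)

lemma fun_sum_apply: "(\<Sum>i\<in>I. f i) x = (\<Sum>i\<in>I. (f i x :: 'e::real_vector))"
  by (induction I rule: infinite_finite_induct) auto

lemma smul_apply [simp]: "smul f s x = f x *\<^sub>R s x"
  by (simp add: smul_def)

text \<open>The shape in which local frames yield the assumption \<open>localize\<close> below: with \<open>\<mu> x = 1\<close>, the remainder
\<open>(1 - \<mu>) s\<close> has a coefficient vanishing at \<open>x\<close>, too.\<close>

lemma (in smooth_mfd) in_span_vanishing:
  fixes s :: "'m \<Rightarrow> 'e::real_vector"
  assumes x: "x \<in> points M" and \<mu>: "\<mu> \<in> Cinf" "\<mu> x = 1"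
    and s: "s \<in> S" "\<And>y. y \<notin> points M \<Longrightarrow> s y = 0"
    and \<kappa>: "\<And>i. i \<in> I \<Longrightarrow> \<kappa> i \<in> Cinf" "\<And>i. i \<in> I \<Longrightarrow> \<kappa> i x = 0" "\<And>i. i \<in> I \<Longrightarrow> t i \<in> S"
    and gen: "smul \<mu> s = (\<Sum>i\<in>I. smul (\<kappa> i) (t i))"
  shows "s \<in> span {smul f t |f t. f \<in> Cinf \<and> f x = 0 \<and> t \<in> S}" (is "_ \<in> span ?G")
proof -
  let ?r = "\<lambda>y. const_fn 1 y - \<mu> y"
  have "?r \<in> Cinf" "?r x = 0" using smooth_fn_diff[OF const_fn_smooth \<mu>(1)] \<mu>(2) x
    by (simp_all add: const_fn_def)
  then have "smul ?r s \<in> span ?G" using s(1) by (intro span_base) blast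
  moreover have "smul (\<kappa> i) (t i) \<in> ?G" if "i \<in> I" for i using \<kappa>[OF that] by blast
  then have "smul \<mu> s \<in> span ?G" unfolding gen by (intro span_sum span_base)
  ultimately have "smul \<mu> s + smul ?r s \<in> span ?G" by (intro span_add)
  moreover have "smul \<mu> s + smul ?r s = s"
    using s(2) by (auto simp: fun_eq_iff const_fn_def scaleR_diff_left)
  ultimately show ?thesis by simp
qed

text \<open>What the sections of a vector bundle and the vector fields have in common.  The last two assumptions
are there to evaluate tensorial operators pointwise: the one provides sections through given vectors,
the other shows that the choice does not matter.\<close>

locale section_module = smooth_mfd M
  for M :: "('m, 'b::euclidean_space) manifold" +
  fixes E :: "('m, 'e::real_vector, 'z) vbundle_scheme"
  assumes fibre_subspace: "x \<in> points M \<Longrightarrow> subspace (fibre E x)"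
    and section_off: "s \<in> sections E \<Longrightarrow> x \<notin> points M \<Longrightarrow> s x = 0"
    and section_in: "s \<in> sections E \<Longrightarrow> x \<in> points M \<Longrightarrow> s x \<in> fibre E x"
    and section_zero: "0 \<in> sections E"
    and section_add: "s \<in> sections E \<Longrightarrow> t \<in> sections E \<Longrightarrow> s + t \<in> sections E"
    and section_smul: "f \<in> Cinf \<Longrightarrow> s \<in> sections E \<Longrightarrow> smul f s \<in> sections E"
    and extend: "x \<in> points M \<Longrightarrow> e \<in> fibre E x \<Longrightarrow> \<exists>s\<in>sections E. s x = e"
    and localize: "s \<in> sections E \<Longrightarrow> x \<in> points M \<Longrightarrow> s x = 0 \<Longrightarrow>
      s \<in> span {smul f t |f t. f \<in> Cinf \<and> f x = 0 \<and> t \<in> sections E}"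
begin

lemma scaleR_eq_smul: "s \<in> sections E \<Longrightarrow> a *\<^sub>R s = smul (const_fn a) s"
  using section_off[of s] by (auto simp: fun_eq_iff const_fn_def)

lemma section_scaleR: "s \<in> sections E \<Longrightarrow> a *\<^sub>R s \<in> sections E"
  by (simp only: scaleR_eq_smul section_smul[OF const_fn_smooth])

lemma section_uminus: "s \<in> sections E \<Longrightarrow> - s \<in> sections E"
  using section_scaleR[of s "-1"] by simp

lemma section_diff: "s \<in> sections E \<Longrightarrow> t \<in> sections E \<Longrightarrow> s - t \<in> sections E"
  using section_add[of s "- t"] section_uminus by simp

lemma section_through:
  assumes "x \<in> points M" "e \<in> fibre E x"
  shows "section_through E x e \<in> sections E" "section_through E x e x = e"
  using someI_ex[of "\<lambda>s. s \<in> sections E \<and> s x = e"] extend[OF assms]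
  unfolding section_through_def by blast+

definition tensorial :: "(('m \<Rightarrow> 'e) \<Rightarrow> 'm \<Rightarrow> 'w::real_vector) \<Rightarrow> bool" where
  "tensorial \<Phi> \<longleftrightarrow> (\<forall>s\<in>sections E. \<forall>t\<in>sections E. \<Phi> (s + t) = \<Phi> s + \<Phi> t) \<and>
     (\<forall>f\<in>Cinf. \<forall>s\<in>sections E. \<Phi> (smul f s) = smul f (\<Phi> s))"

lemma tensorialI:
  "(\<And>s t. s \<in> sections E \<Longrightarrow> t \<in> sections E \<Longrightarrow> \<Phi> (s + t) = \<Phi> s + \<Phi> t) \<Longrightarrow>
   (\<And>f s. f \<in> Cinf \<Longrightarrow> s \<in> sections E \<Longrightarrow> \<Phi> (smul f s) = smul f (\<Phi> s)) \<Longrightarrow> tensorial \<Phi>"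
  unfolding tensorial_def by blast

lemma tensorial_linear:
  assumes "tensorial \<Phi>" "s \<in> sections E" "t \<in> sections E" "x \<in> points M"
  shows "\<Phi> (a *\<^sub>R s + b *\<^sub>R t) x = a *\<^sub>R \<Phi> s x + b *\<^sub>R \<Phi> t x"
proof -
  have "a *\<^sub>R s + b *\<^sub>R t = smul (const_fn a) s + smul (const_fn b) t"
    using section_off[OF assms(2)] section_off[OF assms(3)] by (auto simp: fun_eq_iff const_fn_def)
  then have "\<Phi> (a *\<^sub>R s + b *\<^sub>R t) = smul (const_fn a) (\<Phi> s) + smul (const_fn b) (\<Phi> t)"
    using assms(1-3) by (simp add: tensorial_def section_smul const_fn_smooth)
  then show ?thesis using assms(4) by (simp add: const_fn_def)
qed

text \<open>If \<open>s\<close> is a sum of products \<open>f t\<close> with \<open>f x = 0\<close>, then \<open>\<Phi> s\<close> is the sum of the products \<open>f (\<Phi> t)\<close>, which vanish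
at \<open>x\<close>.\<close>

lemma tensorial_vanish:
  assumes \<Phi>: "tensorial \<Phi>" and "s \<in> sections E" "x \<in> points M" "s x = 0"
  shows "\<Phi> s x = 0"
proof -
  let ?G = "{smul f t |f t. f \<in> Cinf \<and> f x = 0 \<and> t \<in> sections E}"
  have add: "\<Phi> (u + t) = \<Phi> u + \<Phi> t" if "u \<in> sections E" "t \<in> sections E" for u t
    using \<Phi> that unfolding tensorial_def by blast
  have mul: "\<Phi> (smul f t) = smul f (\<Phi> t)" if "f \<in> Cinf" "t \<in> sections E" for f t
    using \<Phi> that unfolding tensorial_def by blast
  have sub: "subspace {u \<in> sections E. \<Phi> u x = 0}"
  proof (rule subspaceI)
    have "\<Phi> (0 + 0) x = \<Phi> 0 x + \<Phi> 0 x" using add[OF section_zero section_zero] by (metis plus_fun_apply)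
    then show "0 \<in> {u \<in> sections E. \<Phi> u x = 0}" by (simp add: section_zero)
  next
    fix u t assume "u \<in> {u \<in> sections E. \<Phi> u x = 0}" "t \<in> {u \<in> sections E. \<Phi> u x = 0}"
    then show "u + t \<in> {u \<in> sections E. \<Phi> u x = 0}" by (simp add: section_add add)
  next
    fix c u assume u: "u \<in> {u \<in> sections E. \<Phi> u x = 0}"
    have "c *\<^sub>R u = smul (const_fn c) u"
      using u section_off by (auto simp: fun_eq_iff const_fn_def)
    then show "c *\<^sub>R u \<in> {u \<in> sections E. \<Phi> u x = 0}"
      using u section_smul[OF const_fn_smooth] mul[OF const_fn_smooth] by simp
  qed
  have "?G \<subseteq> {u \<in> sections E. \<Phi> u x = 0}" by (auto simp: section_smul mul)
  then have "span ?G \<subseteq> {u \<in> sections E. \<Phi> u x = 0}" using sub by (rule span_minimal)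
  then show ?thesis using localize[OF assms(2-4)] by blast
qed

text \<open>This makes the pointwise definitions by means of \<^const>\<open>section_through\<close> independent of choices.\<close>

lemma tensorial_at:
  assumes \<Phi>: "tensorial \<Phi>" and s: "s \<in> sections E" "s' \<in> sections E" "x \<in> points M" "s x = s' x"
  shows "\<Phi> s x = \<Phi> s' x"
proof -
  have "\<Phi> (s - s') x = 0" using tensorial_vanish[OF \<Phi> section_diff[OF s(1,2)] s(3)] s(4) by simp
  moreover have "\<Phi> s = \<Phi> (s - s') + \<Phi> s'"
    using \<Phi> section_diff[OF s(1,2)] s(2) unfolding tensorial_def by (metis diff_add_cancel)
  ultimately show ?thesis by simp
qed

end

section \<open>Vector bundles\<close>

text \<open>The data hidden by the existential quantifiers of \<^const>\<open>vector_bundle\<close>.\<close>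

locale framed_bundle = smooth_mfd M
  for M :: "('m, 'b::euclidean_space) manifold" +
  fixes E :: "('m, 'e::real_vector, 'z) vbundle_scheme" and k :: nat
    and \<F> :: "('m set \<times> (nat \<Rightarrow> 'm \<Rightarrow> 'e)) set"
  assumes frames: "(U, e) \<in> \<F> \<Longrightarrow> local_frame M E k U e"
    and frames_cover: "(\<Union>(U, e)\<in>\<F>. U) = points M"
    and frames_compatible: "(U, e) \<in> \<F> \<Longrightarrow> (U', e') \<in> \<F> \<Longrightarrow> j < k \<Longrightarrow>
      smooth_wrt_frame M k e (U \<inter> U') (e' j)"
    and sections_eq: "sections E =
          {s. (\<forall>x. x \<notin> points M \<longrightarrow> s x = 0) \<and> (\<forall>x\<in>points M. s x \<in> fibre E x) \<and>
              (\<forall>(U, e)\<in>\<F>. smooth_wrt_frame M k e U s)}"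
begin

lemma frame_open: "(U, e) \<in> \<F> \<Longrightarrow> openin (mtop M) U"
  using frames unfolding local_frame_def by blast

lemma frame_span: "(U, e) \<in> \<F> \<Longrightarrow> x \<in> U \<Longrightarrow> span ((\<lambda>i. e i x) ` {..<k}) = fibre E x"
  using frames unfolding local_frame_def by blast

lemma frame_at: "x \<in> points M \<Longrightarrow> \<exists>U e. (U, e) \<in> \<F> \<and> x \<in> U"
  using frames_cover by fast

lemma frame_in_fibre: "(U, e) \<in> \<F> \<Longrightarrow> x \<in> U \<Longrightarrow> i < k \<Longrightarrow> e i x \<in> fibre E x"
  by (auto simp flip: frame_span intro: span_base)

lemma frame_subspace: "x \<in> points M \<Longrightarrow> subspace (fibre E x)"
proof -
  assume "x \<in> points M"
  then obtain U e where "(U, e) \<in> \<F>" "x \<in> U" using frame_at by blast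
  from frame_span[OF this] show ?thesis by (metis subspace_span)
qed

lemma frame_coeff_unique:
  assumes "(U, e) \<in> \<F>" "x \<in> U" "(\<Sum>i<k. a i *\<^sub>R e i x) = (\<Sum>i<k. b i *\<^sub>R e i x)" "i < k"
  shows "a i = b i"
proof -
  have inj: "inj_on (\<lambda>i. e i x) {..<k}" and ind: "independent ((\<lambda>i. e i x) ` {..<k})"
    using frames[OF assms(1)] assms(2) unfolding local_frame_def by blast+
  \<comment> \<open>The vanishing combination of the frame vectors, with coefficients indexed by the vectors themselves.\<close>
  let ?u = "\<lambda>v. (let j = inv_into {..<k} (\<lambda>i. e i x) v in a j - b j)"
  have "(\<Sum>v\<in>(\<lambda>i. e i x) ` {..<k}. ?u v *\<^sub>R v) = (\<Sum>i<k. (a i - b i) *\<^sub>R e i x)"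
    by (subst sum.reindex[OF inj]) (auto simp: inv_into_f_f[OF inj] intro!: sum.cong)
  also have "\<dots> = 0" using assms(3) by (simp add: scaleR_diff_left sum_subtractf)
  finally have "?u (e i x) = 0"
    by (rule independentD[OF ind finite_imageI[OF finite_lessThan] order_refl]) (use assms(4) in blast)
  then show ?thesis using inv_into_f_f[OF inj] assms(4) by simp
qed

lemma fibre_coeffs:
  assumes "(U, e) \<in> \<F>" "x \<in> U" "v \<in> fibre E x"
  shows "\<exists>a. v = (\<Sum>i<k. a i *\<^sub>R e i x)"
proof -
  have inj: "inj_on (\<lambda>i. e i x) {..<k}"
    using frames[OF assms(1)] assms(2) unfolding local_frame_def by blast
  have "v \<in> range (\<lambda>u. \<Sum>w\<in>(\<lambda>i. e i x) ` {..<k}. u w *\<^sub>R w)"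
    using frame_span[OF assms(1,2)] assms(3) span_finite[of "(\<lambda>i. e i x) ` {..<k}"] by auto
  then obtain u where "v = (\<Sum>w\<in>(\<lambda>i. e i x) ` {..<k}. u w *\<^sub>R w)" by blast
  then have "v = (\<Sum>i<k. u (e i x) *\<^sub>R e i x)" by (simp add: sum.reindex[OF inj])
  then show ?thesis by (rule exI[of _ "\<lambda>i. u (e i x)"])
qed

lemma sections_frame: "s \<in> sections E \<Longrightarrow> (U, e) \<in> \<F> \<Longrightarrow> smooth_wrt_frame M k e U s"
  unfolding sections_eq by blast

lemma sections_fibre: "s \<in> sections E \<Longrightarrow> x \<in> points M \<Longrightarrow> s x \<in> fibre E x"
  unfolding sections_eq by blast

lemma sections_off: "s \<in> sections E \<Longrightarrow> x \<notin> points M \<Longrightarrow> s x = 0"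
  unfolding sections_eq by blast

lemma sectionsI:
  "(\<And>x. x \<notin> points M \<Longrightarrow> s x = 0) \<Longrightarrow> (\<And>x. x \<in> points M \<Longrightarrow> s x \<in> fibre E x) \<Longrightarrow>
   (\<And>U e. (U, e) \<in> \<F> \<Longrightarrow> smooth_wrt_frame M k e U s) \<Longrightarrow> s \<in> sections E"
  unfolding sections_eq by blast

text \<open>Coefficients in a frame are unique, so those of \<open>s\<close> agree locally with those of the sections \<open>t\<close>.\<close>

lemma section_local:
  assumes off: "\<And>x. x \<notin> points M \<Longrightarrow> s x = 0"
    and loc: "\<And>x. x \<in> points M \<Longrightarrow> \<exists>N t. openin (mtop M) N \<and> x \<in> N \<and> t \<in> sections E \<and> (\<forall>y\<in>N. s y = t y)"
  shows "s \<in> sections E"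
proof (rule sectionsI)
  show fib: "s x \<in> fibre E x" if "x \<in> points M" for x
    using loc[OF that] sections_fibre that by metis
  fix U e assume fr: "(U, e) \<in> \<F>"
  then have UM: "U \<subseteq> points M" using frame_open openin_subset by blast
  have "\<forall>y\<in>U. \<exists>a. s y = (\<Sum>i<k. a i *\<^sub>R e i y)"
    using fibre_coeffs[OF fr] fib UM by blast
  then obtain a where a: "\<And>y. y \<in> U \<Longrightarrow> s y = (\<Sum>i<k. a y i *\<^sub>R e i y)" by metis
  have "smooth_at_points M U (\<lambda>y. a y i)" if i: "i < k" for i
  proof (rule smooth_at_points_local)
    fix x assume x: "x \<in> U"
    then obtain N t where N: "openin (mtop M) N" "x \<in> N" "t \<in> sections E" "\<And>y. y \<in> N \<Longrightarrow> s y = t y"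
      using loc[OF subsetD[OF UM x]] by blast
    obtain c where c: "\<And>i. i < k \<Longrightarrow> smooth_at_points M U (c i)" "\<And>y. y \<in> U \<Longrightarrow> t y = (\<Sum>i<k. c i y *\<^sub>R e i y)"
      using sections_frame[OF N(3) fr] unfolding smooth_wrt_frame_def by blast
    have "c i y = a y i" if "y \<in> N \<inter> U" for y
    proof (rule frame_coeff_unique[OF fr _ _ i])
      show "(\<Sum>i<k. c i y *\<^sub>R e i y) = (\<Sum>i<k. a y i *\<^sub>R e i y)"
        using that N(4)[of y] a[of y] c(2)[of y] by simp
    qed (use that in auto)
    then show "\<exists>N g. openin (mtop M) N \<and> x \<in> N \<and> smooth_at_points M N g \<and> (\<forall>y\<in>N \<inter> U. g y = a y i)"
      using N(1,2) x frame_open[OF fr] smooth_at_points_subset[OF c(1)[OF i]]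
      by (intro exI[of _ "N \<inter> U"] exI[of _ "c i"]) (auto intro: openin_Int)
  qed
  then show "smooth_wrt_frame M k e U s"
    unfolding smooth_wrt_frame_def using a by (intro exI[of _ "\<lambda>i y. a y i"]) auto
qed (rule off)

lemma sections_add: "s \<in> sections E \<Longrightarrow> t \<in> sections E \<Longrightarrow> s + t \<in> sections E"
proof (rule sectionsI)
  assume st: "s \<in> sections E" "t \<in> sections E"
  show "(s + t) x = 0" if "x \<notin> points M" for x
    using sections_off[OF st(1) that] sections_off[OF st(2) that] by simp
  show "(s + t) x \<in> fibre E x" if "x \<in> points M" for x
    using st that sections_fibre frame_subspace subspace_add by (metis plus_fun_apply)
  fix U e assume fr: "(U, e) \<in> \<F>"
  obtain c d where "\<And>i. i < k \<Longrightarrow> smooth_at_points M U (c i)" "\<And>y. y \<in> U \<Longrightarrow> s y = (\<Sum>i<k. c i y *\<^sub>R e i y)"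
    "\<And>i. i < k \<Longrightarrow> smooth_at_points M U (d i)" "\<And>y. y \<in> U \<Longrightarrow> t y = (\<Sum>i<k. d i y *\<^sub>R e i y)"
    using st[THEN sections_frame, OF fr] unfolding smooth_wrt_frame_def by blast
  then show "smooth_wrt_frame M k e U (s + t)"
    unfolding smooth_wrt_frame_def
    by (intro exI[of _ "\<lambda>i y. c i y + d i y"])
       (auto intro: smooth_at_points_add simp: scaleR_add_left sum.distrib)
qed

lemma sections_smul: "f \<in> Cinf \<Longrightarrow> s \<in> sections E \<Longrightarrow> smul f s \<in> sections E"
proof (rule sectionsI)
  assume st: "f \<in> Cinf" "s \<in> sections E"
  show "smul f s x = 0" if "x \<notin> points M" for x using sections_off[OF st(2) that] by simp
  show "smul f s x \<in> fibre E x" if "x \<in> points M" for x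
    using st that sections_fibre frame_subspace subspace_scale by (metis smul_apply)
  fix U e assume fr: "(U, e) \<in> \<F>"
  obtain c where "\<And>i. i < k \<Longrightarrow> smooth_at_points M U (c i)" "\<And>y. y \<in> U \<Longrightarrow> s y = (\<Sum>i<k. c i y *\<^sub>R e i y)"
    using sections_frame[OF st(2) fr] unfolding smooth_wrt_frame_def by blast
  moreover have "smooth_at_points M U f"
    using smooth_fn_at[OF st(1) openin_subset[OF frame_open[OF fr]]] .
  ultimately show "smooth_wrt_frame M k e U (smul f s)"
    unfolding smooth_wrt_frame_def
    by (intro exI[of _ "\<lambda>i y. f y * c i y"])
       (auto intro: smooth_at_points_mult simp: scaleR_sum_right)
qed

lemma sections_zero: "0 \<in> sections E"
proof (rule sectionsI)
  show "0 x \<in> fibre E x" if "x \<in> points M" for x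
    using frame_subspace[OF that] by (simp add: subspace_0)
  show "smooth_wrt_frame M k e U 0" for U e
    unfolding smooth_wrt_frame_def by (intro exI[of _ "\<lambda>i y. 0"]) (auto intro: smooth_at_points_const)
qed simp

text \<open>A frame \<open>e\<close> around \<open>x\<close> is cut off by a bump function \<open>\<eta>\<close>: the generators are \<open>t\<^sub>i = \<eta> e\<^sub>i\<close>, and the
coefficients are \<open>\<kappa>\<^sub>i(s) = \<eta> c\<^sub>i\<close> if \<open>s = \<Sum> c\<^sub>i e\<^sub>i\<close>.  All of them are global, at the price of the factor \<open>\<eta>\<^sup>2\<close>.\<close>

lemma local_generators:
  assumes "x \<in> points M"
  obtains \<eta> N t \<kappa> where "\<eta> \<in> Cinf" "openin (mtop M) N" "x \<in> N" "\<And>y. y \<in> N \<Longrightarrow> \<eta> y = 1"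
    "\<And>i. i < k \<Longrightarrow> t i \<in> sections E"
    "\<And>v. v \<in> fibre E x \<Longrightarrow> \<exists>a. v = (\<Sum>i<k. a i *\<^sub>R t i x)"
    "\<And>i s. i < k \<Longrightarrow> s \<in> sections E \<Longrightarrow> \<kappa> i s \<in> Cinf"
    "\<And>s. s \<in> sections E \<Longrightarrow> smul (\<lambda>y. \<eta> y * \<eta> y) s = (\<Sum>i<k. smul (\<kappa> i s) (t i))"
    "\<And>i s s' y. i < k \<Longrightarrow> s \<in> sections E \<Longrightarrow> s' \<in> sections E \<Longrightarrow> \<kappa> i (s + s') y = \<kappa> i s y + \<kappa> i s' y"
    "\<And>i f s y. i < k \<Longrightarrow> s \<in> sections E \<Longrightarrow> f \<in> Cinf \<Longrightarrow> \<kappa> i (smul f s) y = f y * \<kappa> i s y"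
    "\<And>i s y. i < k \<Longrightarrow> s \<in> sections E \<Longrightarrow> s y = 0 \<Longrightarrow> \<kappa> i s y = 0"
proof -
  obtain U e where fr: "(U, e) \<in> \<F>" "x \<in> U" using frame_at[OF assms] by blast
  obtain \<eta> N where \<eta>: "\<eta> \<in> Cinf" "supported_in \<eta> U" "openin (mtop M) N" "x \<in> N"
     "N \<subseteq> U" "\<And>y. y \<in> N \<Longrightarrow> \<eta> y = 1"
    by (rule bump_exists[OF frame_open[OF fr(1)] fr(2)]) (rule that)
  have UM: "U \<subseteq> points M" using frame_open[OF fr(1)] openin_subset by blast
  define cf where "cf y v = (SOME a. v = (\<Sum>i<k. a i *\<^sub>R e i y))" for y v
  have cf_ex: "v = (\<Sum>i<k. cf y v i *\<^sub>R e i y)" if "y \<in> U" "v \<in> fibre E y" for y v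
    unfolding cf_def by (rule someI_ex[where P = "\<lambda>a. v = (\<Sum>i<k. a i *\<^sub>R e i y)"]) (rule fibre_coeffs[OF fr(1) that])
  have cf: "cf y v i = a i" if "y \<in> U" "v = (\<Sum>i<k. a i *\<^sub>R e i y)" "i < k" for y v a i
  proof (rule frame_coeff_unique[OF fr(1) that(1) _ that(3)])
    have "v = (\<Sum>i<k. cf y v i *\<^sub>R e i y)" unfolding cf_def
      by (rule someI[where P = "\<lambda>a. v = (\<Sum>i<k. a i *\<^sub>R e i y)"]) (rule that(2))
    then show "(\<Sum>i<k. cf y v i *\<^sub>R e i y) = (\<Sum>i<k. a i *\<^sub>R e i y)" using that(2) by simp
  qed
  define t where "t i = smul \<eta> (e i)" for i
  define \<kappa> where "\<kappa> i s y = \<eta> y * cf y (s y) i" for i s y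
  have off: "\<eta> y = 0" if "y \<notin> U" for y using supported_in_off[OF \<eta>(2) that] .
  have sec: "s y = (\<Sum>i<k. cf y (s y) i *\<^sub>R e i y)" if "s \<in> sections E" "y \<in> U" for s y
    using cf_ex sections_fibre that UM by blast
  have t_sec: "t i \<in> sections E" if i: "i < k" for i
  proof (rule sectionsI)
    show "t i y = 0" if "y \<notin> points M" for y using off that UM by (auto simp: t_def)
    show "t i y \<in> fibre E y" if "y \<in> points M" for y
      using frame_subspace[OF that] frame_in_fibre[OF fr(1) _ i, of y] off[of y]
      by (cases "y \<in> U") (auto simp: t_def subspace_scale subspace_0)
    fix U' e' assume fr': "(U', e') \<in> \<F>"
    obtain c where c: "\<And>j. j < k \<Longrightarrow> smooth_at_points M (U' \<inter> U) (c j)"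
       "\<And>y. y \<in> U' \<inter> U \<Longrightarrow> e i y = (\<Sum>j<k. c j y *\<^sub>R e' j y)"
      using frames_compatible[OF fr' fr(1) i] unfolding smooth_wrt_frame_def by blast
    have "smooth_at_points M U' (\<lambda>y. \<eta> y * c j y)" if "j < k" for j
      using c(1)[OF that] smooth_fn_at[OF \<eta>(1)] frame_open[OF fr'] openin_subset
      by (intro cutoff_at[OF frame_open[OF fr(1)] frame_open[OF fr'] \<eta>(2)]) (auto simp: Int_commute)
    moreover have "t i y = (\<Sum>j<k. (\<eta> y * c j y) *\<^sub>R e' j y)" if "y \<in> U'" for y
      using c(2)[of y] that off[of y] by (cases "y \<in> U") (auto simp: t_def scaleR_sum_right)
    ultimately show "smooth_wrt_frame M k e' U' (t i)"
      unfolding smooth_wrt_frame_def by (intro exI[of _ "\<lambda>j y. \<eta> y * c j y"]) auto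
  qed
  have k_smooth: "\<kappa> i s \<in> Cinf" if i: "i < k" and s: "s \<in> sections E" for i s
  proof -
    obtain c where c: "\<And>i. i < k \<Longrightarrow> smooth_at_points M U (c i)" "\<And>y. y \<in> U \<Longrightarrow> s y = (\<Sum>i<k. c i y *\<^sub>R e i y)"
      using sections_frame[OF s fr(1)] unfolding smooth_wrt_frame_def by blast
    have "\<kappa> i s = (\<lambda>y. \<eta> y * c i y)"
      using cf[OF _ c(2) i] off by (force simp: \<kappa>_def)
    then show ?thesis
      using cutoff_smooth[OF frame_open[OF fr(1)] \<eta>(2,1) c(1)[OF i]] by simp
  qed
  have gen: "smul (\<lambda>y. \<eta> y * \<eta> y) s = (\<Sum>i<k. smul (\<kappa> i s) (t i))" if s: "s \<in> sections E" for s
  proof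
    fix y
    show "smul (\<lambda>y. \<eta> y * \<eta> y) s y = (\<Sum>i<k. smul (\<kappa> i s) (t i)) y"
    proof (cases "y \<in> U")
      case True
      have "(\<Sum>i<k. smul (\<kappa> i s) (t i)) y = (\<eta> y * \<eta> y) *\<^sub>R (\<Sum>i<k. cf y (s y) i *\<^sub>R e i y)"
        by (simp add: fun_sum_apply \<kappa>_def t_def scaleR_sum_right ac_simps)
      then show ?thesis using sec[OF s True] by simp
    qed (simp add: off fun_sum_apply \<kappa>_def)
  qed
  show thesis
  proof (rule that[of \<eta> N t \<kappa>])
    show "\<exists>a. v = (\<Sum>i<k. a i *\<^sub>R t i x)" if "v \<in> fibre E x" for v
      using fibre_coeffs[OF fr that] \<eta>(4,6) by (simp add: t_def)
    show "\<kappa> i (s + s') y = \<kappa> i s y + \<kappa> i s' y" if "i < k" "s \<in> sections E" "s' \<in> sections E" for i s s' y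
    proof (cases "y \<in> U")
      case True
      have "(s + s') y = (\<Sum>i<k. (cf y (s y) i + cf y (s' y) i) *\<^sub>R e i y)"
        using sec[OF that(2) True] sec[OF that(3) True] by (simp add: scaleR_add_left sum.distrib)
      from cf[OF True this that(1)] show ?thesis by (simp add: \<kappa>_def distrib_left)
    qed (simp add: off \<kappa>_def)
    show "\<kappa> i (smul f s) y = f y * \<kappa> i s y" if "i < k" "s \<in> sections E" for i f s y
    proof (cases "y \<in> U")
      case True
      have "smul f s y = (\<Sum>i<k. (f y * cf y (s y) i) *\<^sub>R e i y)"
        by (subst smul_apply, subst sec[OF that(2) True]) (simp add: scaleR_sum_right)
      from cf[OF True this that(1)] show ?thesis by (simp add: \<kappa>_def)
    qed (simp add: off \<kappa>_def)
    show "\<kappa> i s y = 0" if "i < k" "s y = 0" for i s y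
    proof (cases "y \<in> U")
      case True
      have "s y = (\<Sum>i<k. 0 *\<^sub>R e i y)" using that(2) by simp
      from cf[OF True this that(1)] show ?thesis by (simp add: \<kappa>_def)
    qed (simp add: off \<kappa>_def)
  qed (use \<eta> t_sec k_smooth gen in auto)
qed

lemma sections_sum: "(\<And>i. i \<in> I \<Longrightarrow> s i \<in> sections E) \<Longrightarrow> (\<Sum>i\<in>I. s i) \<in> sections E"
  by (induction I rule: infinite_finite_induct) (auto intro: sections_add sections_zero)

sublocale section_module M E
proof
  fix x e assume x: "x \<in> points M" and "e \<in> fibre E x"
  obtain \<eta> N t and \<kappa> :: "nat \<Rightarrow> ('m \<Rightarrow> 'e) \<Rightarrow> 'm \<Rightarrow> real" where
    t: "\<And>i. i < k \<Longrightarrow> t i \<in> sections E" "\<And>v. v \<in> fibre E x \<Longrightarrow> \<exists>a. v = (\<Sum>i<k. a i *\<^sub>R t i x)"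
    using local_generators[OF x] by metis
  obtain a where a: "e = (\<Sum>i<k. a i *\<^sub>R t i x)" using t(2) \<open>e \<in> fibre E x\<close> by blast
  have "smul (const_fn (a i)) (t i) \<in> sections E" if "i < k" for i
    using sections_smul[OF const_fn_smooth t(1)[OF that]] .
  then have "(\<Sum>i<k. smul (const_fn (a i)) (t i)) \<in> sections E" by (intro sections_sum) auto
  moreover have "(\<Sum>i<k. smul (const_fn (a i)) (t i)) x = e"
    using x by (simp add: fun_sum_apply a const_fn_def)
  ultimately show "\<exists>s\<in>sections E. s x = e" by blast
next
  fix s x assume s: "s \<in> sections E" and x: "x \<in> points M" "s x = 0"
  obtain \<eta> N t \<kappa> where g: "\<eta> \<in> Cinf" "x \<in> N" "\<And>y. y \<in> N \<Longrightarrow> \<eta> y = 1"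
    "\<And>i. i < k \<Longrightarrow> t i \<in> sections E"
    "\<And>i s. i < k \<Longrightarrow> s \<in> sections E \<Longrightarrow> \<kappa> i s \<in> Cinf"
    "\<And>s. s \<in> sections E \<Longrightarrow> smul (\<lambda>y. \<eta> y * \<eta> y) s = (\<Sum>i<k. smul (\<kappa> i s) (t i))"
    "\<And>i s y. i < k \<Longrightarrow> s \<in> sections E \<Longrightarrow> s y = 0 \<Longrightarrow> \<kappa> i s y = 0"
    by (rule local_generators[OF x(1)]) blast
  show "s \<in> span {smul f t |f t. f \<in> Cinf \<and> f x = 0 \<and> t \<in> sections E}"
    using g(1-5,7) s x by (intro in_span_vanishing[OF x(1) _ _ s sections_off[OF s] _ _ _ g(6)[OF s]] smooth_fn_mult) auto
qed (auto intro: frame_subspace sections_off sections_fibre sections_zero sections_add sections_smul)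

text \<open>Serves \<open>rho_bracket\<close>, where a zero fibre of a Lie algebroid has to force all sections to be zero.\<close>

lemma constant_rank:
  "(\<forall>x\<in>points M. fibre E x = {0}) \<or> (\<forall>x\<in>points M. \<exists>v\<in>fibre E x. v \<noteq> 0)"
proof (cases "k = 0")
  case True
  have "fibre E x = {0}" if x: "x \<in> points M" for x
  proof -
    obtain U e where "(U, e) \<in> \<F>" "x \<in> U" using frame_at[OF x] by blast
    from frame_span[OF this] show ?thesis using True by simp
  qed
  then show ?thesis by blast
next
  case False
  have "\<exists>v\<in>fibre E x. v \<noteq> 0" if x: "x \<in> points M" for x
  proof -
    obtain U e where fr: "(U, e) \<in> \<F>" "x \<in> U" using frame_at[OF x] by blast
    then have "independent ((\<lambda>i. e i x) ` {..<k})" using frames unfolding local_frame_def by blast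
    then have "e 0 x \<noteq> 0" using dependent_zero False by (metis imageI lessThan_iff neq0_conv)
    then show ?thesis using frame_in_fibre[OF fr] False by blast
  qed
  then show ?thesis by blast
qed

end

context smooth_mfd
begin

lemma vector_bundle_framed:
  assumes "vector_bundle M E"
  shows "\<exists>k \<F>. framed_bundle M E k \<F>"
proof -
  obtain k \<F> where "\<forall>(U, e)\<in>\<F>. local_frame M E k U e" "(\<Union>(U, e)\<in>\<F>. U) = points M"
    "\<forall>(U, e)\<in>\<F>. \<forall>(U', e')\<in>\<F>. \<forall>j<k. smooth_wrt_frame M k e (U \<inter> U') (e' j)"
    "sections E = {s. (\<forall>x. x \<notin> points M \<longrightarrow> s x = 0) \<and> (\<forall>x\<in>points M. s x \<in> fibre E x) \<and>
              (\<forall>(U, e)\<in>\<F>. smooth_wrt_frame M k e U s)}"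
    using assms unfolding vector_bundle_def by (elim exE conjE)
  note * = this
  have "framed_bundle_axioms M E k \<F>"
  proof (rule framed_bundle_axioms.intro)
    show "local_frame M E k U e" if "(U, e) \<in> \<F>" for U e
      using bspec[OF *(1) that] by simp
    show "smooth_wrt_frame M k e (U \<inter> U') (e' j)"
      if "(U, e) \<in> \<F>" "(U', e') \<in> \<F>" "j < k" for U e U' e' j
      using bspec[OF *(3) that(1)] that(2,3) by blast
  qed (fact *)+
  then have "framed_bundle M E k \<F>" by (rule framed_bundle.intro[OF smooth_mfd_axioms])
  then show ?thesis by blast
qed

lemma section_module_of_bundle:
  fixes E :: "('m, 'e::real_vector, 'z) vbundle_scheme"
  assumes "vector_bundle M E" shows "section_module M E"
proof -
  obtain k \<F> where "framed_bundle M E k \<F>" using vector_bundle_framed[OF assms] by blast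
  then interpret framed_bundle M E k \<F> .
  show ?thesis by (rule section_module_axioms)
qed

section \<open>The tangent bundle\<close>

abbreviation "TM \<equiv> tangent_algebroid M"

lemma TM_simps [simp]:
  "fibre TM = tangent_space M" "sections TM = Vect" "anchor TM = (\<lambda>x v. v)"
  by (simp_all add: tangent_algebroid_def)

lemma bracket_TM: "bracket TM X Y x f = X x (derive_by Y f) - Y x (derive_by X f)"
  by (simp add: tangent_algebroid_def)

lemma anchor_field_TM [simp]: "anchor_field TM X = X"
  by (simp add: anchor_field_def apply_section_def)

lemma derive_by_apply: "derive_by X f x = X x f"
  by (simp add: derive_by_def)

context
  fixes v x assumes v: "v \<in> tangent_space M x"
begin

lemma tv_nonsmooth: "f \<notin> Cinf \<Longrightarrow> v f = 0"
  using v unfolding tangent_space_def by blast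

lemma tv_mult: "f \<in> Cinf \<Longrightarrow> g \<in> Cinf \<Longrightarrow>
    v (\<lambda>y. f y * g y) = v f * g x + f x * v g"
  using v unfolding tangent_space_def by blast

lemma tv_linear: "f \<in> Cinf \<Longrightarrow> g \<in> Cinf \<Longrightarrow>
    v (\<lambda>y. a * f y + b * g y) = a * v f + b * v g"
  using v unfolding tangent_space_def by blast

lemma tv_add: "f \<in> Cinf \<Longrightarrow> g \<in> Cinf \<Longrightarrow> v (\<lambda>y. f y + g y) = v f + v g"
  using tv_linear[of f g 1 1] by simp

lemma tv_diff: "f \<in> Cinf \<Longrightarrow> g \<in> Cinf \<Longrightarrow> v (\<lambda>y. f y - g y) = v f - v g"
  using tv_linear[of f g 1 "-1"] by simp

lemma tv_cmult: "f \<in> Cinf \<Longrightarrow> v (\<lambda>y. a * f y) = a * v f"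
  using tv_linear[of f f a 0] by simp

lemma tv_const: "x \<in> points M \<Longrightarrow> v (const_fn c) = 0"
proof -
  assume x: "x \<in> points M"
  have "v (const_fn 1) = v (\<lambda>y. const_fn 1 y * const_fn 1 y)"
    by (rule arg_cong[of _ _ v]) (auto simp: const_fn_def)
  also have "\<dots> = v (const_fn 1) + v (const_fn 1)"
    using tv_mult[OF const_fn_smooth const_fn_smooth] x by (simp add: const_fn_def)
  finally have "v (const_fn 1) = 0" by simp
  moreover have "v (const_fn c) = v (\<lambda>y. c * const_fn 1 y)"
    by (rule arg_cong[of _ _ v]) (auto simp: const_fn_def)
  ultimately show ?thesis using tv_cmult[OF const_fn_smooth] by simp
qed

lemma tv_sum: "finite I \<Longrightarrow> (\<And>i. i \<in> I \<Longrightarrow> f i \<in> Cinf) \<Longrightarrow>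
    v (\<lambda>y. \<Sum>i\<in>I. f i y) = (\<Sum>i\<in>I. v (f i)) \<and> (\<lambda>y. \<Sum>i\<in>I. f i y) \<in> Cinf"
proof (induction I rule: finite_induct)
  case empty
  then show ?case using tv_cmult[OF smooth_fn_zero, of 0] smooth_fn_zero by simp
next
  case (insert i I)
  then show ?case using tv_add[of "f i" "\<lambda>y. \<Sum>i\<in>I. f i y"] smooth_fn_add[of "f i" "\<lambda>y. \<Sum>i\<in>I. f i y"] by simp
qed

end

lemma tangent_subspace: "subspace (tangent_space M x)"
  by (rule subspaceI) (auto simp: tangent_space_def algebra_simps)

lemma vf_tangent: "X \<in> Vect \<Longrightarrow> x \<in> points M \<Longrightarrow> X x \<in> tangent_space M x"
  unfolding vector_fields_def by blast

lemma vf_off: "X \<in> Vect \<Longrightarrow> x \<notin> points M \<Longrightarrow> X x = 0"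
  unfolding vector_fields_def by blast

lemma vf_smooth: "X \<in> Vect \<Longrightarrow> f \<in> Cinf \<Longrightarrow> derive_by X f \<in> Cinf"
  unfolding vector_fields_def by blast

lemma vfI: "(\<And>x. x \<notin> points M \<Longrightarrow> X x = 0) \<Longrightarrow> (\<And>x. x \<in> points M \<Longrightarrow> X x \<in> tangent_space M x) \<Longrightarrow>
  (\<And>f. f \<in> Cinf \<Longrightarrow> derive_by X f \<in> Cinf) \<Longrightarrow> X \<in> Vect"
  unfolding vector_fields_def by blast

lemma vf_zero: "0 \<in> Vect"
  by (rule vfI) (auto simp: tangent_subspace subspace_0 derive_by_def smooth_fn_zero)

lemma vf_add: "X \<in> Vect \<Longrightarrow> Y \<in> Vect \<Longrightarrow> X + Y \<in> Vect"
  using smooth_fn_add[OF vf_smooth vf_smooth, of X _ Y]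
  by (intro vfI) (auto simp: vf_off derive_by_def intro: subspace_add[OF tangent_subspace] vf_tangent)

lemma vf_smul: "f \<in> Cinf \<Longrightarrow> X \<in> Vect \<Longrightarrow> smul f X \<in> Vect"
  using smooth_fn_mult[OF _ vf_smooth, of f X]
  by (intro vfI) (auto simp: vf_off derive_by_def intro: subspace_scale[OF tangent_subspace] vf_tangent)

lemma vf_sum: "(\<And>i. i \<in> I \<Longrightarrow> X i \<in> Vect) \<Longrightarrow> (\<Sum>i\<in>I. X i) \<in> Vect"
  by (induction I rule: infinite_finite_induct) (auto intro: vf_add vf_zero)

definition coord_deriv :: "'m set \<Rightarrow> ('m \<Rightarrow> 'b) \<Rightarrow> 'b \<Rightarrow> ('m \<Rightarrow> real) \<Rightarrow> 'm \<Rightarrow> real" where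
  "coord_deriv U \<phi> b f y = frechet_derivative (coord_rep U \<phi> f) (at (\<phi> y)) b"

lemma coord_rep_derivative:
  assumes "(U, \<phi>) \<in> atlas M" "y \<in> U" "f \<in> Cinf"
  shows "(coord_rep U \<phi> f has_derivative frechet_derivative (coord_rep U \<phi> f) (at (\<phi> y))) (at (\<phi> y))"
  using Ck_on_derivative[OF coord_rep_smooth[OF assms(1,3), of "Suc 0"] open_coord_dom[OF assms(1)]
      chart_in_coord_dom[OF assms(1,2)]] .

lemma coord_deriv_linear:
  assumes "(U, \<phi>) \<in> atlas M" "y \<in> U" "f \<in> Cinf" "g \<in> Cinf"
  shows "coord_deriv U \<phi> b (\<lambda>y. a * f y + c * g y) y = a * coord_deriv U \<phi> b f y + c * coord_deriv U \<phi> b g y"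
proof -
  have "((\<lambda>z. a * coord_rep U \<phi> f z + c * coord_rep U \<phi> g z) has_derivative
     (\<lambda>b. a * coord_deriv U \<phi> b f y + c * coord_deriv U \<phi> b g y)) (at (\<phi> y))" (is "(_ has_derivative ?D) _")
    unfolding coord_deriv_def
    using coord_rep_derivative[OF assms(1,2,3)] coord_rep_derivative[OF assms(1,2,4)]
    by (auto intro!: derivative_eq_intros)
  moreover have "(\<lambda>z. a * coord_rep U \<phi> f z + c * coord_rep U \<phi> g z) = coord_rep U \<phi> (\<lambda>y. a * f y + c * g y)"
    by (simp add: coord_rep_def)
  ultimately have "(coord_rep U \<phi> (\<lambda>y. a * f y + c * g y) has_derivative ?D) (at (\<phi> y))" by simp
  from fun_cong[OF frechet_derivative_at[OF this], of b] show ?thesis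
    by (simp add: coord_deriv_def[of U \<phi> b "\<lambda>y. a * f y + c * g y"])
qed

lemma coord_deriv_mult:
  assumes "(U, \<phi>) \<in> atlas M" "y \<in> U" "f \<in> Cinf" "g \<in> Cinf"
  shows "coord_deriv U \<phi> b (\<lambda>y. f y * g y) y = coord_deriv U \<phi> b f y * g y + f y * coord_deriv U \<phi> b g y"
proof -
  have "((\<lambda>z. coord_rep U \<phi> f z * coord_rep U \<phi> g z) has_derivative
     (\<lambda>b. coord_deriv U \<phi> b f y * g y + f y * coord_deriv U \<phi> b g y)) (at (\<phi> y))" (is "(_ has_derivative ?D) _")
    unfolding coord_deriv_def
    using has_derivative_mult[OF coord_rep_derivative[OF assms(1,2,3)] coord_rep_derivative[OF assms(1,2,4)]]
    by (simp add: assms(1,2) algebra_simps)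
  moreover have "(\<lambda>z. coord_rep U \<phi> f z * coord_rep U \<phi> g z) = coord_rep U \<phi> (\<lambda>y. f y * g y)"
    by (simp add: coord_rep_def)
  ultimately have "(coord_rep U \<phi> (\<lambda>y. f y * g y) has_derivative ?D) (at (\<phi> y))" by simp
  from fun_cong[OF frechet_derivative_at[OF this], of b] show ?thesis
    by (simp add: coord_deriv_def[of U \<phi> b "\<lambda>y. f y * g y"])
qed

text \<open>The coordinate vector field \<open>\<eta> \<partial>\<^sub>b\<close>, extended by zero.\<close>

definition coord_field :: "('m \<Rightarrow> real) \<Rightarrow> 'm set \<Rightarrow> ('m \<Rightarrow> 'b) \<Rightarrow> 'b \<Rightarrow> 'm \<Rightarrow> 'm tvec" where
  "coord_field \<eta> U \<phi> b = (\<lambda>y f. if y \<in> U \<and> f \<in> Cinf then \<eta> y * coord_deriv U \<phi> b f y else 0)"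

context
  fixes U \<phi> \<eta>
  assumes ch: "(U, \<phi>) \<in> atlas M" and \<eta>: "\<eta> \<in> Cinf" "supported_in \<eta> U"
begin

lemma coord_field_vf: "coord_field \<eta> U \<phi> b \<in> Vect"
proof (rule vfI)
  show "coord_field \<eta> U \<phi> b y = 0" if "y \<notin> points M" for y
    using that chart_subset[OF ch] by (auto simp: coord_field_def fun_eq_iff)
  show "coord_field \<eta> U \<phi> b y \<in> tangent_space M y" for y
  proof (cases "y \<in> U")
    case True
    then show ?thesis
      using coord_deriv_linear[OF ch True] coord_deriv_mult[OF ch True] smooth_fn_mult
        smooth_fn_add[OF smooth_fn_cmult smooth_fn_cmult]
      by (auto simp: tangent_space_def coord_field_def algebra_simps)
  qed (auto simp: tangent_space_def coord_field_def)
  show "derive_by (coord_field \<eta> U \<phi> b) f \<in> Cinf" if f: "f \<in> Cinf" for f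
  proof -
    have "smooth_at_points M U (coord_deriv U \<phi> b f)"
    proof (rule smooth_at_points_chart[OF ch chart_open[OF ch] order_refl open_coord_dom[OF ch]])
      show "Ck_on k (\<lambda>z. frechet_derivative (coord_rep U \<phi> f) (at z) b) (coord_dom U \<phi>)" for k
        using coord_rep_smooth[OF ch f, of "Suc k"] by simp
    qed (auto simp: coord_deriv_def chart_in_coord_dom[OF ch])
    from cutoff_smooth[OF chart_open[OF ch] \<eta>(2,1) this]
    have "(\<lambda>y. \<eta> y * coord_deriv U \<phi> b f y) \<in> Cinf" .
    moreover have "derive_by (coord_field \<eta> U \<phi> b) f = (\<lambda>y. \<eta> y * coord_deriv U \<phi> b f y)"
      using supported_in_off[OF \<eta>(2)] f by (auto simp: derive_by_def coord_field_def)
    ultimately show ?thesis by simp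
  qed
qed

definition cutoff_coord :: "'b \<Rightarrow> 'm \<Rightarrow> real" where
  "cutoff_coord b y = \<eta> y * (\<phi> y \<bullet> b)"

lemma cutoff_coord_smooth: "cutoff_coord b \<in> Cinf"
proof -
  have "smooth_at_points M U (\<lambda>y. \<phi> y \<bullet> b)"
    by (rule smooth_at_points_chart[OF ch chart_open[OF ch] order_refl open_UNIV, of "\<lambda>z. z \<bullet> b"])
       (auto intro!: Ck_on_bounded_linear bounded_linear_inner_left)
  then show ?thesis
    unfolding cutoff_coord_def[abs_def] by (rule cutoff_smooth[OF chart_open[OF ch] \<eta>(2,1)])
qed

text \<open>Up to the factor \<open>\<eta> y * \<eta> y\<close> this is the expansion of \<open>v\<close> in coordinate derivatives.  By Hadamard's lemma,
\<open>f - f y\<close> is a sum of products of \<open>(\<phi> - \<phi> y) \<bullet> b\<close> with functions whose values at \<open>y\<close> are the partial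
derivatives of \<open>f\<close>, and a derivation at \<open>y\<close> sees only these values because the first factors vanish
at \<open>y\<close>.  As coordinates are not global
functions, the first factors are replaced by \<open>\<eta> y * h b - h b y * \<eta>\<close>, where \<open>h b\<close> is the cut off
coordinate; they equal \<open>\<eta> y * \<eta> * ((\<phi> - \<phi> y) \<bullet> b)\<close> and vanish at \<open>y\<close>.\<close>

lemma tangent_expansion:
  assumes y: "y \<in> U" and v: "v \<in> tangent_space M y" and f: "f \<in> Cinf"
  shows "\<eta> y * \<eta> y * v f =
    (\<Sum>b\<in>Basis. (\<eta> y * v (cutoff_coord b) - v \<eta> * cutoff_coord b y) * coord_deriv U \<phi> b f y)"
proof -
  have yM: "y \<in> points M" using y chart_subset[OF ch] by blast
  obtain r where r: "r > 0" "ball (\<phi> y) r \<subseteq> coord_dom U \<phi>"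
    using open_coord_dom[OF ch] chart_in_coord_dom[OF ch y] open_contains_ball by blast
  have "\<exists>g. \<forall>b. (\<forall>k. Ck_on k (g b) (ball (\<phi> y) r)) \<and> g b (\<phi> y) = frechet_derivative (coord_rep U \<phi> f) (at (\<phi> y)) b \<and>
     (\<forall>z\<in>ball (\<phi> y) r. coord_rep U \<phi> f z = coord_rep U \<phi> f (\<phi> y) + (\<Sum>b\<in>Basis. ((z - \<phi> y) \<bullet> b) * g b z))"
    by (rule Hadamard[OF r(1)]) (rule Ck_on_subset[OF coord_rep_smooth[OF ch f] r(2)])
  then obtain g where g: "\<And>b k. Ck_on k (g b) (ball (\<phi> y) r)" "\<And>b. g b (\<phi> y) = coord_deriv U \<phi> b f y"
    "\<And>z. z \<in> ball (\<phi> y) r \<Longrightarrow> coord_rep U \<phi> f z = coord_rep U \<phi> f (\<phi> y) + (\<Sum>b\<in>Basis. ((z - \<phi> y) \<bullet> b) * g b z)"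
    unfolding coord_deriv_def by blast
  define W where "W = {z\<in>U. \<phi> z \<in> ball (\<phi> y) r}"
  have W: "openin (mtop M) W" "y \<in> W" "W \<subseteq> U"
    using chart_preimage_open[OF ch open_ball] y r(1) by (auto simp: W_def)
  obtain \<zeta> N where \<zeta>: "\<zeta> \<in> Cinf" "supported_in \<zeta> W" "y \<in> N" "\<And>z. z \<in> N \<Longrightarrow> \<zeta> z = 1"
    using bump_exists[OF W(1,2)] by metis
  define G where "G b z = \<zeta> z * g b (\<phi> z)" for b z
  have G: "G b \<in> Cinf" for b
  proof -
    have "smooth_at_points M W (\<lambda>z. g b (\<phi> z))"
      by (rule smooth_at_points_chart[OF ch W(1,3) open_ball _ g(1)[of _ b]]) (auto simp: W_def)
    then show ?thesis unfolding G_def[abs_def] by (rule cutoff_smooth[OF W(1) \<zeta>(2,1)])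
  qed
  define F where "F z = f z - const_fn (f y) z" for z
  have F: "F \<in> Cinf" unfolding F_def[abs_def] by (intro smooth_fn_diff f const_fn_smooth)
  have Fy: "F y = 0" using yM by (simp add: F_def const_fn_def)
  have vF: "v F = v f"
    unfolding F_def[abs_def] using tv_diff[OF v f const_fn_smooth] tv_const[OF v yM] by simp
  define H where "H b z = \<eta> y * cutoff_coord b z - cutoff_coord b y * \<eta> z" for b z
  have H: "H b \<in> Cinf" for b
    unfolding H_def[abs_def] by (intro smooth_fn_diff smooth_fn_cmult cutoff_coord_smooth \<eta>(1))
  have Hy: "H b y = 0" for b by (simp add: H_def cutoff_coord_def)
  have vH: "v (H b) = \<eta> y * v (cutoff_coord b) - v \<eta> * cutoff_coord b y" for b
    unfolding H_def[abs_def]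
    using tv_diff[OF v smooth_fn_cmult smooth_fn_cmult, OF cutoff_coord_smooth \<eta>(1)]
      tv_cmult[OF v cutoff_coord_smooth] tv_cmult[OF v \<eta>(1)] by simp
  \<comment> \<open>The cut-off \<open>\<zeta>\<close> globalizes the functions that Hadamard's lemma provides on a ball only.\<close>
  have eq: "\<eta> y * ((\<zeta> z * \<eta> z) * F z) = (\<Sum>b\<in>Basis. H b z * G b z)" for z
  proof (cases "z \<in> W")
    case True
    then have zU: "z \<in> U" using W(3) by blast
    then have "f z = f y + (\<Sum>b\<in>Basis. ((\<phi> z - \<phi> y) \<bullet> b) * g b (\<phi> z))"
      using g(3)[of "\<phi> z"] True ch y by (simp add: W_def)
    moreover have "z \<in> points M" using zU chart_subset[OF ch] by blast
    ultimately have "F z = (\<Sum>b\<in>Basis. ((\<phi> z - \<phi> y) \<bullet> b) * g b (\<phi> z))"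
      by (simp add: F_def const_fn_def)
    then show ?thesis
      by (simp add: H_def G_def cutoff_coord_def sum_distrib_left inner_diff_left algebra_simps)
  next
    case False
    then show ?thesis using supported_in_off[OF \<zeta>(2)] by (simp add: G_def)
  qed
  have \<zeta>y: "\<zeta> y = 1" using \<zeta>(3,4) by blast
  have "v (\<lambda>z. \<eta> y * ((\<zeta> z * \<eta> z) * F z)) = \<eta> y * \<eta> y * v f"
    using tv_cmult[OF v smooth_fn_mult[OF smooth_fn_mult[OF \<zeta>(1) \<eta>(1)] F]]
      tv_mult[OF v smooth_fn_mult[OF \<zeta>(1) \<eta>(1)] F] Fy vF \<zeta>y by simp
  moreover have "v (\<lambda>z. \<Sum>b\<in>Basis. H b z * G b z) = (\<Sum>b\<in>Basis. v (\<lambda>z. H b z * G b z))"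
    using tv_sum[OF v finite_Basis, of "\<lambda>b z. H b z * G b z"] smooth_fn_mult[OF H G] by blast
  moreover have "v (\<lambda>z. H b z * G b z) = v (H b) * coord_deriv U \<phi> b f y" for b
    using tv_mult[OF v H G] Hy g(2) \<zeta>y by (simp add: G_def)
  ultimately show ?thesis by (simp add: eq vH)
qed

end

text \<open>By \<open>tangent_expansion\<close> the fields \<^const>\<open>coord_field\<close> generate the vector fields near \<open>x\<close>, with coefficients
that vanish where the vector field does.\<close>

sublocale T: section_module M "tangent_algebroid M"
proof
  fix x e assume x: "x \<in> points M" and e: "e \<in> fibre TM x"
  obtain U \<phi> where ch: "(U, \<phi>) \<in> atlas M" "x \<in> U" using chart_exists[OF x] by blast
  obtain \<eta> N where \<eta>: "\<eta> \<in> Cinf" "supported_in \<eta> U" "x \<in> N" "\<And>z. z \<in> N \<Longrightarrow> \<eta> z = 1"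
    using bump_exists[OF chart_open[OF ch(1)] ch(2)] by metis
  define a where "a b = e (cutoff_coord \<phi> \<eta> b) - e \<eta> * cutoff_coord \<phi> \<eta> b x" for b
  let ?E = "coord_field \<eta> U \<phi>"
  have \<eta>x: "\<eta> x = 1" using \<eta>(3,4) by blast
  have "(\<Sum>b\<in>Basis. smul (const_fn (a b)) (?E b)) \<in> Vect"
    by (intro vf_sum vf_smul const_fn_smooth coord_field_vf[OF ch(1) \<eta>(1,2)])
  moreover have "(\<Sum>b\<in>Basis. smul (const_fn (a b)) (?E b)) x = e"
  proof
    fix f
    show "(\<Sum>b\<in>Basis. smul (const_fn (a b)) (?E b)) x f = e f"
    proof (cases "f \<in> Cinf")
      case True
      then show ?thesis
        using tangent_expansion[OF ch(1) \<eta>(1,2) ch(2) _ True, of e] e x ch(2) \<eta>x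
        by (simp add: fun_sum_apply a_def const_fn_def coord_field_def)
    next
      case False
      then show ?thesis using tv_nonsmooth[of e x f] e by (simp add: fun_sum_apply coord_field_def)
    qed
  qed
  ultimately show "\<exists>s\<in>sections TM. s x = e" by auto
next
  fix X x assume X: "X \<in> sections TM" and x: "x \<in> points M" "X x = 0"
  obtain U \<phi> where ch: "(U, \<phi>) \<in> atlas M" "x \<in> U" using chart_exists[OF x(1)] by blast
  obtain \<eta> N where \<eta>: "\<eta> \<in> Cinf" "supported_in \<eta> U" "x \<in> N" "\<And>z. z \<in> N \<Longrightarrow> \<eta> z = 1"
    using bump_exists[OF chart_open[OF ch(1)] ch(2)] by metis
  let ?E = "coord_field \<eta> U \<phi>"
  let ?h = "cutoff_coord \<phi> \<eta>"
  define \<kappa> where "\<kappa> b y = \<eta> y * derive_by X (?h b) y - derive_by X \<eta> y * ?h b y" for b y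
  have hs: "?h b \<in> Cinf" for b by (rule cutoff_coord_smooth[OF ch(1) \<eta>(1,2)])
  have \<kappa>: "\<kappa> b \<in> Cinf" for b
    unfolding \<kappa>_def[abs_def] using X by (intro smooth_fn_diff smooth_fn_mult vf_smooth hs \<eta>(1)) auto
  let ?\<mu> = "\<lambda>y. \<eta> y * (\<eta> y * \<eta> y)"
  \<comment> \<open>This is \<open>tangent_expansion\<close> times \<open>\<eta>\<close>; the third factor \<open>\<eta>\<close> is the one inside the coordinate fields.\<close>
  have gen: "smul ?\<mu> X = (\<Sum>b\<in>Basis. smul (\<kappa> b) (?E b))"
  proof (intro ext)
    fix y f
    show "smul ?\<mu> X y f = (\<Sum>b\<in>Basis. smul (\<kappa> b) (?E b)) y f"
    proof (cases "y \<in> U \<and> f \<in> Cinf")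
      case True
      then have "X y \<in> tangent_space M y" using X vf_tangent chart_subset[OF ch(1)] by auto
      with tangent_expansion[OF ch(1) \<eta>(1,2) _ _ , of y "X y" f] True
      have "\<eta> y * (\<eta> y * \<eta> y * X y f) = \<eta> y * (\<Sum>b\<in>Basis. \<kappa> b y * coord_deriv U \<phi> b f y)"
        by (simp add: \<kappa>_def derive_by_def)
      then show ?thesis using True
        by (simp add: fun_sum_apply coord_field_def sum_distrib_left ac_simps)
    next
      case False
      have "X y f = 0" if "f \<notin> Cinf"
        using X that tv_nonsmooth[OF vf_tangent[of X y]] vf_off[of X y] by (cases "y \<in> points M") auto
      moreover have "\<eta> y = 0" if "y \<notin> U" using supported_in_off[OF \<eta>(2) that] .
      ultimately show ?thesis using False by (auto simp: fun_sum_apply coord_field_def)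
    qed
  qed
  have "\<kappa> b x = 0" for b using x(2) by (simp add: \<kappa>_def derive_by_def)
  moreover have "\<eta> x = 1" using \<eta>(3,4) by blast
  ultimately show "X \<in> span {smul f t |f t. f \<in> Cinf \<and> f x = 0 \<and> t \<in> sections TM}"
    using X \<eta>(1) \<kappa> coord_field_vf[OF ch(1) \<eta>(1,2)]
    by (intro in_span_vanishing[OF x(1) _ _ X _ _ _ _ gen] smooth_fn_mult) (auto intro: vf_off)
qed (auto intro: tangent_subspace vf_off vf_tangent vf_zero vf_add vf_smul)

lemma vf_apply_nonsmooth: "X \<in> Vect \<Longrightarrow> f \<notin> Cinf \<Longrightarrow> X x f = 0"
  using tv_nonsmooth[OF vf_tangent[of X x]] vf_off[of X x] by (cases "x \<in> points M") auto

lemma vf_bracket: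
  assumes X: "X \<in> Vect" and Y: "Y \<in> Vect"
  shows "bracket TM X Y \<in> Vect"
proof (rule vfI)
  show "bracket TM X Y x = 0" if "x \<notin> points M" for x
    using vf_off[OF X that] vf_off[OF Y that] by (auto simp: fun_eq_iff bracket_TM)
  show "derive_by (bracket TM X Y) f \<in> Cinf" if "f \<in> Cinf" for f
    using smooth_fn_diff[OF vf_smooth[OF X vf_smooth[OF Y that]] vf_smooth[OF Y vf_smooth[OF X that]]]
    by (simp add: derive_by_def bracket_TM)
  show "bracket TM X Y x \<in> tangent_space M x" if x: "x \<in> points M" for x
  proof -
    have lin: "derive_by Z (\<lambda>y. a * f y + b * g y) = (\<lambda>y. a * derive_by Z f y + b * derive_by Z g y)"
      and mul: "derive_by Z (\<lambda>y. f y * g y) = (\<lambda>y. derive_by Z f y * g y + f y * derive_by Z g y)"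
      if Z: "Z \<in> Vect" and fg: "f \<in> Cinf" "g \<in> Cinf" for Z f g a b
    proof -
      show "derive_by Z (\<lambda>y. a * f y + b * g y) = (\<lambda>y. a * derive_by Z f y + b * derive_by Z g y)"
      proof
        fix y show "derive_by Z (\<lambda>y. a * f y + b * g y) y = a * derive_by Z f y + b * derive_by Z g y"
          using tv_linear[OF vf_tangent[OF Z] fg] vf_off[OF Z, of y]
          by (cases "y \<in> points M") (auto simp: derive_by_def)
      qed
      show "derive_by Z (\<lambda>y. f y * g y) = (\<lambda>y. derive_by Z f y * g y + f y * derive_by Z g y)"
      proof
        fix y show "derive_by Z (\<lambda>y. f y * g y) y = derive_by Z f y * g y + f y * derive_by Z g y"
          using tv_mult[OF vf_tangent[OF Z] fg] vf_off[OF Z, of y]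
          by (cases "y \<in> points M") (auto simp: derive_by_def)
      qed
    qed
    note tX = vf_tangent[OF X x] and tY = vf_tangent[OF Y x]
    show ?thesis
      unfolding tangent_space_def
    proof (intro CollectI conjI ballI allI impI)
      fix f assume "f \<notin> Cinf"
      then have "derive_by Y f = (\<lambda>y. 0)" "derive_by X f = (\<lambda>y. 0)"
        using vf_apply_nonsmooth X Y by (auto simp: derive_by_def)
      then show "bracket TM X Y x f = 0"
        using tv_cmult[OF tX smooth_fn_zero, of 0] tv_cmult[OF tY smooth_fn_zero, of 0] by (simp add: bracket_TM)
    next
      fix f g and a b :: real assume fg: "f \<in> Cinf" "g \<in> Cinf"
      show "bracket TM X Y x (\<lambda>y. a * f y + b * g y) = a * bracket TM X Y x f + b * bracket TM X Y x g"
        unfolding bracket_TM lin[OF X fg] lin[OF Y fg]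
        using tv_linear[OF tX vf_smooth[OF Y fg(1)] vf_smooth[OF Y fg(2)]]
          tv_linear[OF tY vf_smooth[OF X fg(1)] vf_smooth[OF X fg(2)]]
        by (simp add: algebra_simps)
    next
      fix f g assume fg: "f \<in> Cinf" "g \<in> Cinf"
      have *: "Z x (\<lambda>y. derive_by Z' f y * g y + f y * derive_by Z' g y) =
         Z x (derive_by Z' f) * g x + derive_by Z' f x * Z x g + Z x f * derive_by Z' g x + f x * Z x (derive_by Z' g)"
        if Z: "Z \<in> Vect" "Z' \<in> Vect" for Z Z'
      proof -
        note tZ = vf_tangent[OF Z(1) x]
        show ?thesis
          using tv_add[OF tZ smooth_fn_mult[OF vf_smooth[OF Z(2) fg(1)] fg(2)] smooth_fn_mult[OF fg(1) vf_smooth[OF Z(2) fg(2)]]]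
            tv_mult[OF tZ vf_smooth[OF Z(2) fg(1)] fg(2)] tv_mult[OF tZ fg(1) vf_smooth[OF Z(2) fg(2)]]
          by simp
      qed
      show "bracket TM X Y x (\<lambda>y. f y * g y) = bracket TM X Y x f * g x + f x * bracket TM X Y x g"
        unfolding bracket_TM mul[OF X fg] mul[OF Y fg] *[OF X Y] *[OF Y X]
        by (simp add: derive_by_def algebra_simps)
    qed
  qed
qed

lemma derive_by_smul: "derive_by (smul f X) g = (\<lambda>x. f x * derive_by X g x)"
  by (simp add: derive_by_def)

lemma derive_by_add: "derive_by (X + Y) g = (\<lambda>x. derive_by X g x + derive_by Y g x)"
  by (simp add: derive_by_def)

lemma derive_by_bracket:
  "derive_by (bracket TM X Y) f = (\<lambda>x. derive_by X (derive_by Y f) x - derive_by Y (derive_by X f) x)"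
  by (simp add: derive_by_def bracket_TM)

lemma vf_eqI:
  assumes "X \<in> Vect" "Y \<in> Vect"
    "\<And>f x. f \<in> Cinf \<Longrightarrow> x \<in> points M \<Longrightarrow> X x f = Y x f"
  shows "X = Y"
proof (intro ext)
  fix x f
  show "X x f = Y x f"
    using assms(3)[of f x] vf_apply_nonsmooth[OF assms(1)] vf_apply_nonsmooth[OF assms(2)]
      vf_off[OF assms(1)] vf_off[OF assms(2)]
    by (cases "f \<in> Cinf"; cases "x \<in> points M") auto
qed

lemma bracket_TM_add_right:
  assumes "X \<in> Vect" "Y \<in> Vect" "Z \<in> Vect"
  shows "bracket TM X (Y + Z) = bracket TM X Y + bracket TM X Z"
proof (rule vf_eqI)
  fix f x assume "f \<in> Cinf" "x \<in> points M"
  then show "bracket TM X (Y + Z) x f = (bracket TM X Y + bracket TM X Z) x f"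
    using tv_add[OF vf_tangent[OF assms(1)] vf_smooth[OF assms(2)] vf_smooth[OF assms(3)], of x f f]
    by (simp add: bracket_TM derive_by_add)
qed (use assms in \<open>auto intro: vf_bracket vf_add\<close>)

lemma bracket_TM_smul_right:
  assumes "X \<in> Vect" "Y \<in> Vect" "f \<in> Cinf"
  shows "bracket TM X (smul f Y) = smul f (bracket TM X Y) + smul (derive_by X f) Y"
proof (rule vf_eqI)
  fix g x assume "g \<in> Cinf" "x \<in> points M"
  then show "bracket TM X (smul f Y) x g = (smul f (bracket TM X Y) + smul (derive_by X f) Y) x g"
    using tv_mult[OF vf_tangent[OF assms(1)] assms(3) vf_smooth[OF assms(2)], of x g]
    by (simp add: bracket_TM derive_by_smul derive_by_apply algebra_simps)
qed (use assms in \<open>auto intro!: vf_bracket vf_add vf_smul vf_smooth\<close>)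

lemma bracket_TM_anti: "bracket TM X Y = - bracket TM Y X"
  by (auto simp: fun_eq_iff bracket_TM)

lemma bracket_TM_add_left:
  assumes "X \<in> Vect" "Y \<in> Vect" "Z \<in> Vect"
  shows "bracket TM (X + Y) Z = bracket TM X Z + bracket TM Y Z"
  using bracket_TM_add_right[OF assms(3,1,2)] bracket_TM_anti[of "X + Y" Z] bracket_TM_anti[of X Z] bracket_TM_anti[of Y Z]
  by simp

lemma derive_by_fn_linear:
  assumes "X \<in> Vect" "f \<in> Cinf" "g \<in> Cinf"
  shows "derive_by X (\<lambda>y. f y + g y) x = derive_by X f x + derive_by X g x"
    "derive_by X (\<lambda>y. f y * g y) x = derive_by X f x * g x + f x * derive_by X g x"
  using assms tv_add[OF vf_tangent[OF assms(1)] assms(2,3), of x]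
    tv_mult[OF vf_tangent[OF assms(1)] assms(2,3), of x] vf_off[OF assms(1), of x]
  by (cases "x \<in> points M"; simp add: derive_by_def)+

end

section \<open>Existence of linear connections\<close>

context framed_bundle
begin

text \<open>A linear connection, except that the derivative of \<open>f\<close> in the Leibniz rule is multiplied by \<open>\<mu>\<close>.  Unlike
connections, these operators can be added and multiplied by functions, with the corresponding effect
on \<open>\<mu>\<close>.\<close>

definition partial_connection :: "('m \<Rightarrow> real) \<Rightarrow> ('m, 'm tvec, 'e) covariant \<Rightarrow> bool" where
  "partial_connection \<mu> P \<longleftrightarrow> \<mu> \<in> Cinf \<and>
     (\<forall>X\<in>Vect. \<forall>s\<in>sections E.
        P X s \<in> sections E \<and>
        (\<forall>Y\<in>Vect. P (X + Y) s = P X s + P Y s) \<and>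
        (\<forall>t\<in>sections E. P X (s + t) = P X s + P X t) \<and>
        (\<forall>f\<in>Cinf. P (smul f X) s = smul f (P X s) \<and>
           P X (smul f s) = smul f (P X s) + smul (\<lambda>x. \<mu> x * derive_by X f x) s))"

lemma partial_connection_zero: "partial_connection (\<lambda>x. 0) (\<lambda>X s. 0)"
  by (auto simp: partial_connection_def smooth_fn_zero sections_zero fun_eq_iff)

lemma partial_connection_combine:
  assumes "partial_connection \<mu> P" "partial_connection \<mu>' P'" "h \<in> Cinf"
  shows "partial_connection (\<lambda>x. \<mu> x + h x * \<mu>' x) (\<lambda>X s. P X s + smul h (P' X s))"
  unfolding partial_connection_def
proof (intro conjI ballI)
  show "(\<lambda>x. \<mu> x + h x * \<mu>' x) \<in> Cinf"
    using assms by (auto simp: partial_connection_def intro: smooth_fn_add smooth_fn_mult)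
  fix X s assume X: "X \<in> Vect" and s: "s \<in> sections E"
  have P: "P X s \<in> sections E" "\<And>Y. Y \<in> Vect \<Longrightarrow> P (X + Y) s = P X s + P Y s"
    "\<And>t. t \<in> sections E \<Longrightarrow> P X (s + t) = P X s + P X t"
    "\<And>f. f \<in> Cinf \<Longrightarrow> P (smul f X) s = smul f (P X s)"
    "\<And>f. f \<in> Cinf \<Longrightarrow> P X (smul f s) = smul f (P X s) + smul (\<lambda>x. \<mu> x * derive_by X f x) s"
    and P': "P' X s \<in> sections E" "\<And>Y. Y \<in> Vect \<Longrightarrow> P' (X + Y) s = P' X s + P' Y s"
    "\<And>t. t \<in> sections E \<Longrightarrow> P' X (s + t) = P' X s + P' X t"
    "\<And>f. f \<in> Cinf \<Longrightarrow> P' (smul f X) s = smul f (P' X s)"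
    "\<And>f. f \<in> Cinf \<Longrightarrow> P' X (smul f s) = smul f (P' X s) + smul (\<lambda>x. \<mu>' x * derive_by X f x) s"
    using assms(1,2) X s unfolding partial_connection_def by blast+
  show "P X s + smul h (P' X s) \<in> sections E"
    using P(1) P'(1) assms(3) by (intro sections_add sections_smul)
  fix Y assume Y: "Y \<in> Vect"
  show "P (X + Y) s + smul h (P' (X + Y) s) = P X s + smul h (P' X s) + (P Y s + smul h (P' Y s))"
    by (simp add: P(2)[OF Y] P'(2)[OF Y] fun_eq_iff algebra_simps)
next
  fix X s t assume X: "X \<in> Vect" and s: "s \<in> sections E" and t: "t \<in> sections E"
  have "P X (s + t) = P X s + P X t" "P' X (s + t) = P' X s + P' X t"
    using assms(1,2) X s t unfolding partial_connection_def by blast+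
  then show "P X (s + t) + smul h (P' X (s + t)) = P X s + smul h (P' X s) + (P X t + smul h (P' X t))"
    by (simp add: fun_eq_iff algebra_simps)
next
  fix X s f assume X: "X \<in> Vect" and s: "s \<in> sections E" and f: "f \<in> Cinf"
  have "P (smul f X) s = smul f (P X s)" "P' (smul f X) s = smul f (P' X s)"
    "P X (smul f s) = smul f (P X s) + smul (\<lambda>x. \<mu> x * derive_by X f x) s"
    "P' X (smul f s) = smul f (P' X s) + smul (\<lambda>x. \<mu>' x * derive_by X f x) s"
    using assms(1,2) X s f unfolding partial_connection_def by blast+
  then show "P (smul f X) s + smul h (P' (smul f X) s) = smul f (P X s + smul h (P' X s))"
    "P X (smul f s) + smul h (P' X (smul f s)) =
       smul f (P X s + smul h (P' X s)) + smul (\<lambda>x. (\<mu> x + h x * \<mu>' x) * derive_by X f x) s"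
    by (simp_all add: fun_eq_iff algebra_simps)
qed

text \<open>The flat connection of a frame, which differentiates coefficients.  For the cut off frame of
\<open>local_generators\<close> the Leibniz rule produces \<open>\<Sum> (X f) \<kappa>\<^sub>i(s) t\<^sub>i = \<eta>\<^sup>2 (X f) s\<close>.\<close>

lemma local_connection:
  assumes "x \<in> points M"
  shows "\<exists>\<mu> P N. partial_connection \<mu> P \<and> openin (mtop M) N \<and> x \<in> N \<and> (\<forall>y\<in>N. \<mu> y = 1)"
proof -
  obtain \<eta> N t \<kappa> where g: "\<eta> \<in> Cinf" "openin (mtop M) N" "x \<in> N" "\<And>y. y \<in> N \<Longrightarrow> \<eta> y = 1"
    "\<And>i. i < k \<Longrightarrow> t i \<in> sections E"
    "\<And>i s. i < k \<Longrightarrow> s \<in> sections E \<Longrightarrow> \<kappa> i s \<in> Cinf"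
    "\<And>s. s \<in> sections E \<Longrightarrow> smul (\<lambda>y. \<eta> y * \<eta> y) s = (\<Sum>i<k. smul (\<kappa> i s) (t i))"
    "\<And>i s s' y. i < k \<Longrightarrow> s \<in> sections E \<Longrightarrow> s' \<in> sections E \<Longrightarrow> \<kappa> i (s + s') y = \<kappa> i s y + \<kappa> i s' y"
    "\<And>i f s y. i < k \<Longrightarrow> s \<in> sections E \<Longrightarrow> f \<in> Cinf \<Longrightarrow> \<kappa> i (smul f s) y = f y * \<kappa> i s y"
    by (rule local_generators[OF assms]) blast
  define P where "P X s = (\<Sum>i<k. smul (derive_by X (\<kappa> i s)) (t i))" for X s
  let ?\<mu> = "\<lambda>y. \<eta> y * \<eta> y"
  have "partial_connection ?\<mu> P"
    unfolding partial_connection_def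
  proof (intro conjI ballI)
    show "?\<mu> \<in> Cinf" using g(1) smooth_fn_mult by blast
    fix X s assume X: "X \<in> Vect" and s: "s \<in> sections E"
    show "P X s \<in> sections E"
      unfolding P_def using X s g(5,6) by (intro sections_sum sections_smul vf_smooth) auto
    show "P (X + Y) s = P X s + P Y s" for Y
      by (simp add: P_def fun_eq_iff derive_by_def fun_sum_apply sum.distrib algebra_simps)
    show "P (smul f X) s = smul f (P X s)" for f
      by (simp add: P_def fun_eq_iff derive_by_def fun_sum_apply scaleR_sum_right)
    show "P X (s + u) = P X s + P X u" if u: "u \<in> sections E" for u
    proof -
      have "derive_by X (\<kappa> i (s + u)) y = derive_by X (\<kappa> i s) y + derive_by X (\<kappa> i u) y" if i: "i < k" for i y
      proof -
        have "\<kappa> i (s + u) = (\<lambda>y. \<kappa> i s y + \<kappa> i u y)" using g(8)[OF i s u] by blast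
        then show ?thesis using derive_by_fn_linear(1)[OF X g(6)[OF i s] g(6)[OF i u]] by simp
      qed
      then show ?thesis
        by (simp add: P_def fun_eq_iff fun_sum_apply algebra_simps flip: sum.distrib)
    qed
    show "P X (smul f s) = smul f (P X s) + smul (\<lambda>x. ?\<mu> x * derive_by X f x) s"
      if f: "f \<in> Cinf" for f
    proof
      fix y
      have "derive_by X (\<kappa> i (smul f s)) y = derive_by X f y * \<kappa> i s y + f y * derive_by X (\<kappa> i s) y" if i: "i < k" for i
      proof -
        have "\<kappa> i (smul f s) = (\<lambda>y. f y * \<kappa> i s y)" using g(9)[OF i s f] by blast
        then show ?thesis using derive_by_fn_linear(2)[OF X f g(6)[OF i s]] by simp
      qed
      then have eq: "P X (smul f s) y = f y *\<^sub>R P X s y + derive_by X f y *\<^sub>R (\<Sum>i<k. smul (\<kappa> i s) (t i)) y"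
        by (simp add: P_def fun_sum_apply scaleR_sum_right scaleR_add_left sum.distrib add.commute)
      show "P X (smul f s) y = (smul f (P X s) + smul (\<lambda>x. ?\<mu> x * derive_by X f x) s) y"
        unfolding eq g(7)[OF s, symmetric] by (simp add: mult.commute)
    qed
  qed
  then show ?thesis using g(2-4) by (intro exI[of _ ?\<mu>] exI[of _ P] exI[of _ N]) auto
qed

text \<open>Countably many open sets \<open>N\<^sub>n\<close> cover \<open>M\<close> such that a partial connection \<open>P\<^sub>n\<close> has \<open>\<mu>\<^sub>n = 1\<close> on \<open>N\<^sub>n\<close>.  Starting
with \<open>Q\<^sub>0 = 0\<close>, what the partial connection \<open>Q\<^sub>n\<close> lacks of a connection, namely \<open>\<nu>\<^sub>n\<close>, is filled with \<open>P\<^sub>n\<close>: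
\<open>Q\<^sub>n\<^sub>+\<^sub>1 = Q\<^sub>n + \<nu>\<^sub>n P\<^sub>n\<close> and \<open>\<nu>\<^sub>n\<^sub>+\<^sub>1 = \<nu>\<^sub>n (1 - \<mu>\<^sub>n)\<close>.  On \<open>N\<^sub>m\<close> all \<open>\<nu>\<^sub>n\<close> with \<open>n > m\<close> vanish, so that the sequence
of the \<open>Q\<^sub>n\<close> becomes constant there and its limit is a connection.  Local finiteness, which a
partition of unity has to arrange, is automatic here.\<close>

lemma connection_exists: "\<exists>nabla. linear_connection M E nabla"
proof -
  define good where "good N \<mu> P \<longleftrightarrow> partial_connection \<mu> P \<and> openin (mtop M) N \<and> (\<forall>y\<in>N. \<mu> y = 1)" for N \<mu> P
  let ?\<U> = "{N. \<exists>\<mu> P. good N \<mu> P}"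
  have "Lindelof_space (mtop M)"
    using mfd second_countable_imp_Lindelof_space unfolding smooth_manifold_def by (elim conjE)
  moreover have "\<Union>?\<U> = topspace (mtop M)"
  proof
    show "\<Union>?\<U> \<subseteq> points M" using openin_subset unfolding good_def by blast
    show "points M \<subseteq> \<Union>?\<U>"
    proof
      fix x assume "x \<in> points M"
      from local_connection[OF this] obtain \<mu> P N where
        N: "partial_connection \<mu> P" "openin (mtop M) N" "x \<in> N" "\<forall>y\<in>N. \<mu> y = 1" by (elim exE conjE)
      have "good N \<mu> P" unfolding good_def by (intro conjI N)
      then have "N \<in> ?\<U>" by (intro CollectI exI)
      then show "x \<in> \<Union>?\<U>" using N(3) by (rule UnionI)
    qed
  qed
  moreover have "openin (mtop M) N" if "N \<in> ?\<U>" for N using that unfolding good_def by blast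
  ultimately have "\<exists>\<V>. countable \<V> \<and> \<V> \<subseteq> ?\<U> \<and> \<Union>\<V> = points M"
    by (intro Lindelof_spaceD)
  then obtain \<V> where \<V>: "countable \<V>" "\<V> \<subseteq> ?\<U>" "\<Union>\<V> = points M" by (elim exE conjE)
  let ?W = "insert {} \<V>"
  \<comment> \<open>The empty set is added to obtain a sequence also if \<open>M\<close> is empty.\<close>
  have "good {} (\<lambda>x. 0) (\<lambda>X s. 0)" using partial_connection_zero by (simp add: good_def)
  then have "{} \<in> ?\<U>" by (intro CollectI exI)
  then have W: "?W \<subseteq> ?\<U>" using \<V>(2) by (intro insert_subsetI)
  define N where "N = from_nat_into ?W"
  have range: "range N = ?W" unfolding N_def using \<V>(1) by (intro range_from_nat_into) auto
  have "\<forall>n. \<exists>\<mu> P. good (N n) \<mu> P"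
    using subsetD[OF W[folded range] rangeI] by (simp only: mem_Collect_eq) simp
  then obtain \<mu> P where g: "\<And>n. good (N n) (\<mu> n) (P n)" by metis
  define \<nu> where "\<nu> = rec_nat (const_fn 1) (\<lambda>n v y. v y * (const_fn 1 y - \<mu> n y))"
  have \<nu>: "\<nu> 0 = const_fn 1" "\<nu> (Suc n) = (\<lambda>y. \<nu> n y * (const_fn 1 y - \<mu> n y))" for n
    by (simp_all add: \<nu>_def)
  define Q where "Q = rec_nat (\<lambda>X s. 0) (\<lambda>n R X s. R X s + smul (\<nu> n) (P n X s))"
  have Q: "Q 0 = (\<lambda>X s. 0)" "Q (Suc n) = (\<lambda>X s. Q n X s + smul (\<nu> n) (P n X s))" for n
    by (simp_all add: Q_def)
  have \<nu>s: "\<nu> n \<in> Cinf" for n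
    using g by (induction n) (auto simp: \<nu> good_def partial_connection_def intro!: const_fn_smooth smooth_fn_mult smooth_fn_diff)
  have Qc: "partial_connection (\<lambda>y. const_fn 1 y - \<nu> n y) (Q n)" for n
  proof (induction n)
    case 0
    show ?case unfolding \<nu>(1) Q(1) diff_self by (rule partial_connection_zero)
  next
    case (Suc n)
    have "(\<lambda>y. const_fn 1 y - \<nu> n y + \<nu> n y * \<mu> n y) = (\<lambda>y. const_fn 1 y - \<nu> (Suc n) y)"
      using smooth_fn_off[OF \<nu>s] by (auto simp: \<nu> const_fn_def algebra_simps)
    moreover have "partial_connection (\<mu> n) (P n)" using g[of n] by (simp add: good_def)
    ultimately have "partial_connection (\<lambda>y. const_fn 1 y - \<nu> (Suc n) y) (\<lambda>X s. Q n X s + smul (\<nu> n) (P n X s))"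
      using partial_connection_combine[OF Suc _ \<nu>s, of "\<mu> n" "P n" n] by simp
    then show ?case by (simp only: Q(2))
  qed
  have NM: "N m \<subseteq> points M" for m using g[of m] openin_subset unfolding good_def by blast
  have \<nu>0: "\<nu> (Suc m + n) y = 0" if "y \<in> N m" for m n y
    using g[of m] NM[of m] that by (induction n) (auto simp: \<nu> good_def const_fn_def)
  have stable: "Q (Suc m + n) X s y = Q (Suc m) X s y" if "y \<in> N m" for m n X s y
    using \<nu>0[OF that] by (induction n) (simp_all add: Q)
  \<comment> \<open>\<open>Q\<close> is stable at \<open>y\<close> one step after the first index whose set contains \<open>y\<close>.\<close>
  define lev where "lev y = Suc (LEAST m. y \<in> N m)" for y
  have lev: "Q (lev y) X s y = Q (Suc m) X s y" if "y \<in> N m" for y m X s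
  proof -
    have "lev y \<le> Suc m" using that by (simp add: lev_def Least_le)
    moreover have "y \<in> N (LEAST m. y \<in> N m)" using that by (rule LeastI)
    ultimately show ?thesis using stable[of y "LEAST m. y \<in> N m" "Suc m - lev y" X s] by (simp add: lev_def)
  qed
  have cover: "\<exists>m. y \<in> N m" if "y \<in> points M" for y
    using that \<V>(3) range by (metis UN_iff Union_iff insertCI)
  define nabla where "nabla X s = (if X \<in> Vect \<and> s \<in> sections E then (\<lambda>y. if y \<in> points M then Q (lev y) X s y else 0) else 0)" for X s
  have Qp: "Q n X s \<in> sections E" "\<And>Y. Y \<in> Vect \<Longrightarrow> Q n (X + Y) s = Q n X s + Q n Y s"
    "\<And>t. t \<in> sections E \<Longrightarrow> Q n X (s + t) = Q n X s + Q n X t"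
    "\<And>f. f \<in> Cinf \<Longrightarrow> Q n (smul f X) s = smul f (Q n X s)"
    "\<And>f. f \<in> Cinf \<Longrightarrow> Q n X (smul f s) = smul f (Q n X s) + smul (\<lambda>x. (const_fn 1 x - \<nu> n x) * derive_by X f x) s"
    if "X \<in> Vect" "s \<in> sections E" for n X s
    using Qc[of n] that unfolding partial_connection_def by blast+
  have \<nu>lev: "\<nu> (lev y) y = 0" if y: "y \<in> points M" for y
  proof -
    obtain m where "y \<in> N m" using cover[OF y] by blast
    then have "y \<in> N (LEAST m. y \<in> N m)" by (rule LeastI)
    from \<nu>0[OF this, of 0] show ?thesis by (simp add: lev_def)
  qed
  have leibniz: "nabla X (smul f s) = smul f (nabla X s) + smul (derive_by X f) s"
    if "X \<in> Vect" "s \<in> sections E" "f \<in> Cinf" for X s f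
    using that \<nu>lev sections_off[OF that(2)]
    by (auto simp: nabla_def fun_eq_iff Qp(5) sections_smul const_fn_def)
  have add_right: "nabla X (s + t) = nabla X s + nabla X t"
    if "X \<in> Vect" "s \<in> sections E" "t \<in> sections E" for X s t
    using that by (auto simp: nabla_def fun_eq_iff Qp(3) sections_add)
  have scale_right: "nabla X (a *\<^sub>R s) = a *\<^sub>R nabla X s"
    if "X \<in> Vect" "s \<in> sections E" for X s a
  proof -
    have eq: "a *\<^sub>R s = smul (const_fn a) s"
      using sections_off[OF that(2)] by (auto simp: fun_eq_iff const_fn_def)
    have "derive_by X (const_fn a) y = 0" for y
      using tv_const[OF vf_tangent[OF that(1)]] vf_off[OF that(1), of y] by (cases "y \<in> points M") (auto simp: derive_by_def)
    then have "nabla X (a *\<^sub>R s) = smul (const_fn a) (nabla X s)"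
      unfolding eq leibniz[OF that const_fn_smooth] by (simp add: fun_eq_iff)
    then show ?thesis by (auto simp: fun_eq_iff const_fn_def nabla_def)
  qed
  have "A_connection M TM E nabla"
    unfolding A_connection_def TM_simps anchor_field_TM
  proof (intro conjI allI ballI impI)
    show "nabla X s = 0" if "X \<notin> Vect \<or> s \<notin> sections E" for X s
      using that by (auto simp: nabla_def)
    fix X s assume Xs: "X \<in> Vect" "s \<in> sections E"
    show "nabla X s \<in> sections E"
    proof (rule section_local)
      show "nabla X s x = 0" if "x \<notin> points M" for x using that by (simp add: nabla_def)
      fix x assume "x \<in> points M"
      then obtain m where m: "x \<in> N m" using cover by blast
      have "\<forall>y\<in>N m. nabla X s y = Q (Suc m) X s y"
        using lev[of _ m] NM[of m] Xs by (auto simp: nabla_def)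
      then show "\<exists>N t. openin (mtop M) N \<and> x \<in> N \<and> t \<in> sections E \<and> (\<forall>y\<in>N. nabla X s y = t y)"
        using m g[of m] Qp(1)[OF Xs] unfolding good_def by blast
    qed
    show "nabla (X + Y) s = nabla X s + nabla Y s" if "Y \<in> Vect" for Y
      using that Xs by (auto simp: nabla_def fun_eq_iff Qp(2) vf_add)
    show "nabla X (a *\<^sub>R s + b *\<^sub>R t) = a *\<^sub>R nabla X s + b *\<^sub>R nabla X t" if "t \<in> sections E" for t a b
      using add_right[OF Xs(1) section_scaleR section_scaleR] scale_right[OF Xs(1)] Xs(2) that by simp
    show "nabla (smul f X) s = smul f (nabla X s)" if "f \<in> Cinf" for f
      using that Xs by (auto simp: nabla_def fun_eq_iff Qp(4) vf_smul)
    show "nabla X (smul f s) = smul f (nabla X s) + smul (derive_by X f) s" if "f \<in> Cinf" for f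
      using leibniz[OF Xs that] .
  qed
  then show ?thesis by blast
qed

end

section \<open>Endomorphisms and endomorphism-valued one-forms\<close>

context section_module
begin

abbreviation "EndE \<equiv> End_bundle M E"

lemma apply_section_apply [simp]: "apply_section h s x = h x (s x)"
  by (simp add: apply_section_def)

lemma End_bundle_simps [simp]:
  "fibre EndE x = hom_space (fibre E x) (fibre E x)"
  "h \<in> sections EndE \<longleftrightarrow> bundle_map M E E h"
  by (simp_all add: End_bundle_def)

lemma End_off_points: "h \<in> sections EndE \<Longrightarrow> x \<notin> points M \<Longrightarrow> h x = 0"
  by (simp add: bundle_map_def)

lemma End_hom: "h \<in> sections EndE \<Longrightarrow> x \<in> points M \<Longrightarrow> h x \<in> hom_space (fibre E x) (fibre E x)"
  by (simp add: bundle_map_def)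

lemma End_apply: "h \<in> sections EndE \<Longrightarrow> s \<in> sections E \<Longrightarrow> apply_section h s \<in> sections E"
  by (simp add: bundle_map_def)

lemma End_off_fibre: "h \<in> sections EndE \<Longrightarrow> e \<notin> fibre E x \<Longrightarrow> h x e = 0"
  by (cases "x \<in> points M") (auto simp: bundle_map_def hom_space_def)

lemma End_linear:
  assumes "h \<in> sections EndE" "x \<in> points M" "u \<in> fibre E x" "v \<in> fibre E x"
  shows "h x (a *\<^sub>R u + b *\<^sub>R v) = a *\<^sub>R h x u + b *\<^sub>R h x v"
  using End_hom[OF assms(1,2)] assms(3,4) unfolding hom_space_def by blast

lemma End_apply_add:
  assumes "h \<in> sections EndE" "s \<in> sections E" "t \<in> sections E"
  shows "apply_section h (s + t) = apply_section h s + apply_section h t"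
proof
  fix x show "apply_section h (s + t) x = (apply_section h s + apply_section h t) x"
    using End_linear[OF assms(1), of x "s x" "t x" 1 1] section_in[OF assms(2)] section_in[OF assms(3)]
      End_off_points[OF assms(1)] by (cases "x \<in> points M") auto
qed

lemma End_apply_smul:
  assumes "h \<in> sections EndE" "s \<in> sections E"
  shows "apply_section h (smul f s) = smul f (apply_section h s)"
proof
  fix x show "apply_section h (smul f s) x = smul f (apply_section h s) x"
    using End_linear[OF assms(1), of x "s x" "s x" "f x" 0] section_in[OF assms(2)]
      End_off_points[OF assms(1)] by (cases "x \<in> points M") auto
qed

lemma apply_add: "apply_section (h + h') s = apply_section h s + apply_section h' s"
  and apply_diff: "apply_section (h - h') s = apply_section h s - apply_section h' s"
  and apply_scaleR: "apply_section (a *\<^sub>R h) s = a *\<^sub>R apply_section h s"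
  and apply_smul: "apply_section (smul f h) s = smul f (apply_section h s)"
  and apply_zero: "apply_section 0 s = 0"
  for h h' :: "'m \<Rightarrow> 'x \<Rightarrow> 'w::real_vector"
  by (auto simp: fun_eq_iff apply_section_def)

lemma End_ext:
  assumes "h \<in> sections EndE" "h' \<in> sections EndE"
    "\<And>s. s \<in> sections E \<Longrightarrow> apply_section h s = apply_section h' s"
  shows "h = h'"
proof (intro ext)
  fix x e
  show "h x e = h' x e"
  proof (cases "x \<in> points M \<and> e \<in> fibre E x")
    case True
    then obtain s where s: "s \<in> sections E" "s x = e" using extend by blast
    from fun_cong[OF assms(3)[OF s(1)], of x] show ?thesis by (simp add: s(2))
  next
    case False
    then show ?thesis
      using End_off_points[OF assms(1)] End_off_points[OF assms(2)]
        End_off_fibre[OF assms(1)] End_off_fibre[OF assms(2)] by auto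
  qed
qed

lemma End_zero: "0 \<in> sections EndE"
  using section_zero fibre_subspace
  by (auto simp: bundle_map_def hom_space_def subspace_0 apply_section_def zero_fun_def)

lemma End_add:
  assumes "h \<in> sections EndE" "h' \<in> sections EndE" shows "h + h' \<in> sections EndE"
proof -
  have "apply_section (h + h') s = apply_section h s + apply_section h' s" for s by auto
  then show ?thesis
    using assms section_add
    by (auto simp: bundle_map_def hom_space_def algebra_simps intro!: subspace_add[OF fibre_subspace])
qed

lemma End_smul:
  assumes "f \<in> Cinf" "h \<in> sections EndE" shows "smul f h \<in> sections EndE"
proof -
  have "apply_section (smul f h) s = smul f (apply_section h s)" for s by auto
  then show ?thesis
    using assms section_smul
    by (auto simp: bundle_map_def hom_space_def algebra_simps intro!: subspace_scale[OF fibre_subspace])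
qed

lemma End_scaleR: assumes "h \<in> sections EndE" shows "a *\<^sub>R h \<in> sections EndE"
proof -
  have "a *\<^sub>R h = smul (const_fn a) h"
    using End_off_points[OF assms] by (auto simp: fun_eq_iff const_fn_def)
  then show ?thesis using End_smul[OF const_fn_smooth assms] by metis
qed

lemma End_diff: "h \<in> sections EndE \<Longrightarrow> h' \<in> sections EndE \<Longrightarrow> h - h' \<in> sections EndE"
  using End_add[of h "(-1) *\<^sub>R h'"] End_scaleR[of h' "-1"] by (simp del: End_bundle_simps)

text \<open>Tensoriality in \<open>X\<close> may be checked after evaluation on sections.\<close>

lemma End_tensorialI:
  assumes E: "\<And>X. X \<in> Vect \<Longrightarrow> \<Psi> X \<in> sections EndE"
    and F: "\<And>X s. X \<in> Vect \<Longrightarrow> s \<in> sections E \<Longrightarrow> apply_section (\<Psi> X) s = F X s"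
    and t: "\<And>s. s \<in> sections E \<Longrightarrow> T.tensorial (\<lambda>X. F X s)"
  shows "T.tensorial \<Psi>"
proof (rule T.tensorialI; unfold TM_simps)
  fix X Y assume XY: "X \<in> Vect" "Y \<in> Vect"
  show "\<Psi> (X + Y) = \<Psi> X + \<Psi> Y"
  proof (rule End_ext[OF E[OF vf_add[OF XY]] End_add[OF E[OF XY(1)] E[OF XY(2)]]])
    fix s assume s: "s \<in> sections E"
    show "apply_section (\<Psi> (X + Y)) s = apply_section (\<Psi> X + \<Psi> Y) s"
      using t[OF s] XY by (simp add: apply_add F s vf_add T.tensorial_def)
  qed
next
  fix f X assume f: "f \<in> Cinf" and X: "X \<in> Vect"
  show "\<Psi> (smul f X) = smul f (\<Psi> X)"
  proof (rule End_ext[OF E[OF vf_smul[OF f X]] End_smul[OF f E[OF X]]])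
    fix s assume s: "s \<in> sections E"
    show "apply_section (\<Psi> (smul f X)) s = apply_section (smul f (\<Psi> X)) s"
      using t[OF s] X f by (simp add: apply_smul F s vf_smul T.tensorial_def)
  qed
qed

definition end_op :: "(('m \<Rightarrow> 'e) \<Rightarrow> 'm \<Rightarrow> 'e) \<Rightarrow> bool" where
  "end_op \<Phi> \<longleftrightarrow> tensorial \<Phi> \<and> (\<forall>s\<in>sections E. \<Phi> s \<in> sections E)"

text \<open>The endomorphism that a tensorial operator on sections defines pointwise.\<close>

definition end_of :: "(('m \<Rightarrow> 'e) \<Rightarrow> 'm \<Rightarrow> 'e) \<Rightarrow> 'm \<Rightarrow> 'e \<Rightarrow> 'e" where
  "end_of \<Phi> = (\<lambda>x e. if x \<in> points M \<and> e \<in> fibre E x then \<Phi> (section_through E x e) x else 0)"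

lemma end_opI:
  "(\<And>s. s \<in> sections E \<Longrightarrow> \<Phi> s \<in> sections E) \<Longrightarrow>
   (\<And>s t. s \<in> sections E \<Longrightarrow> t \<in> sections E \<Longrightarrow> \<Phi> (s + t) = \<Phi> s + \<Phi> t) \<Longrightarrow>
   (\<And>f s. f \<in> Cinf \<Longrightarrow> s \<in> sections E \<Longrightarrow> \<Phi> (smul f s) = smul f (\<Phi> s)) \<Longrightarrow> end_op \<Phi>"
  by (simp add: end_op_def tensorialI)

lemma end_of_at:
  assumes "tensorial \<Phi>" "s \<in> sections E" "x \<in> points M"
  shows "end_of \<Phi> x (s x) = \<Phi> s x"
  using tensorial_at[OF assms(1) section_through(1)[OF assms(3) section_in[OF assms(2,3)]] assms(2,3)]
    section_through(2)[OF assms(3) section_in[OF assms(2,3)]] section_in[OF assms(2,3)] assms(3)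
  by (simp add: end_of_def)

lemma end_of_apply:
  assumes "end_op \<Phi>" "s \<in> sections E"
  shows "apply_section (end_of \<Phi>) s = \<Phi> s"
proof
  fix x show "apply_section (end_of \<Phi>) s x = \<Phi> s x"
    using assms end_of_at[of \<Phi> s x] section_off[of "\<Phi> s" x]
    by (cases "x \<in> points M") (auto simp: end_op_def end_of_def)
qed

lemma end_of_in:
  assumes "end_op \<Phi>" shows "end_of \<Phi> \<in> sections EndE"
proof -
  have T: "tensorial \<Phi>" and cl: "\<And>s. s \<in> sections E \<Longrightarrow> \<Phi> s \<in> sections E"
    using assms by (auto simp: end_op_def)
  have "end_of \<Phi> x \<in> hom_space (fibre E x) (fibre E x)" if x: "x \<in> points M" for x
    unfolding hom_space_def
  proof (intro CollectI conjI ballI allI impI)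
    fix u assume u: "u \<in> fibre E x"
    show "end_of \<Phi> x u \<in> fibre E x"
      using section_in[OF cl x] section_through(1)[OF x u] u x by (simp add: end_of_def)
  next
    fix u v a b assume uv: "u \<in> fibre E x" "v \<in> fibre E x"
    obtain s t where st: "s \<in> sections E" "s x = u" "t \<in> sections E" "t x = v"
      using extend[OF x] uv by metis
    have "a *\<^sub>R s + b *\<^sub>R t \<in> sections E" using st by (intro section_add section_scaleR)
    from end_of_at[OF T this x] show "end_of \<Phi> x (a *\<^sub>R u + b *\<^sub>R v) = a *\<^sub>R end_of \<Phi> x u + b *\<^sub>R end_of \<Phi> x v"
      using tensorial_linear[OF T st(1,3) x] end_of_at[OF T st(1) x] end_of_at[OF T st(3) x] st(2,4) by simp
  qed (simp add: end_of_def)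
  then show ?thesis
    using end_of_apply[OF assms] cl by (auto simp: bundle_map_def fun_eq_iff[of "end_of \<Phi> _"] end_of_def[of \<Phi>])
qed

abbreviation "forms1 \<equiv> forms M 1 EndE"

text \<open>The one-form that a tensorial operator on vector fields defines pointwise.  The covariant derivative,
the Lie derivative, \<open>df \<and> \<eta>\<close> and the contraction of the curvature all have this shape.\<close>

definition form_of :: "(('m \<Rightarrow> 'm tvec) \<Rightarrow> 'm \<Rightarrow> 'w::real_vector) \<Rightarrow> ('m, 'w) vform" where
  "form_of \<Psi> = (\<lambda>x vs. if tangent_list M x vs \<and> length vs = 1
     then \<Psi> (section_through TM x (vs ! 0)) x else 0)"

lemma eval_form_single: "eval_form \<gamma> [X] x = \<gamma> x [X x]"
  by (simp add: eval_form_def)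

lemma tangent_list_single [simp]: "tangent_list M x [v] \<longleftrightarrow> x \<in> points M \<and> v \<in> tangent_space M x"
  by (simp add: tangent_list_def)

lemma form_of_at:
  assumes "T.tensorial \<Psi>" "X \<in> Vect" "x \<in> points M"
  shows "form_of \<Psi> x [X x] = \<Psi> X x"
  using T.tensorial_at[OF assms(1) _ _ assms(3), of "section_through TM x (X x)" X]
    T.section_through[OF assms(3), of "X x"] vf_tangent[OF assms(2,3)] assms(2,3)
  by (simp add: form_of_def)

abbreviation "act \<gamma> X s \<equiv> apply_section (eval_form \<gamma> [X]) s"

lemma form_of_eval:
  assumes "T.tensorial \<Psi>" "\<And>X. X \<in> Vect \<Longrightarrow> \<Psi> X \<in> sections EndE" "X \<in> Vect"
  shows "eval_form (form_of \<Psi>) [X] = \<Psi> X"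
proof
  fix x show "eval_form (form_of \<Psi>) [X] x = \<Psi> X x"
    using form_of_at[OF assms(1,3)] End_off_points[OF assms(2)[OF assms(3)]]
    by (cases "x \<in> points M") (auto simp: eval_form_single form_of_def tangent_list_def)
qed

lemma length_Suc_0: "length vs = Suc 0 \<longleftrightarrow> (\<exists>v. vs = [v])"
  by (cases vs) auto

lemma form1I:
  assumes "\<And>x vs. \<not> (tangent_list M x vs \<and> length vs = 1) \<Longrightarrow> \<gamma> x vs = 0"
    and "\<And>x v. x \<in> points M \<Longrightarrow> v \<in> tangent_space M x \<Longrightarrow> \<gamma> x [v] \<in> hom_space (fibre E x) (fibre E x)"
    and "\<And>x v w a b. x \<in> points M \<Longrightarrow> v \<in> tangent_space M x \<Longrightarrow> w \<in> tangent_space M x \<Longrightarrow>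
       \<gamma> x [a *\<^sub>R v + b *\<^sub>R w] = a *\<^sub>R \<gamma> x [v] + b *\<^sub>R \<gamma> x [w]"
    and "\<And>X. X \<in> Vect \<Longrightarrow> eval_form \<gamma> [X] \<in> sections EndE"
  shows "\<gamma> \<in> forms1"
proof -
  have "\<gamma> x = 0" if "x \<notin> points M" for x
    using assms(1)[of x] that by (auto simp: fun_eq_iff tangent_list_def)
  moreover have "\<gamma> x \<in> alternating_forms M x 1 (fibre EndE x)" if "x \<in> points M" for x
    using assms(1)[of x] assms(2)[OF that] assms(3)[OF that] that
    by (auto simp: alternating_forms_def length_Suc_0)
  moreover have "eval_form \<gamma> Xs \<in> sections EndE" if "length Xs = 1" "set Xs \<subseteq> Vect" for Xs
    using that assms(4) by (auto simp: length_Suc_0 simp del: End_bundle_simps)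
  ultimately show ?thesis by (simp add: form_bundle_def del: End_bundle_simps)
qed

lemma form1_off_tangent:
  assumes "\<gamma> \<in> forms1" "\<not> (tangent_list M x vs \<and> length vs = 1)"
  shows "\<gamma> x vs = 0"
proof (cases "x \<in> points M")
  case True
  then have "\<gamma> x \<in> alternating_forms M x 1 (fibre EndE x)"
    using assms(1) by (simp add: form_bundle_def del: End_bundle_simps)
  then show ?thesis using assms(2) unfolding alternating_forms_def by blast
next
  case False
  then show ?thesis using assms(1) by (simp add: form_bundle_def)
qed

lemma form1_off:
  assumes "\<gamma> \<in> forms1" "\<not> (x \<in> points M \<and> v \<in> tangent_space M x \<and> vs = [])"
  shows "\<gamma> x (v # vs) = 0"
  by (rule form1_off_tangent[OF assms(1)]) (use assms(2) in \<open>auto simp: tangent_list_def\<close>)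

lemma form1_Nil:
  assumes "\<gamma> \<in> forms1" shows "\<gamma> x [] = 0"
  using assms by (cases "x \<in> points M") (auto simp: form_bundle_def alternating_forms_def)

lemma form1_End: "\<gamma> \<in> forms1 \<Longrightarrow> X \<in> Vect \<Longrightarrow> eval_form \<gamma> [X] \<in> sections EndE"
  by (simp add: form_bundle_def del: End_bundle_simps)

lemma form1_hom: "\<gamma> \<in> forms1 \<Longrightarrow> x \<in> points M \<Longrightarrow> v \<in> tangent_space M x \<Longrightarrow>
    \<gamma> x [v] \<in> hom_space (fibre E x) (fibre E x)"
  by (simp add: form_bundle_def alternating_forms_def)

lemma form1_linear:
  assumes "\<gamma> \<in> forms1" "x \<in> points M" "v \<in> tangent_space M x" "w \<in> tangent_space M x"
  shows "\<gamma> x [a *\<^sub>R v + b *\<^sub>R w] = a *\<^sub>R \<gamma> x [v] + b *\<^sub>R \<gamma> x [w]"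
proof -
  have "\<gamma> x \<in> alternating_forms M x 1 (fibre EndE x)" using assms(1,2) by (simp add: form_bundle_def del: End_bundle_simps)
  then have "\<gamma> x ([v][0 := a *\<^sub>R v + b *\<^sub>R w]) = a *\<^sub>R \<gamma> x ([v][0 := v]) + b *\<^sub>R \<gamma> x ([v][0 := w])"
    using assms(2-4) unfolding alternating_forms_def mem_Collect_eq
    by (elim conjE allE[of _ "[v]"]) (auto simp del: list_update.simps)
  then show ?thesis by simp
qed

lemma form1_tensorial:
  assumes "\<gamma> \<in> forms1" shows "T.tensorial (\<lambda>X. eval_form \<gamma> [X])"
proof (rule T.tensorialI)
  fix X Y assume XY: "X \<in> sections TM" "Y \<in> sections TM"
  show "eval_form \<gamma> [X + Y] = eval_form \<gamma> [X] + eval_form \<gamma> [Y]"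
  proof
    fix x show "eval_form \<gamma> [X + Y] x = (eval_form \<gamma> [X] + eval_form \<gamma> [Y]) x"
      using form1_linear[OF assms, of x "X x" "Y x" 1 1] XY vf_tangent form1_off[OF assms, of x]
      by (cases "x \<in> points M") (auto simp: eval_form_single)
  qed
next
  fix f X assume f: "f \<in> Cinf" and X: "X \<in> sections TM"
  show "eval_form \<gamma> [smul f X] = smul f (eval_form \<gamma> [X])"
  proof
    fix x show "eval_form \<gamma> [smul f X] x = smul f (eval_form \<gamma> [X]) x"
      using form1_linear[OF assms, of x "X x" "X x" "f x" 0] X vf_tangent form1_off[OF assms, of x]
      by (cases "x \<in> points M") (auto simp: eval_form_single)
  qed
qed

text \<open>Every tangent vector is a value of a vector field and every element of a fibre is a value of a section.
Through this lemma, identities between one-forms become identities between operators on sections.\<close>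

lemma form1_ext:
  assumes "\<gamma> \<in> forms1" "\<gamma>' \<in> forms1"
    "\<And>X s. X \<in> Vect \<Longrightarrow> s \<in> sections E \<Longrightarrow>
       act \<gamma> X s = act \<gamma>' X s"
  shows "\<gamma> = \<gamma>'"
proof (intro ext)
  have *: "eval_form \<gamma> [X] = eval_form \<gamma>' [X]" if "X \<in> Vect" for X
    by (rule End_ext) (use form1_End[OF assms(1) that] form1_End[OF assms(2) that] assms(3)[OF that] in auto)
  fix x vs e
  have "\<gamma> x vs = \<gamma>' x vs"
  proof (cases vs)
    case (Cons v ws)
    show ?thesis
    proof (cases "x \<in> points M \<and> v \<in> tangent_space M x \<and> ws = []")
      case True
      then obtain X where X: "X \<in> Vect" "X x = v" using T.extend[of x v] by auto
      from fun_cong[OF *[OF X(1)], of x] show ?thesis using True Cons X(2) by (simp add: eval_form_single)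
    next
      case False
      then show ?thesis using form1_off[OF assms(1) False] form1_off[OF assms(2) False] Cons by simp
    qed
  qed (simp add: form1_Nil[OF assms(1)] form1_Nil[OF assms(2)])
  then show "\<gamma> x vs e = \<gamma>' x vs e" by simp
qed

lemma form_of_in:
  assumes T: "T.tensorial \<Psi>" and E: "\<And>X. X \<in> Vect \<Longrightarrow> \<Psi> X \<in> sections EndE"
  shows "form_of \<Psi> \<in> forms1"
proof (rule form1I)
  show "form_of \<Psi> x vs = 0" if "\<not> (tangent_list M x vs \<and> length vs = 1)" for x vs
    using that by (auto simp: form_of_def)
  show "eval_form (form_of \<Psi>) [X] \<in> sections EndE" if "X \<in> Vect" for X
    using form_of_eval[OF T E that] E[OF that] by metis
  fix x v assume x: "x \<in> points M" and v: "v \<in> tangent_space M x"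
  obtain X where X: "X \<in> Vect" "X x = v" using T.extend[OF x] v by auto
  show "form_of \<Psi> x [v] \<in> hom_space (fibre E x) (fibre E x)"
    using form_of_at[OF T X(1) x] End_hom[OF E[OF X(1)] x] X(2) by simp
  fix w a b assume w: "w \<in> tangent_space M x"
  obtain Y where Y: "Y \<in> Vect" "Y x = w" using T.extend[OF x] w by auto
  have "a *\<^sub>R X + b *\<^sub>R Y \<in> Vect"
    using T.section_add[OF T.section_scaleR T.section_scaleR] X Y by simp
  from form_of_at[OF T this x] T.tensorial_linear[OF T _ _ x, of X Y a b]
  show "form_of \<Psi> x [a *\<^sub>R v + b *\<^sub>R w] = a *\<^sub>R form_of \<Psi> x [v] + b *\<^sub>R form_of \<Psi> x [w]"
    using form_of_at[OF T X(1) x] form_of_at[OF T Y(1) x] X Y by simp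
qed

lemma eval_add: "eval_form (\<gamma> + \<gamma>') Xs = eval_form \<gamma> Xs + eval_form \<gamma>' Xs"
  and eval_diff: "eval_form (\<gamma> - \<gamma>') Xs = eval_form \<gamma> Xs - eval_form \<gamma>' Xs"
  and eval_scaleR: "eval_form (a *\<^sub>R \<gamma>) Xs = a *\<^sub>R eval_form \<gamma> Xs"
  and eval_smul: "eval_form (smul f \<gamma>) Xs = smul f (eval_form \<gamma> Xs)"
  and eval_zero: "eval_form 0 Xs = 0"
  for \<gamma> \<gamma>' :: "('m, 'w::real_vector) vform"
  by (auto simp: eval_form_def fun_eq_iff)

lemma form1_add:
  assumes "\<gamma> \<in> forms1" "\<gamma>' \<in> forms1" shows "\<gamma> + \<gamma>' \<in> forms1"
proof (rule form1I)
  show "(\<gamma> + \<gamma>') x vs = 0" if "\<not> (tangent_list M x vs \<and> length vs = 1)" for x vs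
    using form1_off_tangent[OF assms(1) that] form1_off_tangent[OF assms(2) that] by simp
  show "eval_form (\<gamma> + \<gamma>') [X] \<in> sections EndE" if "X \<in> Vect" for X
    unfolding eval_add by (intro End_add form1_End assms that)
  show "(\<gamma> + \<gamma>') x [v] \<in> hom_space (fibre E x) (fibre E x)" if "x \<in> points M" "v \<in> tangent_space M x" for x v
    using form1_hom[OF assms(1) that] form1_hom[OF assms(2) that] subspace_add[OF fibre_subspace[OF that(1)]]
    by (auto simp: hom_space_def algebra_simps)
qed (simp add: form1_linear[OF assms(1)] form1_linear[OF assms(2)] algebra_simps)

lemma form1_smul:
  assumes "\<gamma> \<in> forms1" "f \<in> Cinf" shows "smul f \<gamma> \<in> forms1"
proof (rule form1I)
  show "smul f \<gamma> x vs = 0" if "\<not> (tangent_list M x vs \<and> length vs = 1)" for x vs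
    using form1_off_tangent[OF assms(1) that] by simp
  show "eval_form (smul f \<gamma>) [X] \<in> sections EndE" if "X \<in> Vect" for X
    unfolding eval_smul by (intro End_smul form1_End assms that)
  show "smul f \<gamma> x [v] \<in> hom_space (fibre E x) (fibre E x)" if "x \<in> points M" "v \<in> tangent_space M x" for x v
    using form1_hom[OF assms(1) that] subspace_scale[OF fibre_subspace[OF that(1)]]
    by (auto simp: hom_space_def algebra_simps)
qed (simp add: form1_linear[OF assms(1)] algebra_simps)

lemma form1_const_smul: "\<gamma> \<in> forms1 \<Longrightarrow> smul (const_fn a) \<gamma> = a *\<^sub>R \<gamma>"
  by (auto simp: fun_eq_iff const_fn_def form_bundle_def)

lemma form1_scaleR: "\<gamma> \<in> forms1 \<Longrightarrow> a *\<^sub>R \<gamma> \<in> forms1"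
  using form1_smul[OF _ const_fn_smooth, of \<gamma> a] by (simp only: form1_const_smul)

lemma form1_diff: "\<gamma> \<in> forms1 \<Longrightarrow> \<gamma>' \<in> forms1 \<Longrightarrow> \<gamma> - \<gamma>' \<in> forms1"
  using form1_add[of \<gamma> "(-1) *\<^sub>R \<gamma>'"] form1_scaleR[of \<gamma>' "-1"] by simp

lemma form1_zero: "0 \<in> forms1"
  using form1I[of 0] End_zero by (auto simp: eval_zero hom_space_def fibre_subspace subspace_0)

section \<open>Connections on endomorphisms\<close>

context
  fixes B :: "('m, 'a::real_vector) algebroid" and D
  assumes conn: "A_connection M B E D"
begin

lemma conn_off: "\<alpha> \<notin> sections B \<or> s \<notin> sections E \<Longrightarrow> D \<alpha> s = 0"
  using conn unfolding A_connection_def by blast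

lemma conn_in: "\<alpha> \<in> sections B \<Longrightarrow> s \<in> sections E \<Longrightarrow> D \<alpha> s \<in> sections E"
  using conn unfolding A_connection_def by blast

lemma conn_add_left: "\<alpha> \<in> sections B \<Longrightarrow> \<beta> \<in> sections B \<Longrightarrow> s \<in> sections E \<Longrightarrow> D (\<alpha> + \<beta>) s = D \<alpha> s + D \<beta> s"
  using conn unfolding A_connection_def by blast

lemma conn_smul_left: "\<alpha> \<in> sections B \<Longrightarrow> f \<in> Cinf \<Longrightarrow> s \<in> sections E \<Longrightarrow> D (smul f \<alpha>) s = smul f (D \<alpha> s)"
  using conn unfolding A_connection_def by blast

lemma conn_linear: "\<alpha> \<in> sections B \<Longrightarrow> s \<in> sections E \<Longrightarrow> t \<in> sections E \<Longrightarrow>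
    D \<alpha> (a *\<^sub>R s + b *\<^sub>R t) = a *\<^sub>R D \<alpha> s + b *\<^sub>R D \<alpha> t"
  using conn unfolding A_connection_def by blast

lemma conn_add: "\<alpha> \<in> sections B \<Longrightarrow> s \<in> sections E \<Longrightarrow> t \<in> sections E \<Longrightarrow> D \<alpha> (s + t) = D \<alpha> s + D \<alpha> t"
  using conn_linear[of \<alpha> s t 1 1] by simp

lemma conn_diff: "\<alpha> \<in> sections B \<Longrightarrow> s \<in> sections E \<Longrightarrow> t \<in> sections E \<Longrightarrow> D \<alpha> (s - t) = D \<alpha> s - D \<alpha> t"
  using conn_linear[of \<alpha> s t 1 "-1"] by simp

lemma conn_scaleR: "\<alpha> \<in> sections B \<Longrightarrow> s \<in> sections E \<Longrightarrow> D \<alpha> (a *\<^sub>R s) = a *\<^sub>R D \<alpha> s"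
  using conn_linear[of \<alpha> s s a 0] by simp

lemma conn_zero: "D \<alpha> 0 = 0"
  using conn_scaleR[OF _ section_zero, of \<alpha> 0] conn_off[of \<alpha> 0] by (cases "\<alpha> \<in> sections B") auto

lemma conn_smul: "\<alpha> \<in> sections B \<Longrightarrow> s \<in> sections E \<Longrightarrow> f \<in> Cinf \<Longrightarrow>
    D \<alpha> (smul f s) = smul f (D \<alpha> s) + smul (derive_by (anchor_field B \<alpha>) f) s"
  using conn unfolding A_connection_def by blast

lemma End_connection_op:
  assumes "\<alpha> \<in> sections B" "h \<in> sections EndE"
  shows "end_op (\<lambda>s. D \<alpha> (apply_section h s) - apply_section h (D \<alpha> s))"
proof (rule end_opI)
  note r = assms conn_in End_apply section_diff section_add section_smul
  show "D \<alpha> (apply_section h s) - apply_section h (D \<alpha> s) \<in> sections E" if "s \<in> sections E" for s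
    using that by (intro r)
  show "D \<alpha> (apply_section h (s + t)) - apply_section h (D \<alpha> (s + t)) =
     D \<alpha> (apply_section h s) - apply_section h (D \<alpha> s) + (D \<alpha> (apply_section h t) - apply_section h (D \<alpha> t))"
    if st: "s \<in> sections E" "t \<in> sections E" for s t
  proof -
    have 1: "D \<alpha> s \<in> sections E" "D \<alpha> t \<in> sections E" using st by (auto intro: conn_in assms(1))
    have 2: "apply_section h s \<in> sections E" "apply_section h t \<in> sections E"
      using st by (auto intro: End_apply assms(2) simp del: End_bundle_simps)
    show ?thesis
      unfolding End_apply_add[OF assms(2) st] conn_add[OF assms(1) st] conn_add[OF assms(1) 2] End_apply_add[OF assms(2) 1]
      by simp
  qed
  show "D \<alpha> (apply_section h (smul f s)) - apply_section h (D \<alpha> (smul f s)) =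
     smul f (D \<alpha> (apply_section h s) - apply_section h (D \<alpha> s))"
    if f: "f \<in> Cinf" and s: "s \<in> sections E" for f s
  proof -
    have 1: "D \<alpha> s \<in> sections E" using s by (auto intro: conn_in assms(1))
    have 2: "apply_section h s \<in> sections E" by (rule End_apply[OF assms(2) s])
    have l: "D \<alpha> (smul f s) = smul f (D \<alpha> s) + smul (derive_by (anchor_field B \<alpha>) f) s"
      "D \<alpha> (smul f (apply_section h s)) = smul f (D \<alpha> (apply_section h s)) + smul (derive_by (anchor_field B \<alpha>) f) (apply_section h s)"
      using conn_smul[OF assms(1) s f] conn_smul[OF assms(1) 2 f] .
    have "smul (derive_by (anchor_field B \<alpha>) f) s \<in> sections E"
      using l(1) conn_in[OF assms(1) section_smul[OF f s]] section_smul[OF f 1]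
      by (metis add_diff_cancel_left' section_diff)
    then show ?thesis
      unfolding End_apply_smul[OF assms(2) s] l
      by (subst End_apply_add[OF assms(2) section_smul[OF f 1]])
         (simp_all add: End_apply_smul[OF assms(2)] 1 s fun_eq_iff algebra_simps)
  qed
qed

lemma End_connection_eq:
  assumes "\<alpha> \<in> sections B" "h \<in> sections EndE"
  shows "End_connection M B E D \<alpha> h = end_of (\<lambda>s. D \<alpha> (apply_section h s) - apply_section h (D \<alpha> s))"
  using assms unfolding End_connection_def end_of_def Let_def by simp

lemma End_connection_in:
  "\<alpha> \<in> sections B \<Longrightarrow> h \<in> sections EndE \<Longrightarrow> End_connection M B E D \<alpha> h \<in> sections EndE"
  by (simp only: End_connection_eq end_of_in[OF End_connection_op])

lemma End_connection_apply:
  "\<alpha> \<in> sections B \<Longrightarrow> h \<in> sections EndE \<Longrightarrow> s \<in> sections E \<Longrightarrow>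
   apply_section (End_connection M B E D \<alpha> h) s = D \<alpha> (apply_section h s) - apply_section h (D \<alpha> s)"
  by (simp only: End_connection_eq end_of_apply[OF End_connection_op])

lemma End_connection_zero:
  assumes "\<alpha> \<in> sections B" shows "End_connection M B E D \<alpha> 0 = 0"
  by (rule End_ext[OF End_connection_in[OF assms End_zero] End_zero])
     (simp add: End_connection_apply[OF assms End_zero] apply_zero conn_zero del: End_bundle_simps)

end

end

section \<open>Lie algebroids and their representations\<close>

locale algebroid_rep = smooth_mfd M
  for M :: "('m, 'b::euclidean_space) manifold" +
  fixes A :: "('m, 'a::real_vector) algebroid"
    and V :: "('m, 'v::real_vector) vbundle"
    and D :: "('m, 'a, 'v) covariant"
  assumes lie: "lie_algebroid M A" and vb: "vector_bundle M V" and rep: "representation M A V D"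
begin

sublocale A: section_module M A
  using lie by (intro section_module_of_bundle) (simp add: lie_algebroid_def)

sublocale V: section_module M V
  by (rule section_module_of_bundle[OF vb])

lemma A_rank: "(\<forall>x\<in>points M. fibre A x = {0}) \<or> (\<forall>x\<in>points M. \<exists>v\<in>fibre A x. v \<noteq> 0)"
proof -
  obtain k \<F> where "framed_bundle M A k \<F>"
    using vector_bundle_framed lie unfolding lie_algebroid_def by blast
  then interpret framed_bundle M A k \<F> .
  show ?thesis by (rule constant_rank)
qed

lemma nabla_exists: "\<exists>nabla. linear_connection M V nabla"
proof -
  obtain k \<F> where "framed_bundle M V k \<F>" using vector_bundle_framed[OF vb] by blast
  then interpret framed_bundle M V k \<F> .
  show ?thesis by (rule connection_exists)
qed

abbreviation "\<rho> \<equiv> anchor_field A"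

lemma anchor_map: "bundle_map M A TM (anchor A)"
  using lie unfolding lie_algebroid_def by blast

lemma rho_vf: "\<alpha> \<in> sections A \<Longrightarrow> \<rho> \<alpha> \<in> Vect"
  using anchor_map by (simp add: bundle_map_def anchor_field_def)

lemma rho_at: "\<rho> \<alpha> x = anchor A x (\<alpha> x)"
  by (simp add: anchor_field_def apply_section_def)

lemma anchor_off: "x \<notin> points M \<Longrightarrow> anchor A x = 0"
  using anchor_map by (simp add: bundle_map_def)

lemma anchor_in: "x \<in> points M \<Longrightarrow> u \<in> fibre A x \<Longrightarrow> anchor A x u \<in> tangent_space M x"
  using anchor_map by (simp add: bundle_map_def hom_space_def)

lemma anchor_linear: "x \<in> points M \<Longrightarrow> u \<in> fibre A x \<Longrightarrow> v \<in> fibre A x \<Longrightarrow>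
    anchor A x (a *\<^sub>R u + b *\<^sub>R v) = a *\<^sub>R anchor A x u + b *\<^sub>R anchor A x v"
  using anchor_map by (simp add: bundle_map_def hom_space_def)

lemma rho_linear:
  assumes "\<alpha> \<in> sections A" "\<beta> \<in> sections A"
  shows "\<rho> (a *\<^sub>R \<alpha> + b *\<^sub>R \<beta>) = a *\<^sub>R \<rho> \<alpha> + b *\<^sub>R \<rho> \<beta>"
proof
  fix x show "\<rho> (a *\<^sub>R \<alpha> + b *\<^sub>R \<beta>) x = (a *\<^sub>R \<rho> \<alpha> + b *\<^sub>R \<rho> \<beta>) x"
    using anchor_linear[of x "\<alpha> x" "\<beta> x" a b] A.section_in[OF assms(1)] A.section_in[OF assms(2)] anchor_off[of x]
    by (cases "x \<in> points M") (auto simp: rho_at)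
qed

lemma rho_add: "\<alpha> \<in> sections A \<Longrightarrow> \<beta> \<in> sections A \<Longrightarrow> \<rho> (\<alpha> + \<beta>) = \<rho> \<alpha> + \<rho> \<beta>"
  using rho_linear[of \<alpha> \<beta> 1 1] by simp

lemma rho_smul:
  assumes "\<alpha> \<in> sections A" shows "\<rho> (smul f \<alpha>) = smul f (\<rho> \<alpha>)"
proof
  fix x show "\<rho> (smul f \<alpha>) x = smul f (\<rho> \<alpha>) x"
    using anchor_linear[of x "\<alpha> x" "\<alpha> x" "f x" 0] A.section_in[OF assms(1)] anchor_off[of x]
    by (cases "x \<in> points M") (auto simp: rho_at)
qed

lemma br_in: "\<alpha> \<in> sections A \<Longrightarrow> \<beta> \<in> sections A \<Longrightarrow> bracket A \<alpha> \<beta> \<in> sections A"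
  using lie unfolding lie_algebroid_def by blast

lemma br_anti: "\<alpha> \<in> sections A \<Longrightarrow> \<beta> \<in> sections A \<Longrightarrow> bracket A \<alpha> \<beta> = - bracket A \<beta> \<alpha>"
  using lie unfolding lie_algebroid_def by blast

lemma br_linear_left: "\<alpha> \<in> sections A \<Longrightarrow> \<beta> \<in> sections A \<Longrightarrow> \<gamma> \<in> sections A \<Longrightarrow>
   bracket A (a *\<^sub>R \<alpha> + b *\<^sub>R \<beta>) \<gamma> = a *\<^sub>R bracket A \<alpha> \<gamma> + b *\<^sub>R bracket A \<beta> \<gamma>"
  using lie unfolding lie_algebroid_def by blast

lemma br_jacobi: "\<alpha> \<in> sections A \<Longrightarrow> \<beta> \<in> sections A \<Longrightarrow> \<gamma> \<in> sections A \<Longrightarrow>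
   bracket A \<alpha> (bracket A \<beta> \<gamma>) + bracket A \<beta> (bracket A \<gamma> \<alpha>) + bracket A \<gamma> (bracket A \<alpha> \<beta>) = 0"
  using lie unfolding lie_algebroid_def by blast

lemma br_smul: "\<alpha> \<in> sections A \<Longrightarrow> \<beta> \<in> sections A \<Longrightarrow> f \<in> Cinf \<Longrightarrow>
   bracket A \<alpha> (smul f \<beta>) = smul f (bracket A \<alpha> \<beta>) + smul (derive_by (\<rho> \<alpha>) f) \<beta>"
  using lie unfolding lie_algebroid_def by blast

lemma br_add_right:
  assumes "\<alpha> \<in> sections A" "\<beta> \<in> sections A" "\<gamma> \<in> sections A"
  shows "bracket A \<alpha> (\<beta> + \<gamma>) = bracket A \<alpha> \<beta> + bracket A \<alpha> \<gamma>"
  using br_linear_left[OF assms(2,3,1), of 1 1] br_anti[OF assms(1) A.section_add[OF assms(2,3)]]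
    br_anti[OF assms(1,2)] br_anti[OF assms(1,3)] by simp

lemma br_jacobi':
  assumes "\<alpha> \<in> sections A" "\<beta> \<in> sections A" "\<gamma> \<in> sections A"
  shows "bracket A (bracket A \<alpha> \<beta>) \<gamma> = bracket A \<alpha> (bracket A \<beta> \<gamma>) - bracket A \<beta> (bracket A \<alpha> \<gamma>)"
proof -
  have "bracket A \<beta> (bracket A \<gamma> \<alpha>) = - bracket A (bracket A \<gamma> \<alpha>) \<beta>"
    by (rule br_anti) (use assms in \<open>auto intro: br_in\<close>)
  also have "bracket A (bracket A \<gamma> \<alpha>) \<beta> = bracket A ((-1) *\<^sub>R bracket A \<alpha> \<gamma> + 0 *\<^sub>R bracket A \<alpha> \<gamma>) \<beta>"
    using br_anti[OF assms(3,1)] by simp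
  also have "\<dots> = - bracket A (bracket A \<alpha> \<gamma>) \<beta>"
    by (subst br_linear_left) (use assms in \<open>auto intro: br_in\<close>)
  also have "\<dots> = bracket A \<beta> (bracket A \<alpha> \<gamma>)"
    using br_anti[OF assms(2) br_in[OF assms(1,3)]] by simp
  finally have 1: "bracket A \<beta> (bracket A \<gamma> \<alpha>) = - bracket A \<beta> (bracket A \<alpha> \<gamma>)" .
  have 2: "bracket A \<gamma> (bracket A \<alpha> \<beta>) = - bracket A (bracket A \<alpha> \<beta>) \<gamma>"
    by (rule br_anti) (use assms in \<open>auto intro: br_in\<close>)
  show ?thesis using br_jacobi[OF assms] unfolding 1 2 by (simp add: algebra_simps)
qed

text \<open>The Jacobi identity for \<open>\<alpha>\<close>, \<open>\<beta>\<close> and \<open>f \<gamma>\<close>, expanded by the Leibniz rule, leaves the difference of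
\<open>\<rho>[\<alpha>, \<beta>] f\<close> and \<open>[\<rho>\<alpha>, \<rho>\<beta>] f\<close>, multiplied by \<open>\<gamma>\<close>.  It vanishes at \<open>x\<close> if \<open>\<gamma> x \<noteq> 0\<close> for some \<open>\<gamma>\<close>.  Otherwise the rank
is zero, and \<open>\<alpha>\<close> and \<open>\<beta>\<close> are zero.\<close>

lemma rho_bracket:
  assumes a: "\<alpha> \<in> sections A" and b: "\<beta> \<in> sections A"
  shows "\<rho> (bracket A \<alpha> \<beta>) = bracket TM (\<rho> \<alpha>) (\<rho> \<beta>)"
proof (rule vf_eqI)
  show "\<rho> (bracket A \<alpha> \<beta>) \<in> Vect" "bracket TM (\<rho> \<alpha>) (\<rho> \<beta>) \<in> Vect"
    using a b by (auto intro: rho_vf br_in vf_bracket)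
  fix f x assume f: "f \<in> Cinf" and x: "x \<in> points M"
  show "\<rho> (bracket A \<alpha> \<beta>) x f = bracket TM (\<rho> \<alpha>) (\<rho> \<beta>) x f"
  proof (cases "\<forall>x\<in>points M. fibre A x = {0}")
    case True
    have z: "\<gamma> = 0" if "\<gamma> \<in> sections A" for \<gamma>
      using True A.section_in[OF that] A.section_off[OF that] by (auto simp: fun_eq_iff)
    have r0: "\<rho> 0 = 0" using rho_linear[OF A.section_zero A.section_zero, of 0 0] by simp
    show ?thesis using z[OF a] z[OF b] z[OF br_in[OF a b]] by (simp add: r0 bracket_TM)
  next
    case False
    then obtain v where v: "v \<in> fibre A x" "v \<noteq> 0" using A_rank x by blast
    then obtain \<gamma> where c: "\<gamma> \<in> sections A" "\<gamma> x = v" using A.extend[OF x] by blast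
    have s: "derive_by (\<rho> \<alpha>) f \<in> Cinf" "derive_by (\<rho> \<beta>) f \<in> Cinf"
      using a b f by (auto intro: vf_smooth rho_vf)
    have m: "smul f \<gamma> \<in> sections A" "bracket A \<beta> \<gamma> \<in> sections A" "bracket A \<alpha> \<gamma> \<in> sections A" "bracket A \<alpha> \<beta> \<in> sections A"
      using a b c f by (auto intro: br_in A.section_smul)
    have e1: "bracket A \<alpha> (bracket A \<beta> (smul f \<gamma>)) = smul f (bracket A \<alpha> (bracket A \<beta> \<gamma>)) + smul (derive_by (\<rho> \<alpha>) f) (bracket A \<beta> \<gamma>)
       + (smul (derive_by (\<rho> \<beta>) f) (bracket A \<alpha> \<gamma>) + smul (derive_by (\<rho> \<alpha>) (derive_by (\<rho> \<beta>) f)) \<gamma>)"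
      using a b c(1) f s m by (simp add: br_smul br_add_right A.section_smul)
    have e2: "bracket A \<beta> (bracket A \<alpha> (smul f \<gamma>)) = smul f (bracket A \<beta> (bracket A \<alpha> \<gamma>)) + smul (derive_by (\<rho> \<beta>) f) (bracket A \<alpha> \<gamma>)
       + (smul (derive_by (\<rho> \<alpha>) f) (bracket A \<beta> \<gamma>) + smul (derive_by (\<rho> \<beta>) (derive_by (\<rho> \<alpha>) f)) \<gamma>)"
      using a b c(1) f s m by (simp add: br_smul br_add_right A.section_smul)
    have e3: "bracket A (bracket A \<alpha> \<beta>) (smul f \<gamma>) = smul f (bracket A (bracket A \<alpha> \<beta>) \<gamma>) + smul (derive_by (\<rho> (bracket A \<alpha> \<beta>)) f) \<gamma>"
      using br_smul[OF m(4) c(1) f] .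
    have "smul f (bracket A (bracket A \<alpha> \<beta>) \<gamma>) + smul (derive_by (\<rho> (bracket A \<alpha> \<beta>)) f) \<gamma> =
       smul f (bracket A (bracket A \<alpha> \<beta>) \<gamma>) + smul (derive_by (\<rho> \<alpha>) (derive_by (\<rho> \<beta>) f)) \<gamma> - smul (derive_by (\<rho> \<beta>) (derive_by (\<rho> \<alpha>) f)) \<gamma>"
      using br_jacobi'[OF a b m(1)] unfolding e1 e2 e3 br_jacobi'[OF a b c(1)]
      by (simp add: fun_eq_iff algebra_simps)
    from fun_cong[OF this, of x]
    have "derive_by (\<rho> (bracket A \<alpha> \<beta>)) f x *\<^sub>R v = (derive_by (\<rho> \<alpha>) (derive_by (\<rho> \<beta>) f) x - derive_by (\<rho> \<beta>) (derive_by (\<rho> \<alpha>) f) x) *\<^sub>R v"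
      using c(2) by (simp add: algebra_simps)
    then show ?thesis using v(2) by (simp add: derive_by_apply bracket_TM)
  qed
qed

lemma conn_D: "A_connection M A V D"
  using rep unfolding representation_def by blast

lemma flat: "\<alpha> \<in> sections A \<Longrightarrow> \<beta> \<in> sections A \<Longrightarrow> s \<in> sections V \<Longrightarrow>
    D (bracket A \<alpha> \<beta>) s = D \<alpha> (D \<beta> s) - D \<beta> (D \<alpha> s)"
  using rep unfolding representation_def curvature_def by fastforce

lemma D_off: "\<alpha> \<notin> sections A \<or> s \<notin> sections V \<Longrightarrow> D \<alpha> s = 0"
  by (rule V.conn_off[OF conn_D])

lemmas D_in = V.conn_in[OF conn_D]
  and D_add_left = V.conn_add_left[OF conn_D]
  and D_smul_left = V.conn_smul_left[OF conn_D]
  and D_add = V.conn_add[OF conn_D]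
  and D_diff = V.conn_diff[OF conn_D]
  and D_scaleR = V.conn_scaleR[OF conn_D]
  and D_smul = V.conn_smul[OF conn_D]

abbreviation "EndV \<equiv> End_bundle M V"
abbreviation "DE \<equiv> End_connection M A V D"
abbreviation "F1 \<equiv> forms M 1 EndV"
abbreviation "\<L> \<equiv> lie_derivative M A DE"

lemmas DE_in = V.End_connection_in[OF conn_D]
  and DE_apply = V.End_connection_apply[OF conn_D]
  and DE_zero = V.End_connection_zero[OF conn_D]

section \<open>Forms of degree zero and one along a representation\<close>

text \<open>If \<open>X\<close> is multiplied by \<open>f\<close>, the term \<open>(\<rho>\<alpha> f) \<gamma>(X)\<close> from the Leibniz rule of the connection and the one from
the bracket \<open>[\<rho>\<alpha>, f X]\<close> cancel.\<close>

lemma lie_derivative_tensorial: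
  assumes a: "\<alpha> \<in> sections A" and g: "\<gamma> \<in> F1"
  shows "T.tensorial (\<lambda>X. DE \<alpha> (eval_form \<gamma> [X]) - eval_form \<gamma> [bracket TM (\<rho> \<alpha>) X])"
    "\<And>X. X \<in> Vect \<Longrightarrow> DE \<alpha> (eval_form \<gamma> [X]) - eval_form \<gamma> [bracket TM (\<rho> \<alpha>) X] \<in> sections EndV"
proof -
  let ?\<Psi> = "\<lambda>X. DE \<alpha> (eval_form \<gamma> [X]) - eval_form \<gamma> [bracket TM (\<rho> \<alpha>) X]"
  have r: "\<rho> \<alpha> \<in> Vect" using rho_vf[OF a] .
  show in': "?\<Psi> X \<in> sections EndV" if "X \<in> Vect" for X
    by (intro V.End_diff DE_in V.form1_End[OF g] vf_bracket a r that)
  have gadd: "eval_form \<gamma> [X + Y] = eval_form \<gamma> [X] + eval_form \<gamma> [Y]"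
    if "X \<in> Vect" "Y \<in> Vect" for X Y
    using V.form1_tensorial[OF g] that unfolding T.tensorial_def by simp
  have gmul: "eval_form \<gamma> [smul f X] = smul f (eval_form \<gamma> [X])"
    if "X \<in> Vect" "f \<in> Cinf" for X f
    using V.form1_tensorial[OF g] that unfolding T.tensorial_def by simp
  show "T.tensorial ?\<Psi>"
  proof (rule V.End_tensorialI[where F = "\<lambda>X s. D \<alpha> (V.act \<gamma> X s)
      - V.act \<gamma> X (D \<alpha> s) - V.act \<gamma> (bracket TM (\<rho> \<alpha>) X) s"])
    show "?\<Psi> X \<in> sections EndV" if "X \<in> Vect" for X by (rule in'[OF that])
    show "apply_section (?\<Psi> X) s = D \<alpha> (V.act \<gamma> X s)
        - V.act \<gamma> X (D \<alpha> s) - V.act \<gamma> (bracket TM (\<rho> \<alpha>) X) s"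
      if "X \<in> Vect" "s \<in> sections V" for X s
      unfolding V.apply_diff DE_apply[OF a V.form1_End[OF g that(1)] that(2)] ..
    fix s assume s: "s \<in> sections V"
    have m: "V.act \<gamma> X s \<in> sections V" if "X \<in> Vect" for X
      by (rule V.End_apply[OF V.form1_End[OF g that] s])
    show "T.tensorial (\<lambda>X. D \<alpha> (V.act \<gamma> X s)
        - V.act \<gamma> X (D \<alpha> s) - V.act \<gamma> (bracket TM (\<rho> \<alpha>) X) s)"
    proof (rule T.tensorialI; unfold TM_simps)
      fix X Y assume XY: "X \<in> Vect" "Y \<in> Vect"
      show "D \<alpha> (V.act \<gamma> (X + Y) s) - V.act \<gamma> (X + Y) (D \<alpha> s)
          - V.act \<gamma> (bracket TM (\<rho> \<alpha>) (X + Y)) s =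
        D \<alpha> (V.act \<gamma> X s) - V.act \<gamma> X (D \<alpha> s)
          - V.act \<gamma> (bracket TM (\<rho> \<alpha>) X) s +
        (D \<alpha> (V.act \<gamma> Y s) - V.act \<gamma> Y (D \<alpha> s)
          - V.act \<gamma> (bracket TM (\<rho> \<alpha>) Y) s)"
        unfolding bracket_TM_add_right[OF r XY] gadd[OF XY] gadd[OF vf_bracket[OF r XY(1)] vf_bracket[OF r XY(2)]]
          V.apply_add D_add[OF a m[OF XY(1)] m[OF XY(2)]] by simp
    next
      fix f X assume f: "f \<in> Cinf" and X: "X \<in> Vect"
      note b = vf_bracket[OF r X]
      show "D \<alpha> (V.act \<gamma> (smul f X) s) - V.act \<gamma> (smul f X) (D \<alpha> s)
          - V.act \<gamma> (bracket TM (\<rho> \<alpha>) (smul f X)) s =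
        smul f (D \<alpha> (V.act \<gamma> X s) - V.act \<gamma> X (D \<alpha> s)
          - V.act \<gamma> (bracket TM (\<rho> \<alpha>) X) s)"
        unfolding bracket_TM_smul_right[OF r X f] gadd[OF vf_smul[OF f b] vf_smul[OF vf_smooth[OF r f] X]]
          gmul[OF X f] gmul[OF b f] gmul[OF X vf_smooth[OF r f]] V.apply_add V.apply_smul D_smul[OF a m[OF X] f]
        by (simp add: fun_eq_iff algebra_simps)
    qed
  qed
qed

lemma lie_derivative_one_form:
  assumes a: "\<alpha> \<in> sections A" and g: "\<gamma> \<in> F1"
  shows "\<L> \<alpha> \<gamma> = V.form_of (\<lambda>X. DE \<alpha> (eval_form \<gamma> [X]) - eval_form \<gamma> [bracket TM (\<rho> \<alpha>) X])"
proof (intro ext)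
  fix x vs e
  have "\<L> \<alpha> \<gamma> x vs = V.form_of (\<lambda>X. DE \<alpha> (eval_form \<gamma> [X]) - eval_form \<gamma> [bracket TM (\<rho> \<alpha>) X]) x vs"
  proof (cases "length vs = 1")
    case True
    then obtain v where "vs = [v]" by (auto simp: V.length_Suc_0)
    then show ?thesis by (simp add: lie_derivative_def V.form_of_def Let_def)
  next
    case False
    have z: "eval_form \<gamma> Xs = 0" if "length Xs = length vs" for Xs
      using V.form1_off_tangent[OF g] False that by (auto simp: eval_form_def fun_eq_iff)
    show ?thesis using False by (simp add: lie_derivative_def V.form_of_def Let_def z DE_zero[OF a])
  qed
  then show "\<L> \<alpha> \<gamma> x vs e = V.form_of (\<lambda>X. DE \<alpha> (eval_form \<gamma> [X]) - eval_form \<gamma> [bracket TM (\<rho> \<alpha>) X]) x vs e"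
    by simp
qed

lemma lie_derivative_F1: "\<alpha> \<in> sections A \<Longrightarrow> \<gamma> \<in> F1 \<Longrightarrow> \<L> \<alpha> \<gamma> \<in> F1"
  unfolding lie_derivative_one_form by (rule V.form_of_in[OF lie_derivative_tensorial])

lemma lie_derivative_apply:
  assumes "\<alpha> \<in> sections A" "\<gamma> \<in> F1" "X \<in> Vect" "s \<in> sections V"
  shows "V.act (\<L> \<alpha> \<gamma>) X s =
     D \<alpha> (V.act \<gamma> X s) - V.act \<gamma> X (D \<alpha> s)
       - V.act \<gamma> (bracket TM (\<rho> \<alpha>) X) s"
proof -
  have "eval_form (\<L> \<alpha> \<gamma>) [X] =
      DE \<alpha> (eval_form \<gamma> [X]) - eval_form \<gamma> [bracket TM (\<rho> \<alpha>) X]"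
    unfolding lie_derivative_one_form[OF assms(1,2)] by (intro V.form_of_eval lie_derivative_tensorial assms(1-3))
  then show ?thesis
    by (simp only: V.apply_diff DE_apply[OF assms(1) V.form1_End[OF assms(2,3)] assms(4)])
qed

text \<open>A section, viewed as a form of degree zero.\<close>

definition zero_form :: "('m \<Rightarrow> 'w::zero) \<Rightarrow> ('m, 'w) vform" where
  "zero_form h = (\<lambda>x vs. if vs = [] then h x else 0)"

lemma lie_derivative_zero_form:
  assumes a: "\<alpha> \<in> sections A" and h: "h \<in> sections EndV"
  shows "\<L> \<alpha> (zero_form h) = zero_form (DE \<alpha> h)"
proof (intro ext)
  fix x vs e
  have z: "eval_form (zero_form h) Xs = 0" if "Xs \<noteq> []" for Xs
    using that by (auto simp: eval_form_def fun_eq_iff zero_form_def)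
  show "\<L> \<alpha> (zero_form h) x vs e = zero_form (DE \<alpha> h) x vs e"
  proof (cases "vs = []")
    case True
    have "eval_form (zero_form h) [] = h" by (simp add: eval_form_def zero_form_def)
    then show ?thesis using V.End_off_points[OF DE_in[OF a h], of x] True
      by (simp add: lie_derivative_def zero_form_def tangent_list_def)
  next
    case False
    have "\<L> \<alpha> (zero_form h) x vs = 0"
      using False by (simp add: lie_derivative_def Let_def z DE_zero[OF a])
    then show ?thesis using False by (simp add: zero_form_def)
  qed
qed

lemma contract_one_form: "\<gamma> \<in> F1 \<Longrightarrow> contract X \<gamma> = zero_form (eval_form \<gamma> [X])"
  using V.form1_off[of \<gamma>] by (fastforce simp: fun_eq_iff contract_def zero_form_def eval_form_def)

lemma contract_zero_form: "contract X (zero_form h) = 0"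
  by (auto simp: fun_eq_iff contract_def zero_form_def)

lemma zero_form_in:
  assumes "h \<in> sections EndV" shows "zero_form h \<in> sections (form_bundle M 0 EndV)"
proof -
  have "eval_form (zero_form h) [] = h" by (simp add: eval_form_def zero_form_def)
  moreover have "zero_form h x = 0" if "x \<notin> points M" for x
    using V.End_off_points[OF assms that] by (auto simp: zero_form_def)
  moreover have "zero_form h x \<in> alternating_forms M x 0 (fibre EndV x)" if "x \<in> points M" for x
    using V.End_hom[OF assms that] that by (auto simp: zero_form_def alternating_forms_def tangent_list_def)
  ultimately show ?thesis using assms by (simp add: form_bundle_def)
qed

lemma d_wedge_const: "d_wedge M (const_fn c) \<eta> = 0"
proof -
  have "(vs ! i) (const_fn c) = 0" if "tangent_list M x vs" "i < length vs" for x vs i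
    using that by (intro tv_const[of _ x]) (auto simp: tangent_list_def)
  then show ?thesis by (auto simp: d_wedge_def fun_eq_iff)
qed

lemma d_wedge_tensorial:
  assumes f: "f \<in> Cinf" and h: "h \<in> sections EndV"
  shows "T.tensorial (\<lambda>X. smul (derive_by X f) h)"
    "X \<in> Vect \<Longrightarrow> smul (derive_by X f) h \<in> sections EndV"
proof -
  show "T.tensorial (\<lambda>X. smul (derive_by X f) h)"
    by (rule T.tensorialI) (auto simp: fun_eq_iff derive_by_def algebra_simps)
  show "X \<in> Vect \<Longrightarrow> smul (derive_by X f) h \<in> sections EndV"
    by (intro V.End_smul vf_smooth f h)
qed

lemma d_wedge_eq:
  assumes f: "f \<in> Cinf" and h: "h \<in> sections EndV"
  shows "d_wedge M f (zero_form h) = V.form_of (\<lambda>X. smul (derive_by X f) h)"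
proof (intro ext)
  fix x vs e
  show "d_wedge M f (zero_form h) x vs e = V.form_of (\<lambda>X. smul (derive_by X f) h) x vs e"
  proof (cases "length vs = 1")
    case True
    then obtain v where v: "vs = [v]" by (auto simp: V.length_Suc_0)
    show ?thesis using T.section_through(2)[of x v] by (auto simp: v d_wedge_def V.form_of_def zero_form_def derive_by_def)
  next
    case False
    have "zero_form h x (take i vs @ drop (Suc i) vs) = 0" if "i < length vs" for i
    proof -
      have "length (take i vs @ drop (Suc i) vs) \<noteq> 0" using that False by auto
      then have "take i vs @ drop (Suc i) vs \<noteq> []" by (metis list.size(3))
      then show ?thesis by (simp only: zero_form_def if_False)
    qed
    then show ?thesis using False by (simp add: d_wedge_def V.form_of_def)
  qed
qed

section \<open>The invariance form\<close>

context
  fixes nabla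
  assumes nabla: "linear_connection M V nabla"
begin

lemmas N_off = V.conn_off[OF nabla, unfolded TM_simps]
  and N_in = V.conn_in[OF nabla, unfolded TM_simps]
  and N_add_left = V.conn_add_left[OF nabla, unfolded TM_simps]
  and N_smul_left = V.conn_smul_left[OF nabla, unfolded TM_simps]
  and N_add = V.conn_add[OF nabla, unfolded TM_simps]
  and N_diff = V.conn_diff[OF nabla, unfolded TM_simps]
  and N_scaleR = V.conn_scaleR[OF nabla, unfolded TM_simps]
  and N_smul = V.conn_smul[OF nabla, unfolded TM_simps anchor_field_TM]
  and NE_in = V.End_connection_in[OF nabla, unfolded TM_simps]
  and NE_apply = V.End_connection_apply[OF nabla, unfolded TM_simps]

lemma N_scaleR_left:
  assumes "X \<in> Vect" "s \<in> sections V" shows "nabla (a *\<^sub>R X) s = a *\<^sub>R nabla X s"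
  using N_smul_left[OF assms(1) const_fn_smooth assms(2)]
  by (simp add: T.scaleR_eq_smul[unfolded TM_simps, OF assms(1)] V.scaleR_eq_smul[OF N_in[OF assms]])

lemma N_uminus_left:
  assumes "X \<in> Vect" "s \<in> sections V" shows "nabla (- X) s = - nabla X s"
  using N_scaleR_left[OF assms, of "-1"] by simp

definition theta_op :: "('m \<Rightarrow> 'a) \<Rightarrow> ('m \<Rightarrow> 'v) \<Rightarrow> 'm \<Rightarrow> 'v" where
  "theta_op \<alpha> s = D \<alpha> s - nabla (\<rho> \<alpha>) s"

lemma theta_end_op: assumes a: "\<alpha> \<in> sections A" shows "V.end_op (theta_op \<alpha>)"
proof (rule V.end_opI)
  note r = rho_vf[OF a]
  show "theta_op \<alpha> s \<in> sections V" if "s \<in> sections V" for s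
    unfolding theta_op_def by (intro V.section_diff D_in N_in a r that)
  show "theta_op \<alpha> (s + t) = theta_op \<alpha> s + theta_op \<alpha> t" if "s \<in> sections V" "t \<in> sections V" for s t
    by (simp add: theta_op_def D_add[OF a that] N_add[OF r that])
  show "theta_op \<alpha> (smul f s) = smul f (theta_op \<alpha> s)" if "f \<in> Cinf" "s \<in> sections V" for f s
    by (simp add: theta_op_def D_smul[OF a that(2,1)] N_smul[OF r that(2,1)] fun_eq_iff algebra_simps)
qed

lemma theta_tensorial: assumes s: "s \<in> sections V" shows "A.tensorial (\<lambda>\<alpha>. theta_op \<alpha> s)"
proof (rule A.tensorialI)
  show "theta_op (\<alpha> + \<beta>) s = theta_op \<alpha> s + theta_op \<beta> s" if "\<alpha> \<in> sections A" "\<beta> \<in> sections A" for \<alpha> \<beta>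
    using that by (simp add: theta_op_def rho_add D_add_left N_add_left rho_vf s)
  show "theta_op (smul f \<alpha>) s = smul f (theta_op \<alpha> s)" if "f \<in> Cinf" "\<alpha> \<in> sections A" for f \<alpha>
    using that by (simp add: theta_op_def rho_smul D_smul_left N_smul_left rho_vf s fun_eq_iff algebra_simps)
qed

abbreviation "\<theta> \<equiv> invariance_theta M A V D nabla"

lemma theta_section:
  assumes a: "\<alpha> \<in> sections A" shows "apply_section \<theta> \<alpha> = V.end_of (theta_op \<alpha>)"
proof (intro ext)
  fix x e
  show "apply_section \<theta> \<alpha> x e = V.end_of (theta_op \<alpha>) x e"
  proof (cases "x \<in> points M \<and> e \<in> fibre V x")
    case True
    then have x: "x \<in> points M" and e: "e \<in> fibre V x" by auto
    note ax = A.section_in[OF a x]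
    have "theta_op (section_through A x (\<alpha> x)) (section_through V x e) x = theta_op \<alpha> (section_through V x e) x"
      by (rule A.tensorial_at[OF theta_tensorial A.section_through(1)[OF x ax] a x A.section_through(2)[OF x ax]])
         (rule V.section_through(1)[OF x e])
    then show ?thesis using x e ax
      by (simp add: invariance_theta_def V.end_of_def Let_def theta_op_def)
  next
    case False
    then show ?thesis by (auto simp: invariance_theta_def V.end_of_def)
  qed
qed

lemma theta_End: "\<alpha> \<in> sections A \<Longrightarrow> apply_section \<theta> \<alpha> \<in> sections EndV"
  by (simp only: theta_section V.end_of_in[OF theta_end_op])

lemma theta_apply: "\<alpha> \<in> sections A \<Longrightarrow> s \<in> sections V \<Longrightarrow>
    apply_section (apply_section \<theta> \<alpha>) s = D \<alpha> s - nabla (\<rho> \<alpha>) s"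
  by (simp only: theta_section V.end_of_apply[OF theta_end_op] theta_op_def)

lemma curvature_eq: "curvature TM nabla X Y s = nabla X (nabla Y s) - nabla Y (nabla X s) - nabla (bracket TM X Y) s"
  by (simp add: curvature_def)

lemma curvature_anti:
  assumes "X \<in> Vect" "Y \<in> Vect" "s \<in> sections V"
  shows "curvature TM nabla X Y s = - curvature TM nabla Y X s"
proof -
  have "nabla (bracket TM X Y) s = - nabla (bracket TM Y X) s"
    using N_uminus_left[OF vf_bracket[OF assms(2,1)] assms(3)] bracket_TM_anti[of X Y] by simp
  then show ?thesis by (simp add: curvature_eq)
qed

lemma curvature_end_op:
  assumes X: "X \<in> Vect" and Y: "Y \<in> Vect"
  shows "V.end_op (curvature TM nabla X Y)"
proof (rule V.end_opI)
  note b = vf_bracket[OF X Y]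
  show "curvature TM nabla X Y s \<in> sections V" if "s \<in> sections V" for s
    unfolding curvature_eq by (intro V.section_diff N_in X Y b that)
  show "curvature TM nabla X Y (s + t) = curvature TM nabla X Y s + curvature TM nabla X Y t"
    if "s \<in> sections V" "t \<in> sections V" for s t
    using that by (simp add: curvature_eq N_add X Y b N_in)
  show "curvature TM nabla X Y (smul f s) = smul f (curvature TM nabla X Y s)"
    if f: "f \<in> Cinf" and s: "s \<in> sections V" for f s
  proof -
    have e: "nabla X (nabla Y (smul f s)) = smul f (nabla X (nabla Y s)) + smul (derive_by X f) (nabla Y s) +
        (smul (derive_by Y f) (nabla X s) + smul (derive_by X (derive_by Y f)) s)"
      if X: "X \<in> Vect" and Y: "Y \<in> Vect" for X Y
      using s f by (simp add: N_smul N_add X Y N_in V.section_smul vf_smooth)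
    show ?thesis
      unfolding curvature_eq e[OF X Y] e[OF Y X] N_smul[OF b s f] derive_by_bracket
      by (simp add: fun_eq_iff algebra_simps)
  qed
qed

lemma curvature_tensorial_right:
  assumes X: "X \<in> Vect" and s: "s \<in> sections V"
  shows "T.tensorial (\<lambda>Y. curvature TM nabla X Y s)"
proof (rule T.tensorialI)
  fix Y Z assume YZ: "Y \<in> sections TM" "Z \<in> sections TM"
  then show "curvature TM nabla X (Y + Z) s = curvature TM nabla X Y s + curvature TM nabla X Z s"
    using X s by (simp add: curvature_eq N_add_left N_add N_in vf_add bracket_TM_add_right vf_bracket)
next
  fix f Y assume f: "f \<in> Cinf" and "Y \<in> sections TM"
  then have Y: "Y \<in> Vect" by simp
  have "nabla (bracket TM X (smul f Y)) s = smul f (nabla (bracket TM X Y) s) + smul (derive_by X f) (nabla Y s)"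
    using X Y f s by (simp add: bracket_TM_smul_right N_add_left N_smul_left vf_smul vf_bracket vf_smooth)
  then show "curvature TM nabla X (smul f Y) s = smul f (curvature TM nabla X Y s)"
    using X Y f s by (simp add: curvature_eq N_smul_left N_smul N_in fun_eq_iff algebra_simps)
qed

lemma curvature_tensorial_left:
  assumes Y: "Y \<in> Vect" and s: "s \<in> sections V"
  shows "T.tensorial (\<lambda>X. curvature TM nabla X Y s)"
proof (rule T.tensorialI)
  note t = curvature_tensorial_right[OF Y s, unfolded T.tensorial_def TM_simps]
  fix X Z assume "X \<in> sections TM" "Z \<in> sections TM"
  then have XZ: "X \<in> Vect" "Z \<in> Vect" by auto
  show "curvature TM nabla (X + Z) Y s = curvature TM nabla X Y s + curvature TM nabla Z Y s"
    using t XZ by (simp add: curvature_anti[OF _ Y s] vf_add)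
next
  note t = curvature_tensorial_right[OF Y s, unfolded T.tensorial_def TM_simps]
  fix f X assume f: "f \<in> Cinf" and "X \<in> sections TM"
  then have X: "X \<in> Vect" by simp
  have "curvature TM nabla Y (smul f X) s = smul f (curvature TM nabla Y X s)" using t X f by blast
  then show "curvature TM nabla (smul f X) Y s = smul f (curvature TM nabla X Y s)"
    unfolding curvature_anti[OF vf_smul[OF f X] Y s] curvature_anti[OF X Y s] by (simp add: fun_eq_iff)
qed

lemma curvature_End:
  assumes Z: "Z \<in> Vect"
  shows "T.tensorial (\<lambda>X. V.end_of (curvature TM nabla Z X))"
    "X \<in> Vect \<Longrightarrow> V.end_of (curvature TM nabla Z X) \<in> sections EndV"
proof -
  have E: "V.end_of (curvature TM nabla Z X) \<in> sections EndV" if "X \<in> Vect" for X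
    by (rule V.end_of_in[OF curvature_end_op[OF Z that]])
  then show "X \<in> Vect \<Longrightarrow> V.end_of (curvature TM nabla Z X) \<in> sections EndV" .
  show "T.tensorial (\<lambda>X. V.end_of (curvature TM nabla Z X))"
    by (rule V.End_tensorialI[OF E V.end_of_apply[OF curvature_end_op[OF Z]] curvature_tensorial_right[OF Z]])
qed

lemma curvature_form_contract:
  assumes Z: "Z \<in> Vect"
  shows "contract Z (curvature_form M V nabla) = V.form_of (\<lambda>X. V.end_of (curvature TM nabla Z X))"
proof (intro ext)
  fix x vs e
  show "contract Z (curvature_form M V nabla) x vs e = V.form_of (\<lambda>X. V.end_of (curvature TM nabla Z X)) x vs e"
  proof (cases "x \<in> points M \<and> e \<in> fibre V x \<and> (\<exists>v\<in>tangent_space M x. vs = [v])")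
    case True
    then obtain v where x: "x \<in> points M" and e: "e \<in> fibre V x" and v: "v \<in> tangent_space M x" "vs = [v]" by blast
    note Zx = vf_tangent[OF Z x]
    have tl: "tangent_list M x [Z x, v]" using x Zx v by (simp add: tangent_list_def)
    let ?s = "section_through V x e" and ?Y = "section_through TM x v" and ?Z = "section_through TM x (Z x)"
    have s: "?s \<in> sections V" using V.section_through(1)[OF x e] .
    have Y: "?Y \<in> Vect" using T.section_through(1)[OF x, of v] v by simp
    have Z': "?Z \<in> Vect" "?Z x = Z x" using T.section_through[OF x, of "Z x"] Zx by simp_all
    have "curvature TM nabla ?Z ?Y ?s x = curvature TM nabla Z ?Y ?s x"
      using T.tensorial_at[OF curvature_tensorial_left[OF Y s], of ?Z Z x] Z Z' x by simp
    then show ?thesis using x e v tl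
      by (simp add: contract_def curvature_form_def V.form_of_def V.end_of_def Let_def)
  next
    case False
    then have "contract Z (curvature_form M V nabla) x vs e = 0"
      by (auto simp: contract_def curvature_form_def tangent_list_def V.length_Suc_0)
    moreover have "V.form_of (\<lambda>X. V.end_of (curvature TM nabla Z X)) x vs e = 0"
      using False by (auto simp: V.form_of_def V.end_of_def tangent_list_def V.length_Suc_0)
    ultimately show ?thesis by simp
  qed
qed

lemma End_nabla_tensorial:
  assumes h: "h \<in> sections EndV"
  shows "T.tensorial (\<lambda>X. End_connection M TM V nabla X h)"
proof (rule V.End_tensorialI[OF NE_in[OF _ h] NE_apply[OF _ h]])
  fix s assume s: "s \<in> sections V"
  note hs = V.End_apply[OF h s]
  show "T.tensorial (\<lambda>X. nabla X (apply_section h s) - apply_section h (nabla X s))"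
  proof (rule T.tensorialI; unfold TM_simps)
    fix X Y assume XY: "X \<in> Vect" "Y \<in> Vect"
    show "nabla (X + Y) (apply_section h s) - apply_section h (nabla (X + Y) s) =
      nabla X (apply_section h s) - apply_section h (nabla X s) + (nabla Y (apply_section h s) - apply_section h (nabla Y s))"
      unfolding N_add_left[OF XY s] N_add_left[OF XY hs] V.End_apply_add[OF h N_in[OF XY(1) s] N_in[OF XY(2) s]] by simp
  next
    fix f X assume f: "f \<in> Cinf" and X: "X \<in> Vect"
    show "nabla (smul f X) (apply_section h s) - apply_section h (nabla (smul f X) s) =
      smul f (nabla X (apply_section h s) - apply_section h (nabla X s))"
      unfolding N_smul_left[OF X f s] N_smul_left[OF X f hs] V.End_apply_smul[OF h N_in[OF X s]]
      by (simp add: fun_eq_iff algebra_simps)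
  qed
qed

lemma d_nabla_eq: "d_nabla M V nabla h = V.form_of (\<lambda>X. End_connection M TM V nabla X h)"
  unfolding d_nabla_def V.form_of_def Let_def ..

abbreviation "\<T> \<equiv> invariance_T M A V D nabla"

lemma invariance_T_eq:
  assumes "\<alpha> \<in> sections A"
  shows "\<T> \<alpha> = V.form_of (\<lambda>X. End_connection M TM V nabla X (apply_section \<theta> \<alpha>)) -
     V.form_of (\<lambda>X. V.end_of (curvature TM nabla (\<rho> \<alpha>) X))"
  using assms by (simp add: invariance_T_def d_nabla_eq curvature_form_contract[OF rho_vf])

lemma invariance_T_F1: assumes a: "\<alpha> \<in> sections A" shows "\<T> \<alpha> \<in> F1"
  unfolding invariance_T_eq[OF a]
  by (intro V.form1_diff V.form_of_in End_nabla_tensorial NE_in curvature_End theta_End a rho_vf)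

text \<open>With \<open>\<theta>(\<alpha>) = \<nabla>\<^sup>A\<^sub>\<alpha> - \<nabla>\<^sub>\<rho>\<^sub>\<alpha>\<close>, the commutator of \<open>\<nabla>\<^sub>X\<close> and \<open>\<nabla>\<^sub>\<rho>\<^sub>\<alpha>\<close> in \<open>[\<nabla>\<^sub>X, \<theta>(\<alpha>)]\<close> cancels against the one in the
curvature.  Both the equations of an IM form and the effect of a translation are read off from this formula.\<close>

lemma invariance_T_apply:
  assumes a: "\<alpha> \<in> sections A" and X: "X \<in> Vect" and s: "s \<in> sections V"
  shows "V.act (\<T> \<alpha>) X s =
     nabla X (D \<alpha> s) - D \<alpha> (nabla X s) + nabla (bracket TM (\<rho> \<alpha>) X) s"
proof -
  have 1: "eval_form (V.form_of (\<lambda>X. End_connection M TM V nabla X (apply_section \<theta> \<alpha>))) [X] =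
     End_connection M TM V nabla X (apply_section \<theta> \<alpha>)"
    by (intro V.form_of_eval End_nabla_tensorial NE_in theta_End a X)
  have 2: "eval_form (V.form_of (\<lambda>X. V.end_of (curvature TM nabla (\<rho> \<alpha>) X))) [X] = V.end_of (curvature TM nabla (\<rho> \<alpha>) X)"
    by (intro V.form_of_eval curvature_End rho_vf a X)
  have 3: "nabla X (D \<alpha> s - nabla (\<rho> \<alpha>) s) = nabla X (D \<alpha> s) - nabla X (nabla (\<rho> \<alpha>) s)"
    by (intro N_diff X D_in N_in a s rho_vf)
  show ?thesis
    unfolding invariance_T_eq[OF a] V.eval_diff 1 2 V.apply_diff NE_apply[OF X theta_End[OF a] s]
      V.end_of_apply[OF curvature_end_op[OF rho_vf[OF a] X] s] theta_apply[OF a s] theta_apply[OF a N_in[OF X s]] 3 curvature_eq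
    by simp
qed

text \<open>By \<open>invariance_T_apply\<close> the equations for \<open>(T, \<theta>)\<close> become identities between operators on sections of \<open>V\<close>,
which hold by the Leibniz rules, by flatness and by \<open>rho_bracket\<close>.\<close>

lemma invariance_form_im:
  "invariance_form M A V D nabla \<in> im_forms M A 1 EndV DE"
proof -
  define c1 where "c1 = (\<lambda>x a (vs::'m tvec list). if vs = [] then \<theta> x a else 0)"
  have c1: "apply_section c1 \<alpha> = zero_form (apply_section \<theta> \<alpha>)" for \<alpha>
    by (auto simp: c1_def zero_form_def fun_eq_iff)
  have T_add: "\<T> (\<alpha> + \<beta>) = \<T> \<alpha> + \<T> \<beta>" if ab: "\<alpha> \<in> sections A" "\<beta> \<in> sections A" for \<alpha> \<beta>
  proof (rule V.form1_ext[OF invariance_T_F1[OF A.section_add[OF ab]] V.form1_add[OF invariance_T_F1[OF ab(1)] invariance_T_F1[OF ab(2)]]])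
    fix X s assume X: "X \<in> Vect" and s: "s \<in> sections V"
    note r = rho_vf[OF ab(1)] rho_vf[OF ab(2)]
    note ds = D_in[OF ab(1) s] D_in[OF ab(2) s]
    show "V.act (\<T> (\<alpha> + \<beta>)) X s = V.act (\<T> \<alpha> + \<T> \<beta>) X s"
      unfolding V.eval_add V.apply_add invariance_T_apply[OF A.section_add[OF ab] X s] invariance_T_apply[OF ab(1) X s] invariance_T_apply[OF ab(2) X s]
        D_add_left[OF ab s] D_add_left[OF ab N_in[OF X s]] rho_add[OF ab] bracket_TM_add_left[OF r X]
        N_add_left[OF vf_bracket[OF r(1) X] vf_bracket[OF r(2) X] s] N_add[OF X ds]
      by simp
  qed
  \<comment> \<open>The extra term comes from \<open>[f \<rho>\<alpha>, X]\<close> and from the Leibniz rule of \<open>\<nabla>\<^sub>X\<close>, which yield \<open>(X f) (\<nabla>\<^sup>A\<^sub>\<alpha> - \<nabla>\<^sub>\<rho>\<^sub>\<alpha>)\<close>.\<close>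
  have T_smul: "\<T> (smul f \<alpha>) = smul f (\<T> \<alpha>) + d_wedge M f (zero_form (apply_section \<theta> \<alpha>))"
    if a: "\<alpha> \<in> sections A" and f: "f \<in> Cinf" for \<alpha> f
  proof -
    note h = theta_End[OF a] and fa = A.section_smul[OF f a] and r = rho_vf[OF a]
    note dw = d_wedge_tensorial[OF f h]
    have din: "V.form_of (\<lambda>X. smul (derive_by X f) (apply_section \<theta> \<alpha>)) \<in> F1"
      by (rule V.form_of_in[OF dw])
    show ?thesis
      unfolding d_wedge_eq[OF f h]
    proof (rule V.form1_ext[OF invariance_T_F1[OF fa] V.form1_add[OF V.form1_smul[OF invariance_T_F1[OF a] f] din]])
      fix X s assume X: "X \<in> Vect" and s: "s \<in> sections V"
      have ev: "eval_form (V.form_of (\<lambda>X. smul (derive_by X f) (apply_section \<theta> \<alpha>))) [X] = smul (derive_by X f) (apply_section \<theta> \<alpha>)"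
        by (intro V.form_of_eval dw X)
      have br: "bracket TM (smul f (\<rho> \<alpha>)) X = smul f (bracket TM (\<rho> \<alpha>) X) + smul (\<lambda>x. - derive_by X f x) (\<rho> \<alpha>)"
        using bracket_TM_smul_right[OF X r f] bracket_TM_anti[of "smul f (\<rho> \<alpha>)" X] bracket_TM_anti[of "\<rho> \<alpha>" X]
        by (simp add: fun_eq_iff)
      have nf: "(\<lambda>x. - derive_by X f x) \<in> Cinf"
        using smooth_fn_cmult[OF vf_smooth[OF X f], of "-1"] by simp
      have bv: "bracket TM (\<rho> \<alpha>) X \<in> Vect" using vf_bracket[OF r X] .
      have e1: "nabla (smul f (bracket TM (\<rho> \<alpha>) X) + smul (\<lambda>x. - derive_by X f x) (\<rho> \<alpha>)) s =
         smul f (nabla (bracket TM (\<rho> \<alpha>) X) s) + smul (\<lambda>x. - derive_by X f x) (nabla (\<rho> \<alpha>) s)"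
        using N_add_left[OF vf_smul[OF f bv] vf_smul[OF nf r] s] N_smul_left[OF bv f s] N_smul_left[OF r nf s] by simp
      show "V.act (\<T> (smul f \<alpha>)) X s =
         V.act (smul f (\<T> \<alpha>) + V.form_of (\<lambda>X. smul (derive_by X f) (apply_section \<theta> \<alpha>))) X s"
        unfolding V.eval_add V.eval_smul V.apply_add V.apply_smul ev invariance_T_apply[OF fa X s] invariance_T_apply[OF a X s] theta_apply[OF a s]
          D_smul_left[OF a f s] D_smul_left[OF a f N_in[OF X s]] rho_smul[OF a] br e1 N_smul[OF X D_in[OF a s] f]
        by (simp add: fun_eq_iff algebra_simps)
    qed
  qed
  \<comment> \<open>Homogeneity is the case of a constant function in \<open>T_smul\<close>.\<close>
  have T_scaleR: "\<T> (a *\<^sub>R \<alpha>) = a *\<^sub>R \<T> \<alpha>" if "\<alpha> \<in> sections A" for \<alpha> a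
    using T_smul[OF that const_fn_smooth] by (simp add: A.scaleR_eq_smul[OF that] V.form1_const_smul[OF invariance_T_F1[OF that]] d_wedge_const)
  have T_lin: "\<T> (a *\<^sub>R \<alpha> + b *\<^sub>R \<beta>) = a *\<^sub>R \<T> \<alpha> + b *\<^sub>R \<T> \<beta>"
    if "\<alpha> \<in> sections A" "\<beta> \<in> sections A" for \<alpha> \<beta> a b
    using that by (simp add: T_add T_scaleR A.section_scaleR)
  \<comment> \<open>Jacobi identity for \<open>\<nabla>\<^sub>X\<close>, \<open>\<nabla>\<^sup>A\<^sub>\<alpha>\<close>, \<open>\<nabla>\<^sup>A\<^sub>\<beta>\<close> and for \<open>\<rho>\<alpha>\<close>, \<open>\<rho>\<beta>\<close>, \<open>X\<close>; the mixed terms cancel in pairs.\<close>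
  have T_br: "\<T> (bracket A \<alpha> \<beta>) = \<L> \<alpha> (\<T> \<beta>) - \<L> \<beta> (\<T> \<alpha>)"
    if a: "\<alpha> \<in> sections A" and b: "\<beta> \<in> sections A" for \<alpha> \<beta>
  proof (rule V.form1_ext[OF invariance_T_F1[OF br_in[OF a b]] V.form1_diff[OF lie_derivative_F1[OF a invariance_T_F1[OF b]] lie_derivative_F1[OF b invariance_T_F1[OF a]]]])
    fix X s assume X: "X \<in> Vect" and s: "s \<in> sections V"
    note ra = rho_vf[OF a] and rb = rho_vf[OF b]
    note vf = X ra rb vf_bracket[OF ra X] vf_bracket[OF rb X] vf_bracket[OF ra vf_bracket[OF rb X]] vf_bracket[OF rb vf_bracket[OF ra X]]
    have jac: "bracket TM (bracket TM (\<rho> \<alpha>) (\<rho> \<beta>)) X =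
       bracket TM (\<rho> \<alpha>) (bracket TM (\<rho> \<beta>) X) + (-1) *\<^sub>R bracket TM (\<rho> \<beta>) (bracket TM (\<rho> \<alpha>) X)"
    proof (rule vf_eqI)
      show "bracket TM (bracket TM (\<rho> \<alpha>) (\<rho> \<beta>)) X \<in> Vect" by (intro vf_bracket vf)
      show "bracket TM (\<rho> \<alpha>) (bracket TM (\<rho> \<beta>) X) + (-1) *\<^sub>R bracket TM (\<rho> \<beta>) (bracket TM (\<rho> \<alpha>) X) \<in> Vect"
        using T.section_scaleR[of "bracket TM (\<rho> \<beta>) (bracket TM (\<rho> \<alpha>) X)" "-1"] vf(6,7) by (intro vf_add) auto
      fix f x assume f: "f \<in> Cinf" and x: "x \<in> points M"
      have sm: "derive_by Y g \<in> Cinf" if "Y \<in> Vect" "g \<in> Cinf" for Y g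
        using vf_smooth that .
      have dd: "W x (derive_by (bracket TM Y Z) f) = W x (derive_by Y (derive_by Z f)) - W x (derive_by Z (derive_by Y f))"
        if "W \<in> Vect" "Y \<in> Vect" "Z \<in> Vect" for W Y Z
        unfolding derive_by_bracket
        by (rule tv_diff[OF vf_tangent[OF that(1) x]]) (intro sm that f)+
      show "bracket TM (bracket TM (\<rho> \<alpha>) (\<rho> \<beta>)) X x f =
         (bracket TM (\<rho> \<alpha>) (bracket TM (\<rho> \<beta>) X) + (-1) *\<^sub>R bracket TM (\<rho> \<beta>) (bracket TM (\<rho> \<alpha>) X)) x f"
        using dd[OF X ra rb] dd[OF ra rb X] dd[OF rb ra X] by (simp add: bracket_TM)
    qed
    have Nj: "nabla (bracket TM (bracket TM (\<rho> \<alpha>) (\<rho> \<beta>)) X) s =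
        nabla (bracket TM (\<rho> \<alpha>) (bracket TM (\<rho> \<beta>) X)) s - nabla (bracket TM (\<rho> \<beta>) (bracket TM (\<rho> \<alpha>) X)) s"
      unfolding jac
      using N_add_left[OF vf(6) _ s, of "(-1) *\<^sub>R bracket TM (\<rho> \<beta>) (bracket TM (\<rho> \<alpha>) X)"]
        T.section_scaleR[of "bracket TM (\<rho> \<beta>) (bracket TM (\<rho> \<alpha>) X)" "-1"] vf(7) N_scaleR_left[OF vf(7) s, of "-1"]
      by simp
    have L: "V.act (\<L> \<alpha> (\<T> \<beta>)) X s =
        D \<alpha> (nabla X (D \<beta> s)) - D \<alpha> (D \<beta> (nabla X s)) + D \<alpha> (nabla (bracket TM (\<rho> \<beta>) X) s)
        - (nabla X (D \<beta> (D \<alpha> s)) - D \<beta> (nabla X (D \<alpha> s)) + nabla (bracket TM (\<rho> \<beta>) X) (D \<alpha> s))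
        - (nabla (bracket TM (\<rho> \<alpha>) X) (D \<beta> s) - D \<beta> (nabla (bracket TM (\<rho> \<alpha>) X) s)
           + nabla (bracket TM (\<rho> \<beta>) (bracket TM (\<rho> \<alpha>) X)) s)"
      if a: "\<alpha> \<in> sections A" and b: "\<beta> \<in> sections A" for \<alpha> \<beta>
    proof -
      note ra = rho_vf[OF a] and rb = rho_vf[OF b]
      note bx = vf_bracket[OF ra X] vf_bracket[OF rb X]
      have m: "nabla X (D \<beta> s) \<in> sections V" "D \<beta> (nabla X s) \<in> sections V" "nabla (bracket TM (\<rho> \<beta>) X) s \<in> sections V"
        by (intro N_in D_in X b bx s)+
      have "D \<alpha> (nabla X (D \<beta> s) - D \<beta> (nabla X s) + nabla (bracket TM (\<rho> \<beta>) X) s) =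
         D \<alpha> (nabla X (D \<beta> s)) - D \<alpha> (D \<beta> (nabla X s)) + D \<alpha> (nabla (bracket TM (\<rho> \<beta>) X) s)"
        using D_add[OF a V.section_diff[OF m(1,2)] m(3)] D_diff[OF a m(1,2)] by simp
      then show ?thesis
        unfolding lie_derivative_apply[OF a invariance_T_F1[OF b] X s] invariance_T_apply[OF b X s] invariance_T_apply[OF b X D_in[OF a s]] invariance_T_apply[OF b bx(1) s] by simp
    qed
    have e1: "D (bracket A \<alpha> \<beta>) (nabla X s) = D \<alpha> (D \<beta> (nabla X s)) - D \<beta> (D \<alpha> (nabla X s))"
      by (rule flat[OF a b N_in[OF X s]])
    have e2: "nabla X (D (bracket A \<alpha> \<beta>) s) = nabla X (D \<alpha> (D \<beta> s)) - nabla X (D \<beta> (D \<alpha> s))"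
      unfolding flat[OF a b s] by (intro N_diff X D_in a b s)
    show "V.act (\<T> (bracket A \<alpha> \<beta>)) X s =
       V.act (\<L> \<alpha> (\<T> \<beta>) - \<L> \<beta> (\<T> \<alpha>)) X s"
      unfolding V.eval_diff V.apply_diff L[OF a b] L[OF b a] invariance_T_apply[OF br_in[OF a b] X s] e1 e2 rho_bracket[OF a b] Nj
      by (simp add: algebra_simps)
  qed
  have th_br: "apply_section \<theta> (bracket A \<alpha> \<beta>) = DE \<alpha> (apply_section \<theta> \<beta>) - eval_form (\<T> \<alpha>) [\<rho> \<beta>]"
    if a: "\<alpha> \<in> sections A" and b: "\<beta> \<in> sections A" for \<alpha> \<beta>
  proof (rule V.End_ext[OF theta_End[OF br_in[OF a b]] V.End_diff[OF DE_in[OF a theta_End[OF b]] V.form1_End[OF invariance_T_F1[OF a] rho_vf[OF b]]]])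
    fix s assume s: "s \<in> sections V"
    have "D \<alpha> (D \<beta> s - nabla (\<rho> \<beta>) s) = D \<alpha> (D \<beta> s) - D \<alpha> (nabla (\<rho> \<beta>) s)"
      by (intro D_diff a D_in b s N_in rho_vf)
    then show "apply_section (apply_section \<theta> (bracket A \<alpha> \<beta>)) s =
       apply_section (DE \<alpha> (apply_section \<theta> \<beta>) - eval_form (\<T> \<alpha>) [\<rho> \<beta>]) s"
      unfolding V.apply_diff DE_apply[OF a theta_End[OF b] s] theta_apply[OF b s] theta_apply[OF b D_in[OF a s]]
        theta_apply[OF br_in[OF a b] s] invariance_T_apply[OF a rho_vf[OF b] s] flat[OF a b s] rho_bracket[OF a b]
      by simp
  qed
  have zdiff: "zero_form (h - h') = zero_form h - zero_form h'" for h h' :: "'m \<Rightarrow> 'v \<Rightarrow> 'v"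
    by (auto simp: zero_form_def fun_eq_iff)
  have bm: "bundle_map M A (form_bundle M 0 EndV) c1"
    unfolding bundle_map_def
  proof (intro conjI ballI allI impI)
    show "apply_section c1 \<alpha> \<in> sections (form_bundle M 0 EndV)" if "\<alpha> \<in> sections A" for \<alpha>
      unfolding c1 by (rule zero_form_in[OF theta_End[OF that]])
    show "c1 x = 0" if "x \<notin> points M" for x
      using that by (auto simp: c1_def invariance_theta_def fun_eq_iff)
    fix x assume x: "x \<in> points M"
    have in': "c1 x u \<in> fibre (form_bundle M 0 EndV) x" if u: "u \<in> fibre A x" for u
    proof -
      obtain \<alpha> where al: "\<alpha> \<in> sections A" "\<alpha> x = u" using A.extend[OF x u] by blast
      have "apply_section c1 \<alpha> x \<in> fibre (form_bundle M 0 EndV) x"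
        using zero_form_in[OF theta_End[OF al(1)]] x unfolding c1 by (simp add: form_bundle_def)
      then show ?thesis by (simp add: al(2))
    qed
    have lin: "\<theta> x (a *\<^sub>R u + b *\<^sub>R v) e = a *\<^sub>R \<theta> x u e + b *\<^sub>R \<theta> x v e"
      if u: "u \<in> fibre A x" and v: "v \<in> fibre A x" for u v a b e
    proof (cases "e \<in> fibre V x")
      case True
      obtain s where s: "s \<in> sections V" "s x = e" using V.extend[OF x True] by blast
      obtain \<alpha> \<beta> where al: "\<alpha> \<in> sections A" "\<alpha> x = u" "\<beta> \<in> sections A" "\<beta> x = v"
        using A.extend[OF x u] A.extend[OF x v] by blast
      have th: "\<theta> x (\<alpha> x) e = theta_op \<alpha> s x" if "\<alpha> \<in> sections A" for \<alpha>
        using fun_cong[OF theta_apply[OF that s(1)], of x] by (simp add: s(2) theta_op_def)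
      have "a *\<^sub>R \<alpha> + b *\<^sub>R \<beta> \<in> sections A" using al by (auto intro: A.section_add A.section_scaleR)
      from th[OF this] show ?thesis
        using A.tensorial_linear[OF theta_tensorial[OF s(1)] al(1,3) x, of a b] th[OF al(1)] th[OF al(3)] al(2,4) by simp
    qed (simp add: invariance_theta_def)
    show "c1 x \<in> hom_space (fibre A x) (fibre (form_bundle M 0 EndV) x)"
      unfolding hom_space_def
    proof (intro CollectI conjI ballI allI impI in')
      show "c1 x u = 0" if "u \<notin> fibre A x" for u
        using that by (auto simp: c1_def invariance_theta_def fun_eq_iff)
      show "c1 x (a *\<^sub>R u + b *\<^sub>R v) = a *\<^sub>R c1 x u + b *\<^sub>R c1 x v" if "u \<in> fibre A x" "v \<in> fibre A x" for u v a b
        using lin[OF that] by (auto simp: c1_def fun_eq_iff)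
    qed
  qed
  have "invariance_form M A V D nabla = (\<T>, c1)" by (simp add: invariance_form_def c1_def)
  moreover have "(\<T>, c1) \<in> im_forms M A 1 EndV DE"
    unfolding im_forms_def mem_Collect_eq prod.case c1
  proof (intro conjI allI ballI impI)
    show "\<T> \<alpha> = 0" if "\<alpha> \<notin> sections A" for \<alpha> using that by (simp add: invariance_T_def)
    show "bundle_map M A (form_bundle M (1 - 1) EndV) c1" using bm by simp
    fix \<alpha> \<beta> assume a: "\<alpha> \<in> sections A" and b: "\<beta> \<in> sections A"
    show "zero_form (apply_section \<theta> (bracket A \<alpha> \<beta>)) =
       \<L> \<alpha> (zero_form (apply_section \<theta> \<beta>)) - contract (\<rho> \<beta>) (\<T> \<alpha>)"
      unfolding lie_derivative_zero_form[OF a theta_End[OF b]] contract_one_form[OF invariance_T_F1[OF a]] th_br[OF a b] zdiff ..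
    show "contract (\<rho> \<alpha>) (zero_form (apply_section \<theta> \<beta>)) = - contract (\<rho> \<beta>) (zero_form (apply_section \<theta> \<alpha>))"
      by (simp add: contract_zero_form)
  qed (use invariance_T_F1 T_lin T_smul T_br in auto)
  ultimately show ?thesis by simp
qed

text \<open>The form \<open>\<theta>\<close> measures the first condition of invariance; once \<open>\<theta> = 0\<close>, what remains of \<open>T(\<alpha>)\<close> is the contracted
curvature, up to sign.\<close>

lemma invariant_iff:
  "nabla \<in> invariant_connections M A V D \<longleftrightarrow> invariance_form M A V D nabla = 0"
proof -
  have th: "(\<forall>\<alpha>\<in>sections A. D \<alpha> = nabla (\<rho> \<alpha>)) \<longleftrightarrow> \<theta> = 0"
  proof
    assume l: "\<forall>\<alpha>\<in>sections A. D \<alpha> = nabla (\<rho> \<alpha>)"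
    show "\<theta> = 0"
      using l A.section_through(1) by (auto simp: fun_eq_iff invariance_theta_def Let_def)
  next
    assume z: "\<theta> = 0"
    show "\<forall>\<alpha>\<in>sections A. D \<alpha> = nabla (\<rho> \<alpha>)"
    proof (intro ballI ext)
      fix \<alpha> s x assume a: "\<alpha> \<in> sections A"
      show "D \<alpha> s x = nabla (\<rho> \<alpha>) s x"
      proof (cases "s \<in> sections V")
        case True
        from fun_cong[OF theta_apply[OF a True], of x] show ?thesis by (simp add: z)
      qed (simp add: D_off N_off)
    qed
  qed
  have "\<T> \<alpha> = - contract (\<rho> \<alpha>) (curvature_form M V nabla)" if "\<theta> = 0" "\<alpha> \<in> sections A" for \<alpha>
  proof -
    have "apply_section \<theta> \<alpha> = 0" using that(1) by (simp add: fun_eq_iff)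
    moreover have "d_nabla M V nabla 0 = 0"
      using V.End_connection_zero[OF nabla] T.section_through(1)
      by (auto simp: d_nabla_def Let_def fun_eq_iff tangent_list_def V.length_Suc_0)
    ultimately show ?thesis using that(2) by (simp add: invariance_T_def)
  qed
  then have "\<theta> = 0 \<Longrightarrow> (\<forall>\<alpha>\<in>sections A. contract (\<rho> \<alpha>) (curvature_form M V nabla) = 0) \<longleftrightarrow> \<T> = 0"
    by (auto simp: fun_eq_iff[of \<T>] invariance_T_def[of M A V D nabla])
  moreover have "(\<lambda>x a (vs::'m tvec list). if vs = [] then \<theta> x a else 0) = 0 \<longleftrightarrow> \<theta> = 0"
    by (auto simp: fun_eq_iff)
  ultimately show ?thesis
    using th nabla by (auto simp: invariant_connections_def invariance_form_def zero_prod_def)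
qed

end

section \<open>Translation of connections and the obstruction class\<close>

abbreviation "tr \<equiv> translate_connection M V"
abbreviation "inv_form \<equiv> invariance_form M A V D"
abbreviation "\<delta> \<equiv> delta0 M A DE"

lemma delta_add:
  assumes g: "\<gamma> \<in> F1" "\<gamma>' \<in> F1" shows "\<delta> (\<gamma> + \<gamma>') = \<delta> \<gamma> + \<delta> \<gamma>'"
proof -
  have "\<L> \<alpha> (\<gamma> + \<gamma>') = \<L> \<alpha> \<gamma> + \<L> \<alpha> \<gamma>'"
    if a: "\<alpha> \<in> sections A" for \<alpha>
  proof (rule V.form1_ext[OF lie_derivative_F1[OF a V.form1_add[OF g]] V.form1_add[OF lie_derivative_F1[OF a g(1)] lie_derivative_F1[OF a g(2)]]])
    fix X s assume X: "X \<in> Vect" and s: "s \<in> sections V"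
    have m: "V.act \<gamma> X s \<in> sections V" "V.act \<gamma>' X s \<in> sections V"
      using V.End_apply[OF V.form1_End[OF g(1) X] s] V.End_apply[OF V.form1_End[OF g(2) X] s] .
    show "V.act (\<L> \<alpha> (\<gamma> + \<gamma>')) X s =
        V.act (\<L> \<alpha> \<gamma> + \<L> \<alpha> \<gamma>') X s"
      unfolding V.eval_add V.apply_add lie_derivative_apply[OF a V.form1_add[OF g] X s] lie_derivative_apply[OF a g(1) X s] lie_derivative_apply[OF a g(2) X s]
        D_add[OF a m] by simp
  qed
  then show ?thesis by (auto simp: delta0_def fun_eq_iff)
qed

lemma delta_scaleR:
  assumes g: "\<gamma> \<in> F1" shows "\<delta> (c *\<^sub>R \<gamma>) = c *\<^sub>R \<delta> \<gamma>"
proof -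
  have "\<L> \<alpha> (c *\<^sub>R \<gamma>) = c *\<^sub>R \<L> \<alpha> \<gamma>"
    if a: "\<alpha> \<in> sections A" for \<alpha>
  proof (rule V.form1_ext[OF lie_derivative_F1[OF a V.form1_scaleR[OF g]] V.form1_scaleR[OF lie_derivative_F1[OF a g]]])
    fix X s assume X: "X \<in> Vect" and s: "s \<in> sections V"
    have m: "V.act \<gamma> X s \<in> sections V"
      using V.End_apply[OF V.form1_End[OF g X] s] .
    show "V.act (\<L> \<alpha> (c *\<^sub>R \<gamma>)) X s =
        V.act (c *\<^sub>R \<L> \<alpha> \<gamma>) X s"
      unfolding V.eval_scaleR V.apply_scaleR lie_derivative_apply[OF a V.form1_scaleR[OF g] X s] lie_derivative_apply[OF a g X s]
        D_scaleR[OF a m] by (simp add: algebra_simps)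
  qed
  then show ?thesis by (auto simp: delta0_def fun_eq_iff)
qed

lemma delta_zero: "\<delta> 0 = 0"
  using delta_scaleR[OF V.form1_zero, of 0] by simp

lemma delta_image_subspace: "subspace (\<delta> ` F1)"
proof (rule subspaceI)
  show "0 \<in> \<delta> ` F1" using delta_zero V.form1_zero by (metis imageI)
  show "c + d \<in> \<delta> ` F1" if "c \<in> \<delta> ` F1" "d \<in> \<delta> ` F1" for c d
  proof -
    from that obtain \<gamma> \<gamma>' where "\<gamma> \<in> F1" "c = \<delta> \<gamma>" "\<gamma>' \<in> F1" "d = \<delta> \<gamma>'" by (elim imageE)
    then show ?thesis by (simp only: delta_add[symmetric] imageI V.form1_add)
  qed
  show "a *\<^sub>R c \<in> \<delta> ` F1" if "c \<in> \<delta> ` F1" for a c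
  proof -
    from that obtain \<gamma> where "\<gamma> \<in> F1" "c = \<delta> \<gamma>" by (elim imageE)
    then show ?thesis by (simp only: delta_scaleR[symmetric] imageI V.form1_scaleR)
  qed
qed

lemma tr_apply: "X \<in> Vect \<Longrightarrow> s \<in> sections V \<Longrightarrow>
    tr nabla \<gamma> X s = nabla X s + V.act \<gamma> X s"
  by (simp add: translate_connection_def)

lemma tr_conn:
  assumes N: "linear_connection M V nabla" and g: "\<gamma> \<in> F1"
  shows "linear_connection M V (tr nabla \<gamma>)"
  unfolding A_connection_def TM_simps anchor_field_TM
proof (intro conjI allI ballI impI)
  show "tr nabla \<gamma> X s = 0" if "X \<notin> Vect \<or> s \<notin> sections V" for X s
    using that by (auto simp: translate_connection_def)
  fix X s assume X: "X \<in> Vect" and s: "s \<in> sections V"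
  note E = V.form1_End[OF g X]
  note gT = V.form1_tensorial[OF g, unfolded T.tensorial_def TM_simps]
  show "tr nabla \<gamma> X s \<in> sections V"
    unfolding tr_apply[OF X s] by (intro V.section_add N_in[OF N] X s V.End_apply E)
  show "tr nabla \<gamma> (X + Y) s = tr nabla \<gamma> X s + tr nabla \<gamma> Y s" if Y: "Y \<in> Vect" for Y
    using gT X Y by (simp add: tr_apply vf_add s N_add_left[OF N] V.apply_add)
  show "tr nabla \<gamma> X (a *\<^sub>R s + b *\<^sub>R t) = a *\<^sub>R tr nabla \<gamma> X s + b *\<^sub>R tr nabla \<gamma> X t"
    if t: "t \<in> sections V" for t a b
  proof -
    have st: "a *\<^sub>R s \<in> sections V" "b *\<^sub>R t \<in> sections V" using s t by (auto intro: V.section_scaleR)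
    have "V.act \<gamma> X (c *\<^sub>R u) = c *\<^sub>R V.act \<gamma> X u" if "u \<in> sections V" for c u
      using V.End_apply_smul[OF E that, of "const_fn c"] V.scaleR_eq_smul[OF that] V.scaleR_eq_smul[OF V.End_apply[OF E that]] by simp
    then show ?thesis
      using s t by (simp add: tr_apply[OF X] V.section_add[OF st] V.End_apply_add[OF E st] N_add[OF N X st] N_scaleR[OF N X] algebra_simps)
  qed
  fix f assume f: "f \<in> Cinf"
  have gs: "eval_form \<gamma> [smul f X] = smul f (eval_form \<gamma> [X])" using gT f X by blast
  show "tr nabla \<gamma> (smul f X) s = smul f (tr nabla \<gamma> X s)"
    unfolding tr_apply[OF vf_smul[OF f X] s] tr_apply[OF X s] gs V.apply_smul N_smul_left[OF N X f s]
    by (simp add: fun_eq_iff algebra_simps)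
  show "tr nabla \<gamma> X (smul f s) = smul f (tr nabla \<gamma> X s) + smul (derive_by X f) s"
    unfolding tr_apply[OF X V.section_smul[OF f s]] tr_apply[OF X s] N_smul[OF N X s f] V.End_apply_smul[OF E s]
    by (simp add: fun_eq_iff algebra_simps)
qed

text \<open>The formula of \<open>invariance_T_apply\<close> and \<open>\<theta>(\<alpha>) = \<nabla>\<^sup>A\<^sub>\<alpha> - \<nabla>\<^sub>\<rho>\<^sub>\<alpha>\<close> are affine in the connection; adding \<open>\<gamma>\<close> to it
adds \<open>[\<gamma>(X), \<nabla>\<^sup>A\<^sub>\<alpha>] + \<gamma>([\<rho>\<alpha>, X])\<close> to the former and \<open>-\<gamma>(\<rho>\<alpha>)\<close> to the latter.\<close>

lemma inv_form_translate:
  assumes N: "linear_connection M V nabla" and g: "\<gamma> \<in> F1"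
  shows "inv_form (tr nabla \<gamma>) = inv_form nabla - \<delta> \<gamma>"
proof -
  note N' = tr_conn[OF N g]
  have T: "invariance_T M A V D (tr nabla \<gamma>) \<alpha> = invariance_T M A V D nabla \<alpha> - \<L> \<alpha> \<gamma>"
    if a: "\<alpha> \<in> sections A" for \<alpha>
  proof (rule V.form1_ext[OF invariance_T_F1[OF N' a] V.form1_diff[OF invariance_T_F1[OF N a] lie_derivative_F1[OF a g]]])
    fix X s assume X: "X \<in> Vect" and s: "s \<in> sections V"
    have bx: "bracket TM (\<rho> \<alpha>) X \<in> Vect" by (intro vf_bracket rho_vf a X)
    have d: "D \<alpha> (nabla X s + V.act \<gamma> X s) = D \<alpha> (nabla X s) + D \<alpha> (V.act \<gamma> X s)"
      by (intro D_add a N_in[OF N] X s V.End_apply V.form1_End g)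
    show "V.act (invariance_T M A V D (tr nabla \<gamma>) \<alpha>) X s =
       V.act (invariance_T M A V D nabla \<alpha> - \<L> \<alpha> \<gamma>) X s"
      unfolding V.eval_diff V.apply_diff invariance_T_apply[OF N' a X s] invariance_T_apply[OF N a X s] lie_derivative_apply[OF a g X s]
        tr_apply[OF X s] tr_apply[OF X D_in[OF a s]] tr_apply[OF bx s] d
      by (simp add: algebra_simps)
  qed
  have th: "invariance_theta M A V D (tr nabla \<gamma>) x a e = invariance_theta M A V D nabla x a e - \<gamma> x [anchor A x a] e"
    if x: "x \<in> points M" and a: "a \<in> fibre A x" for x a e
  proof (cases "e \<in> fibre V x")
    case True
    obtain \<alpha> s where al: "\<alpha> \<in> sections A" "\<alpha> x = a" "s \<in> sections V" "s x = e"
      using A.extend[OF x a] V.extend[OF x True] by blast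
    have "\<rho> \<alpha> x = anchor A x a" by (simp add: rho_at al(2))
    then show ?thesis
      using fun_cong[OF theta_apply[OF N' al(1,3)], of x] fun_cong[OF theta_apply[OF N al(1,3)], of x]
      by (simp add: tr_apply[OF rho_vf[OF al(1)] al(3)] al(2,4) V.eval_form_single diff_diff_eq)
  next
    case False
    then have "\<gamma> x [anchor A x a] e = 0"
      using V.form1_hom[OF g x anchor_in[OF x a]] by (simp add: hom_space_def)
    then show ?thesis using False by (simp add: invariance_theta_def)
  qed
  show ?thesis
  proof (rule prod_eqI)
    show "fst (inv_form (tr nabla \<gamma>)) = fst (inv_form nabla - \<delta> \<gamma>)"
    proof
      fix \<alpha> show "fst (inv_form (tr nabla \<gamma>)) \<alpha> = fst (inv_form nabla - \<delta> \<gamma>) \<alpha>"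
        using T[of \<alpha>] by (cases "\<alpha> \<in> sections A") (auto simp: invariance_form_def delta0_def invariance_T_def)
    qed
    show "snd (inv_form (tr nabla \<gamma>)) = snd (inv_form nabla - \<delta> \<gamma>)"
    proof (intro ext)
      fix x a vs e
      show "snd (inv_form (tr nabla \<gamma>)) x a vs e = snd (inv_form nabla - \<delta> \<gamma>) x a vs e"
      proof (cases "x \<in> points M \<and> a \<in> fibre A x")
        case True
        then show ?thesis using th[of x a e] V.form1_off[OF g, of x "anchor A x a" vs]
          by (cases "vs = []") (auto simp: invariance_form_def delta0_def)
      next
        case False
        then show ?thesis by (auto simp: invariance_form_def delta0_def invariance_theta_def)
      qed
    qed
  qed
qed

lemma tr_zero:
  assumes N: "linear_connection M V nabla" shows "tr nabla 0 = nabla"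
proof (intro ext)
  fix X s x show "tr nabla 0 X s x = nabla X s x"
    using N_off[OF N, of X s] by (auto simp: translate_connection_def V.eval_zero V.apply_zero)
qed

lemma tr_tr: "tr (tr nabla \<gamma>) \<gamma>' = tr nabla (\<gamma> + \<gamma>')"
  by (auto simp: translate_connection_def fun_eq_iff V.eval_add V.apply_add)

lemma tr_inj:
  assumes "\<gamma> \<in> F1" "\<gamma>' \<in> F1" "tr nabla \<gamma> = tr nabla \<gamma>'" shows "\<gamma> = \<gamma>'"
proof (rule V.form1_ext[OF assms(1,2)])
  fix X s assume X: "X \<in> Vect" and s: "s \<in> sections V"
  have "tr nabla \<gamma> X s = tr nabla \<gamma>' X s" using assms(3) by simp
  then show "V.act \<gamma> X s = V.act \<gamma>' X s"
    unfolding tr_apply[OF X s] by simp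
qed

text \<open>In the difference of two connections the derivatives of the Leibniz rules cancel.\<close>

lemma tr_exists:
  assumes N: "linear_connection M V nabla" and N': "linear_connection M V nabla'"
  shows "\<exists>\<gamma>\<in>F1. tr nabla \<gamma> = nabla'"
proof -
  let ?d = "\<lambda>X s. nabla' X s - nabla X s"
  have op: "V.end_op (?d X)" if X: "X \<in> Vect" for X
  proof (rule V.end_opI)
    show "?d X s \<in> sections V" if "s \<in> sections V" for s
      by (intro V.section_diff N_in[OF N] N_in[OF N'] X that)
    show "?d X (s + t) = ?d X s + ?d X t" if "s \<in> sections V" "t \<in> sections V" for s t
      by (simp add: N_add[OF N X that] N_add[OF N' X that])
    show "?d X (smul f s) = smul f (?d X s)" if "f \<in> Cinf" "s \<in> sections V" for f s
      by (simp add: N_smul[OF N X that(2,1)] N_smul[OF N' X that(2,1)] fun_eq_iff algebra_simps)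
  qed
  let ?\<Psi> = "\<lambda>X. V.end_of (?d X)"
  have E: "?\<Psi> X \<in> sections EndV" if "X \<in> Vect" for X using V.end_of_in[OF op[OF that]] .
  have ap: "apply_section (?\<Psi> X) s = ?d X s" if "X \<in> Vect" "s \<in> sections V" for X s
    using V.end_of_apply[OF op[OF that(1)] that(2)] .
  have tens: "T.tensorial ?\<Psi>"
  proof (rule V.End_tensorialI[OF E ap])
    show "T.tensorial (\<lambda>X. ?d X s)" if s: "s \<in> sections V" for s
      by (rule T.tensorialI)
         (simp_all add: N_add_left[OF N] N_add_left[OF N'] N_smul_left[OF N] N_smul_left[OF N'] s fun_eq_iff algebra_simps)
  qed
  let ?g = "V.form_of ?\<Psi>"
  have "tr nabla ?g X s = nabla' X s" for X s
  proof (cases "X \<in> Vect \<and> s \<in> sections V")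
    case True
    then have X: "X \<in> Vect" and s: "s \<in> sections V" by auto
    have "eval_form ?g [X] = ?\<Psi> X" by (intro V.form_of_eval tens E X)
    then show ?thesis by (simp add: tr_apply[OF X s] ap[OF X s])
  next
    case False
    then show ?thesis using N_off[OF N', of X s] by (auto simp: translate_connection_def)
  qed
  then have "tr nabla ?g = nabla'" by blast
  moreover have "?g \<in> F1" by (rule V.form_of_in[OF tens E])
  ultimately show ?thesis by blast
qed

lemma invariant_conn: "nabla \<in> invariant_connections M A V D \<longleftrightarrow> linear_connection M V nabla \<and> inv_form nabla = 0"
  using invariant_iff by (auto simp: invariant_connections_def)

lemma invariant_connections_affine: "affine_space_over (invariant_connections M A V D) (invariant_forms M A 1 EndV DE) tr"
  unfolding affine_space_over_def
proof (intro conjI ballI)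
  let ?I = "invariant_forms M A 1 EndV DE"
  have I: "\<gamma> \<in> ?I \<longleftrightarrow> \<gamma> \<in> F1 \<and> \<delta> \<gamma> = 0" for \<gamma> by (simp add: invariant_forms_def)
  show "subspace ?I"
    by (rule subspaceI)
       (auto simp: I delta_zero delta_add delta_scaleR simp del: One_nat_def
         intro: V.form1_zero V.form1_add V.form1_scaleR)
  fix p assume "p \<in> invariant_connections M A V D"
  then have p: "linear_connection M V p" "inv_form p = 0" by (auto simp: invariant_conn)
  show "tr p 0 = p" by (rule tr_zero[OF p(1)])
  show "tr p u \<in> invariant_connections M A V D" if "u \<in> ?I" for u
    using that tr_conn[OF p(1)] inv_form_translate[OF p(1)] p(2)
    by (simp add: invariant_conn I del: One_nat_def)
  show "tr (tr p u) v = tr p (u + v)" for u v by (rule tr_tr)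
  fix p' assume "p' \<in> invariant_connections M A V D"
  then have p': "linear_connection M V p'" "inv_form p' = 0" by (auto simp: invariant_conn)
  obtain u where u: "u \<in> F1" "tr p u = p'" using tr_exists[OF p(1) p'(1)] by blast
  then have "\<delta> u = 0" using inv_form_translate[OF p(1) u(1)] p(2) p'(2) by simp
  then show "\<exists>!u. u \<in> ?I \<and> tr p u = p'"
    using u tr_inj by (intro ex1I[of _ u]) (auto simp: I simp del: One_nat_def)
qed

lemma cohomologous_iff:
  "(c, c') \<in> cohomologous M A 1 EndV DE \<longleftrightarrow>
     c \<in> im_forms M A 1 EndV DE \<and> c' \<in> im_forms M A 1 EndV DE \<and> c - c' \<in> \<delta> ` F1"
  by (simp add: cohomologous_def)

lemma im_class_eq:
  assumes "c \<in> im_forms M A 1 EndV DE" "c' \<in> im_forms M A 1 EndV DE" "c - c' \<in> \<delta> ` F1"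
  shows "im_class M A 1 EndV DE c = im_class M A 1 EndV DE c'"
proof -
  have "c - d \<in> \<delta> ` F1 \<longleftrightarrow> c' - d \<in> \<delta> ` F1" for d
    using subspace_add[OF delta_image_subspace assms(3), of "c' - d"]
      subspace_diff[OF delta_image_subspace _ assms(3), of "c - d"] by auto
  then have "(c, d) \<in> cohomologous M A 1 EndV DE \<longleftrightarrow> (c', d) \<in> cohomologous M A 1 EndV DE" for d
    using assms(1,2) unfolding cohomologous_iff by blast
  then show ?thesis unfolding im_class_def by blast
qed

lemma inv_form_cohomologous:
  assumes N: "linear_connection M V nabla" and N': "linear_connection M V nabla'"
  shows "inv_form nabla - inv_form nabla' \<in> \<delta> ` F1"
proof -
  obtain \<gamma> where g: "\<gamma> \<in> F1" "tr nabla \<gamma> = nabla'" using tr_exists[OF N N'] by blast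
  then have "inv_form nabla - inv_form nabla' = \<delta> \<gamma>" using inv_form_translate[OF N g(1)] by simp
  then show ?thesis using g(1) by blast
qed

lemma some_connection: "linear_connection M V (SOME nabla. linear_connection M V nabla)"
  using someI_ex[OF nabla_exists] .

lemma class_eq_obstruction:
  assumes "linear_connection M V nabla"
  shows "im_class M A 1 EndV DE (inv_form nabla) = obstruction M A V D"
  unfolding obstruction_def
  by (intro im_class_eq invariance_form_im inv_form_cohomologous assms some_connection)

lemma obstruction_in_H1: "obstruction M A V D \<in> H1 M A 1 EndV DE"
  unfolding obstruction_def im_class_def H1_def
  by (rule quotientI[OF invariance_form_im[OF some_connection]])

text \<open>If \<open>(T, \<theta>) = \<delta>\<^sup>0\<gamma>\<close>, then \<open>\<nabla> + \<gamma>\<close> is invariant by \<open>inv_form_translate\<close> and \<open>invariant_iff\<close>.\<close>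

lemma invariant_connection_exists_iff:
  "(\<exists>nabla. nabla \<in> invariant_connections M A V D) \<longleftrightarrow> obstruction M A V D = im_class M A 1 EndV DE 0"
proof
  assume "\<exists>nabla. nabla \<in> invariant_connections M A V D"
  then obtain nabla where "linear_connection M V nabla" "inv_form nabla = 0" by (auto simp: invariant_conn)
  then show "obstruction M A V D = im_class M A 1 EndV DE 0" using class_eq_obstruction by metis
next
  assume eq: "obstruction M A V D = im_class M A 1 EndV DE 0"
  obtain nabla where N: "linear_connection M V nabla" using nabla_exists by blast
  have "inv_form nabla \<in> im_class M A 1 EndV DE (inv_form nabla)"
    using invariance_form_im[OF N] subspace_0[OF delta_image_subspace]
    by (simp add: im_class_def cohomologous_iff del: One_nat_def)
  then have "inv_form nabla \<in> im_class M A 1 EndV DE 0" using class_eq_obstruction[OF N] eq by simp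
  then have "0 - inv_form nabla \<in> \<delta> ` F1"
    by (simp add: im_class_def cohomologous_iff del: One_nat_def)
  then have "inv_form nabla \<in> \<delta> ` F1"
    using subspace_neg[OF delta_image_subspace, of "0 - inv_form nabla"] by simp
  then obtain \<gamma> where g: "\<gamma> \<in> F1" "inv_form nabla = \<delta> \<gamma>" by blast
  have "inv_form (tr nabla \<gamma>) = 0" using inv_form_translate[OF N g(1)] g(2) by simp
  then show "\<exists>nabla. nabla \<in> invariant_connections M A V D"
    using tr_conn[OF N g(1)] invariant_conn by blast
qed

end

theorem theorem3p16:
  fixes M :: "('m, 'b::euclidean_space) manifold"
    and A :: "('m, 'a::real_vector) algebroid"
    and V :: "('m, 'v::real_vector) vbundle"
    and D :: "('m, 'a, 'v) covariant"
  assumes "smooth_manifold M" and "lie_algebroid M A" and "vector_bundle M V"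
    and "representation M A V D"
  shows
    "(\<forall>nabla. linear_connection M V nabla \<longrightarrow>
        invariance_form M A V D nabla \<in> im_forms M A 1 (End_bundle M V) (End_connection M A V D)) \<and>
     affine_space_over (invariant_connections M A V D)
       (invariant_forms M A 1 (End_bundle M V) (End_connection M A V D))
       (translate_connection M V) \<and>
     (obstruction M A V D \<in> H1 M A 1 (End_bundle M V) (End_connection M A V D) \<and>
      (\<forall>nabla. linear_connection M V nabla \<longrightarrow>
        im_class M A 1 (End_bundle M V) (End_connection M A V D) (invariance_form M A V D nabla)
          = obstruction M A V D)) \<and>
     ((\<exists>nabla. nabla \<in> invariant_connections M A V D) \<longleftrightarrow>
        obstruction M A V D = im_class M A 1 (End_bundle M V) (End_connection M A V D) 0)"
proof -
  interpret smooth_mfd M using assms(1) by unfold_locales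
  interpret algebroid_rep M A V D using assms(2-4) by unfold_locales
  show ?thesis
    using invariance_form_im invariant_connections_affine obstruction_in_H1 class_eq_obstruction invariant_connection_exists_iff by blast
qed

end
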